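(* Let $\alpha\in\mathbb{N}_0^N$ be a partition ($\alpha_1\ge\alpha_2\ge\cdots\ge\alpha_N$) with $\ell(\alpha)=m<N$, and $T\in\mathcal{Y}(\tau)$. Then $$\mathcal{D}_m\zeta_{\alpha,T}=(\alpha_m+\kappa c(m,T))\,\theta_m^{-1}\zeta_{\widehat{\alpha},T}\prod_{j=m+1}^N\frac{(\alpha_m+\kappa(c(m,T)-c(j,T)-1))(\alpha_m+\kappa(c(m,T)-c(j,T)+1))}{(\alpha_m+\kappa(c(m,T)-c(j,T)))^2},$$ where $\widehat{\alpha}=(\alpha_m-1,\alpha_1,\dots,\alpha_{m-1},0,\dots,0)$.
   Context: $\tau$ is a partition of $N$; $\mathcal{Y}(\tau)$ is the set of reverse standard Young tableaux of shape $\tau$ (fillings of the Ferrers diagram with $1,\dots,N$ decreasing along rows and columns); $c(i,T)=\operatorname{col}(i,T)-\operatorname{row}(i,T)$. $V_\tau$ is the $\mathbb{R}(\kappa)$-space ($\kappa$ an indeterminate) with basis $\mathcal{Y}(\tau)$ and representation $\tau$ of $\mathcal{S}_N$ given on $s_i=(i,i+1)$ by: $\tau(s_i)T=T$ if $i,i+1$ share a row; $-T$ if they share a column; $T^{(i)}+\frac1bT$ if $b=c(i,T)-c(i+1,T)\ge2$; $(1-\frac1{b^2})T^{(i)}+\frac1bT$ if $b\le-2$ ($T^{(i)}$: $i,i+1$ interchanged). $\mathcal{P}_\tau=\mathcal{P}\otimes V_\tau$ with $\mathcal{S}_N$-action $w(x^\alpha\otimes T)=(xw)^\alpha\otimes\tau(w)T$,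 $(xw)_i=x_{w(i)}$. $\mathcal{D}_i(p\otimes T)=\frac{\partial p}{\partial x_i}\otimes T+\kappa\sum_{j\ne i}\frac{p(x)-p(x(i,j))}{x_i-x_j}\otimes\tau((i,j))T$; $\mathcal{U}_i(p\otimes T)=\mathcal{D}_i(x_ip\otimes T)-\kappa\sum_{j<i}p(x(i,j))\otimes\tau((i,j))T$. For $\alpha\in\mathbb{N}_0^N$: $\ell(\alpha)=\max\{i\colon\alpha_i>0\}$, $\alpha^+$ its nonincreasing rearrangement, rank $r_\alpha(i)=\#\{j\colon\alpha_j>\alpha_i\}+\#\{j\le i\colon\alpha_j=\alpha_i\}$. $\alpha\prec\beta$ iff $\alpha\ne\beta$ and $\sum_{j\le i}\alpha_j\le\sum_{j\le i}\beta_j$ for all $i$; $\alpha\lhd\beta$ iff $|\alpha|=|\beta|$ and ($\alpha^+\prec\beta^+$ or ($\alpha^+=\beta^+$ and $\alpha\prec\beta$)). $\zeta_{\alpha,T}$ is the unique element of the form $x^\alpha\otimes\tau(r_\alpha^{-1})T+\sum_{\beta\lhd\alpha}x^\beta\otimes t_{\alpha\beta}(\kappa)$ with $\mathcal{U}_i\zeta_{\alpha,T}=(\alpha_i+1+\kappa c(r_\alpha(i),T))\zeta_{\alpha,T}$ for all $i$. $\theta_m=s_1s_2\cdots s_{m-1}\in\mathcal{S}_N$ ($\theta_1=1$), acting via the $\mathcal{S}_N$-action. *)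

theory Defs
  imports "HOL-Computational_Algebra.Polynomial" "HOL-Computational_Algebra.Fraction_Field"
begin

type_synonym K = "real poly fract"

definition kappa :: K where "kappa = Fract [:0, 1:] 1"

definition is_partition :: "nat list \<Rightarrow> bool" where
  "is_partition tau \<longleftrightarrow> sorted (rev tau) \<and> 0 \<notin> set tau"

definition cells :: "nat list \<Rightarrow> (nat \<times> nat) set" where
  "cells tau = {(r, c). 1 \<le> r \<and> r \<le> length tau \<and> 1 \<le> c \<and> c \<le> tau ! (r - 1)}"

(* a tableau is represented by entry \<mapsto> (row, column); entries 1..N *)
type_synonym tableau = "nat \<Rightarrow> nat \<times> nat"

definition row :: "nat \<Rightarrow> tableau \<Rightarrow> nat" where "row i T = fst (T i)"
definition col :: "nat \<Rightarrow> tableau \<Rightarrow> nat" where "col i T = snd (T i)"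
definition content :: "nat \<Rightarrow> tableau \<Rightarrow> int" where
  "content i T = int (col i T) - int (row i T)"

definition RSYT :: "nat list \<Rightarrow> tableau set" where
  "RSYT tau = {T. (\<forall>i. i \<notin> {1..sum_list tau} \<longrightarrow> T i = (0, 0))
     \<and> bij_betw T {1..sum_list tau} (cells tau)
     \<and> (\<forall>i\<in>{1..sum_list tau}. \<forall>j\<in>{1..sum_list tau}.
          (row i T = row j T \<and> col i T < col j T \<longrightarrow> j < i) \<and>
          (col i T = col j T \<and> row i T < row j T \<longrightarrow> j < i))}"

definition tr :: "nat \<Rightarrow> nat \<Rightarrow> nat \<Rightarrow> nat" where
  "tr i j x = (if x = i then j else if x = j then i else x)"

(* elements of V_tau: coefficient functions on tableaux (supported on RSYT tau) *)
type_synonym vec = "tableau \<Rightarrow> K"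

definition vzero :: vec where "vzero = (\<lambda>_. 0)"
definition bvec :: "tableau \<Rightarrow> vec" where "bvec T = (\<lambda>S. if S = T then 1 else 0)"

definition tau_s_basis :: "nat \<Rightarrow> tableau \<Rightarrow> vec" where
  "tau_s_basis i T =
    (if row i T = row (Suc i) T then bvec T
     else if col i T = col (Suc i) T then (\<lambda>S. - bvec T S)
     else let b = content i T - content (Suc i) T in
       if 2 \<le> b then (\<lambda>S. bvec (T \<circ> tr i (Suc i)) S + (1 / of_int b) * bvec T S)
       else (\<lambda>S. (1 - 1 / (of_int b)^2) * bvec (T \<circ> tr i (Suc i)) S + (1 / of_int b) * bvec T S))"

definition tau_s :: "nat list \<Rightarrow> nat \<Rightarrow> vec \<Rightarrow> vec" where
  "tau_s tau i v = (\<lambda>S. \<Sum>T\<in>RSYT tau. v T * tau_s_basis i T S)"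

fun wprod :: "nat list \<Rightarrow> nat \<Rightarrow> nat" where
  "wprod [] = id"
| "wprod (i # is) = tr i (Suc i) \<circ> wprod is"

fun tau_word :: "nat list \<Rightarrow> nat list \<Rightarrow> vec \<Rightarrow> vec" where
  "tau_word tau [] v = v"
| "tau_word tau (i # is) v = tau_s tau i (tau_word tau is v)"

definition tau_rep :: "nat list \<Rightarrow> (nat \<Rightarrow> nat) \<Rightarrow> vec \<Rightarrow> vec" where
  "tau_rep tau w = tau_word tau (SOME is. set is \<subseteq> {1..<sum_list tau} \<and> wprod is = w)"

definition monomial_exp :: "nat \<Rightarrow> (nat \<Rightarrow> nat) \<Rightarrow> bool" where
  "monomial_exp N \<alpha> \<longleftrightarrow> (\<forall>i. i \<notin> {1..N} \<longrightarrow> \<alpha> i = 0)"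

(* an element of P_tau: coefficient of x^beta, a vector of V_tau *)
type_synonym pvec = "(nat \<Rightarrow> nat) \<Rightarrow> vec"

(* w(x^alpha \<otimes> T) = (xw)^alpha \<otimes> tau(w) T *)
definition act :: "nat list \<Rightarrow> (nat \<Rightarrow> nat) \<Rightarrow> pvec \<Rightarrow> pvec" where
  "act tau w f = (\<lambda>\<beta>. tau_rep tau w (f (\<beta> \<circ> w)))"

definition mulx :: "nat \<Rightarrow> pvec \<Rightarrow> pvec" where
  "mulx i f = (\<lambda>\<beta>. if 0 < \<beta> i then f (\<beta>(i := \<beta> i - 1)) else vzero)"

definition dx :: "nat \<Rightarrow> pvec \<Rightarrow> pvec" where
  "dx i f = (\<lambda>\<beta> S. of_nat (\<beta> i + 1) * f (\<beta>(i := \<beta> i + 1)) S)"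

(* coefficient of x^gamma in (x^alpha - x^(alpha (i,j)))/(x_i - x_j), where only the
   i-th and j-th exponents a = alpha_i, b = alpha_j vary and a + b = gamma_i + gamma_j + 1 *)
definition ddiff_coef :: "nat \<Rightarrow> nat \<Rightarrow> nat \<Rightarrow> K" where
  "ddiff_coef a b gi =
     (if b < a \<and> b \<le> gi \<and> gi + 1 \<le> a then 1
      else if a < b \<and> a \<le> gi \<and> gi + 1 \<le> b then -1 else 0)"

(* divided difference (p(x) - p(x(i,j)))/(x_i - x_j), coefficientwise *)
definition ddiff :: "nat \<Rightarrow> nat \<Rightarrow> pvec \<Rightarrow> pvec" where
  "ddiff i j f = (\<lambda>\<gamma> S. \<Sum>a\<in>{0..\<gamma> i + \<gamma> j + 1}.
      ddiff_coef a (\<gamma> i + \<gamma> j + 1 - a) (\<gamma> i) *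
      f (\<gamma>(i := a, j := \<gamma> i + \<gamma> j + 1 - a)) S)"

definition Dunkl :: "nat list \<Rightarrow> nat \<Rightarrow> pvec \<Rightarrow> pvec" where
  "Dunkl tau i f = (\<lambda>\<beta> S. dx i f \<beta> S +
      kappa * (\<Sum>j\<in>{1..sum_list tau} - {i}. tau_rep tau (tr i j) (ddiff i j f \<beta>) S))"

definition Uop :: "nat list \<Rightarrow> nat \<Rightarrow> pvec \<Rightarrow> pvec" where
  "Uop tau i f = (\<lambda>\<beta> S. Dunkl tau i (mulx i f) \<beta> S -
      kappa * (\<Sum>j\<in>{1..<i}. act tau (tr i j) f \<beta> S))"

definition rank :: "nat \<Rightarrow> (nat \<Rightarrow> nat) \<Rightarrow> nat \<Rightarrow> nat" where
  "rank N \<alpha> i = (if i \<in> {1..N} then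
       card {j\<in>{1..N}. \<alpha> i < \<alpha> j} + card {j\<in>{1..i}. \<alpha> j = \<alpha> i} else i)"

definition plus_rearr :: "nat \<Rightarrow> (nat \<Rightarrow> nat) \<Rightarrow> nat \<Rightarrow> nat" where
  "plus_rearr N \<alpha> i = (if i \<in> {1..N} then rev (sort (map \<alpha> [1..<N+1])) ! (i - 1) else 0)"

definition prec :: "nat \<Rightarrow> (nat \<Rightarrow> nat) \<Rightarrow> (nat \<Rightarrow> nat) \<Rightarrow> bool" where
  "prec N \<alpha> \<beta> \<longleftrightarrow> \<alpha> \<noteq> \<beta> \<and> (\<forall>i\<in>{1..N}. (\<Sum>j\<in>{1..i}. \<alpha> j) \<le> (\<Sum>j\<in>{1..i}. \<beta> j))"

definition dlt :: "nat \<Rightarrow> (nat \<Rightarrow> nat) \<Rightarrow> (nat \<Rightarrow> nat) \<Rightarrow> bool" where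
  "dlt N \<alpha> \<beta> \<longleftrightarrow> (\<Sum>j\<in>{1..N}. \<alpha> j) = (\<Sum>j\<in>{1..N}. \<beta> j) \<and>
     (prec N (plus_rearr N \<alpha>) (plus_rearr N \<beta>) \<or>
      (plus_rearr N \<alpha> = plus_rearr N \<beta> \<and> prec N \<alpha> \<beta>))"

definition zeta_cond :: "nat list \<Rightarrow> (nat \<Rightarrow> nat) \<Rightarrow> tableau \<Rightarrow> pvec \<Rightarrow> bool" where
  "zeta_cond tau \<alpha> T f \<longleftrightarrow>
     f \<alpha> = tau_rep tau (inv (rank (sum_list tau) \<alpha>)) (bvec T) \<and>
     (\<forall>\<beta>. \<beta> \<noteq> \<alpha> \<and> \<not> (monomial_exp (sum_list tau) \<beta> \<and> dlt (sum_list tau) \<beta> \<alpha>) \<longrightarrow> f \<beta> = vzero) \<and>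
     (\<forall>\<beta> S. f \<beta> S \<noteq> 0 \<longrightarrow> S \<in> RSYT tau) \<and>
     (\<forall>i\<in>{1..sum_list tau}. Uop tau i f =
        (\<lambda>\<beta> S. (of_nat (\<alpha> i + 1) + kappa * of_int (content (rank (sum_list tau) \<alpha> i) T)) * f \<beta> S))"

definition zeta :: "nat list \<Rightarrow> (nat \<Rightarrow> nat) \<Rightarrow> tableau \<Rightarrow> pvec" where
  "zeta tau \<alpha> T = (THE f. zeta_cond tau \<alpha> T f)"

definition ell :: "(nat \<Rightarrow> nat) \<Rightarrow> nat" where
  "ell \<alpha> = (if \<exists>i. 0 < \<alpha> i then Max {i. 0 < \<alpha> i} else 0)"

definition theta :: "nat \<Rightarrow> nat \<Rightarrow> nat" where "theta m = wprod [1..<m]"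

definition alpha_hat :: "nat \<Rightarrow> (nat \<Rightarrow> nat) \<Rightarrow> nat \<Rightarrow> nat" where
  "alpha_hat m \<alpha> = (\<lambda>i. if i = 1 then \<alpha> m - 1 else if 2 \<le> i \<and> i \<le> m then \<alpha> (i - 1) else 0)"

end

theory Submission
  imports Defs "HOL-Combinatorics.Permutations"
begin

text \<open>
  By triangularity and the Jucys--Murphy elements, a joint eigenvector of the \<open>Uop tau i\<close> with
  finite support is determined by its spectrum and one coefficient: at a maximal exponent of its
  support the spectrum forces both the exponent and the tableau. Hence \<open>zeta\<close> is obtained from
  \<open>1 \<otimes> T\<close> by two kinds of steps, \<open>f \<mapsto> s\<^sub>i f - b f\<close> and \<open>f \<mapsto> x\<^sub>N \<theta>\<^sub>N\<^sup>-\<^sup>1 f\<close>. Let \<open>f\<^sub>j\<close> be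
  \<open>zeta\<close> for the exponent in which the last nonzero part of \<open>\<alpha>\<close> has been moved from place \<open>m\<close> to
  place \<open>j\<close>. Since \<open>Dunkl tau (j + 1)\<close> kills \<open>f\<^sub>j\<close>, the relation
  \<open>f\<^sub>j = s\<^sub>j f\<^sub>j\<^sub>+\<^sub>1 + (kappa / z) f\<^sub>j\<^sub>+\<^sub>1\<close> with \<open>z = \<alpha>\<^sub>m + kappa (c(m,T) - c(j+1,T))\<close> gives
  \<open>D\<^sub>j f\<^sub>j = (1 - kappa\<^sup>2 / z\<^sup>2) s\<^sub>j D\<^sub>j\<^sub>+\<^sub>1 f\<^sub>j\<^sub>+\<^sub>1\<close>, which telescopes down from
  \<open>f\<^sub>N = x\<^sub>N \<theta>\<^sub>N\<^sup>-\<^sup>1 zeta (alpha_hat)\<close>.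
\<close>

section \<open>Reverse standard Young tableaux\<close>

text \<open>Two definitions cannot be computed with directly. \<open>tau_rep\<close> evaluates a
  word picked by \<open>SOME\<close>, so even multiplicativity of the action rests on the braid
  relations and on the fact that Coxeter moves connect any two words for one permutation.
  \<open>zeta\<close> is a definite description, so existence has to be earned: both steps are shown
  to carry nonzero eigenvectors to nonzero eigenvectors, and the exchange step could break down only
  for \<open>b\<^sup>2 = 1\<close>, which the indeterminate \<open>kappa\<close> rules out as soon
  as the two exponents differ. The vanishing of \<open>Dunkl tau (j + 1)\<close> on
  \<open>f\<^sub>j\<close> is immediate from the spectrum when \<open>j + 1 = N\<close>, because
  \<open>Uop tau N\<close> is \<open>x\<^sub>N D\<^sub>N + 1\<close>. The factor
  \<open>\<alpha>\<^sub>m + kappa c(m,T)\<close> is the eigenvalue of \<open>Uop tau N\<close> on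
  \<open>f\<^sub>N\<close>, minus 1.\<close>

lemma tr_eq_transpose: "tr i j = Transposition.transpose i j"
  by (auto simp: tr_def Transposition.transpose_def fun_eq_iff)

lemma tr_simps [simp]:
  "tr i j i = j" "tr i j j = i" "k \<noteq> i \<Longrightarrow> k \<noteq> j \<Longrightarrow> tr i j k = k"
  by (auto simp: tr_def)

lemma tr_tr [simp]: "tr i j (tr i j k) = k"
  by (auto simp: tr_def)

lemma tr_comp_tr [simp]: "tr i j \<circ> tr i j = id"
  by auto

lemma tr_comp_tr_assoc [simp]: "f \<circ> tr i j \<circ> tr i j = f"
  by (auto simp: fun_eq_iff)

lemma tr_permutes:
  assumes "i \<in> {1..n}" "j \<in> {1..n}"
  shows "tr i j permutes {1..n}"
  using assms unfolding tr_eq_transpose by (intro permutes_swap_id) auto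

lemma cells_closed:
  assumes "is_partition tau" "(r', c') \<in> cells tau" "1 \<le> r" "r \<le> r'" "1 \<le> c" "c \<le> c'"
  shows "(r, c) \<in> cells tau"
proof -
  have "tau ! (r' - 1) \<le> tau ! (r - 1)"
    using assms unfolding is_partition_def cells_def
    by (intro sorted_rev_nth_mono) auto
  then show ?thesis
    using assms by (auto simp: cells_def)
qed

locale young_shape =
  fixes tau :: "nat list" and N :: nat
  assumes part: "is_partition tau" and size: "sum_list tau = N"
begin

abbreviation "Y \<equiv> RSYT tau"

lemma RSYT_iff:
  "T \<in> Y \<longleftrightarrow> (\<forall>i. i \<notin> {1..N} \<longrightarrow> T i = (0, 0)) \<and> bij_betw T {1..N} (cells tau) \<and>
     (\<forall>i\<in>{1..N}. \<forall>j\<in>{1..N}. (row i T = row j T \<and> col i T < col j T \<longrightarrow> j < i) \<and>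
        (col i T = col j T \<and> row i T < row j T \<longrightarrow> j < i))"
  by (simp add: RSYT_def size)

lemma tableau_inj:
  assumes "T \<in> Y" "i \<in> {1..N}" "j \<in> {1..N}" "T i = T j"
  shows "i = j"
  using assms unfolding RSYT_iff bij_betw_def inj_on_def by blast

lemma tableau_cell:
  assumes "T \<in> Y" "i \<in> {1..N}"
  shows "(row i T, col i T) \<in> cells tau"
  using assms unfolding RSYT_iff bij_betw_def row_def col_def by auto

lemma tableau_surj:
  assumes "T \<in> Y" "(r, c) \<in> cells tau"
  obtains k where "k \<in> {1..N}" "T k = (r, c)"
  using assms unfolding RSYT_iff bij_betw_def by (metis imageE)

text \<open>The cell in the row of \<open>i\<close> and the column of \<open>j\<close> belongs to
  the diagram. Its entry is at most \<open>i\<close> along the row and at least \<open>j\<close>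
  along the column.\<close>

lemma tableau_antimono:
  assumes T: "T \<in> Y" and i: "i \<in> {1..N}" and j: "j \<in> {1..N}"
    and rc: "row i T \<le> row j T" "col i T \<le> col j T"
  shows "j \<le> i"
proof -
  have ci: "(row i T, col i T) \<in> cells tau" and cj: "(row j T, col j T) \<in> cells tau"
    using tableau_cell T i j by auto
  have "(row i T, col j T) \<in> cells tau"
    by (rule cells_closed[OF part cj]) (use ci cj rc in \<open>auto simp: cells_def\<close>)
  then obtain k where k: "k \<in> {1..N}" "T k = (row i T, col j T)"
    using tableau_surj[OF T] by blast
  then have rk: "row k T = row i T" "col k T = col j T"
    by (simp_all add: row_def col_def)
  have "k \<le> i"
  proof (cases "col i T = col j T")
    case True
    then have "T k = T i" using k by (simp add: row_def col_def prod_eq_iff)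
    then show ?thesis using tableau_inj[OF T] k i by auto
  next
    case False
    then have "k < i" using T k i rc rk unfolding RSYT_iff by auto
    then show ?thesis by simp
  qed
  moreover have "j \<le> k"
  proof (cases "row i T = row j T")
    case True
    then have "T k = T j" using k by (simp add: row_def col_def prod_eq_iff)
    then show ?thesis using tableau_inj[OF T] k j by auto
  next
    case False
    then have "j < k" using T k j rc rk unfolding RSYT_iff by auto
    then show ?thesis by simp
  qed
  ultimately show ?thesis by simp
qed

lemma finite_RSYT: "finite Y"
proof -
  have "finite (cells tau)"
    by (rule finite_subset[of _ "{1..length tau} \<times> {1..Max (set tau)}"])
       (auto simp: cells_def intro!: order_trans[OF _ Max_ge[OF _ nth_mem]])
  then have "finite {f. \<forall>i. (i \<in> {1..N} \<longrightarrow> f i \<in> cells tau) \<and> (i \<notin> {1..N} \<longrightarrow> f i = (0, 0))}"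
    by (intro finite_set_of_finite_funs) auto
  then show ?thesis
    by (rule rev_finite_subset) (auto simp: RSYT_iff intro: bij_betw_apply)
qed

text \<open>The larger entry \<open>j\<close> sits up and to the left of \<open>i\<close>. The right
  and the lower neighbour of its cell carry two distinct entries strictly between \<open>i\<close>
  and \<open>j\<close>.\<close>

lemma same_diagonal_gap:
  assumes T: "T \<in> Y" and i: "i \<in> {1..N}" and j: "j \<in> {1..N}"
    and c: "content i T = content j T" and "i < j"
  shows "i + 3 \<le> j"
proof -
  have ci: "(row i T, col i T) \<in> cells tau" and cj: "(row j T, col j T) \<in> cells tau"
    using tableau_cell T i j by auto
  have "\<not> row i T \<le> row j T"
    using tableau_antimono[OF T i j] c \<open>i < j\<close> by (auto simp: content_def)
  then have less: "row j T < row i T" "col j T < col i T"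
    using c by (auto simp: content_def)
  have "(row j T, Suc (col j T)) \<in> cells tau" "(Suc (row j T), col j T) \<in> cells tau"
    by (rule cells_closed[OF part ci]; use ci cj less in \<open>auto simp: cells_def\<close>)+
  then obtain k l where k: "k \<in> {1..N}" "T k = (row j T, Suc (col j T))"
    and l: "l \<in> {1..N}" "T l = (Suc (row j T), col j T)"
    using tableau_surj[OF T] by metis
  have "k \<le> j" "i \<le> k" "l \<le> j" "i \<le> l"
    using tableau_antimono[OF T j k(1)] tableau_antimono[OF T k(1) i]
      tableau_antimono[OF T j l(1)] tableau_antimono[OF T l(1) i] k(2) l(2) less
    by (auto simp: row_def col_def)
  moreover have "k \<noteq> j" "l \<noteq> j" "k \<noteq> l" "k \<noteq> i" "l \<noteq> i"
    using k(2) l(2) less by (auto simp: row_def col_def prod_eq_iff)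
  ultimately show ?thesis
    by linarith
qed

text \<open>In the reverse convention the largest entry occupies the corner \<open>(1, 1)\<close>.
  This anchors the downward inductions for the Jucys--Murphy elements and for the Dunkl
  operators.\<close>

lemma content_last:
  assumes T: "T \<in> Y" and "1 \<le> N"
  shows "content N T = 0"
proof -
  have N: "N \<in> {1..N}" using \<open>1 \<le> N\<close> by simp
  have cN: "(row N T, col N T) \<in> cells tau" using tableau_cell[OF T N] .
  have "(1, 1) \<in> cells tau"
    by (rule cells_closed[OF part cN]) (use cN in \<open>auto simp: cells_def\<close>)
  then obtain k where k: "k \<in> {1..N}" "T k = (1, 1)"
    using tableau_surj[OF T] by metis
  have "N \<le> k"
    using tableau_antimono[OF T k(1) N] k(2) cN by (auto simp: row_def col_def cells_def)
  then have "k = N" using k(1) by auto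
  then show ?thesis using k(2) by (simp add: content_def row_def col_def)
qed

text \<open>Entries are placed from \<open>N\<close> downwards. If \<open>S\<close> and
  \<open>T\<close> agree above \<open>i\<close>, then \<open>i\<close> cannot sit further up its
  diagonal in \<open>S\<close> than in \<open>T\<close>: its cell in \<open>S\<close> would carry in
  \<open>T\<close> some \<open>k > i\<close>, and this \<open>k\<close> occupies the same cell in
  \<open>S\<close>.\<close>

lemma tableau_eqI:
  assumes S: "S \<in> Y" and T: "T \<in> Y"
    and c: "\<And>i. i \<in> {1..N} \<Longrightarrow> content i S = content i T"
  shows "S = T"
proof -
  have *: "row i T \<le> row i S"
    if S: "S \<in> Y" and T: "T \<in> Y" and i: "i \<in> {1..N}" and c: "content i S = content i T"
      and above: "\<And>k. i < k \<Longrightarrow> k \<le> N \<Longrightarrow> S k = T k" for i S T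
  proof (rule ccontr)
    assume "\<not> row i T \<le> row i S"
    then have less: "row i S < row i T" "col i S < col i T"
      using c by (auto simp: content_def)
    have "(row i S, col i S) \<in> cells tau"
      using tableau_cell[OF S i] .
    then obtain k where k: "k \<in> {1..N}" "T k = (row i S, col i S)"
      using tableau_surj[OF T] by metis
    have "i \<le> k"
      using tableau_antimono[OF T k(1) i] k(2) less by (auto simp: row_def col_def)
    moreover have "k \<noteq> i" using k(2) less by (auto simp: row_def col_def)
    ultimately have "S k = S i" using above[of k] k by (auto simp: row_def col_def)
    then show False using tableau_inj[OF S k(1) i] \<open>k \<noteq> i\<close> by simp
  qed
  have "S i = T i" if "i \<in> {1..N}" for i
    using that
  proof (induction "N - i" arbitrary: i rule: less_induct)
    case less
    have above: "S k = T k" if "i < k" "k \<le> N" for k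
      using less.hyps[of k] less.prems that by auto
    have "row i T \<le> row i S" "row i S \<le> row i T"
      using *[OF S T less.prems c[OF less.prems]] *[OF T S less.prems c[OF less.prems, symmetric]] above
      by auto
    then show ?case
      using c[OF less.prems] by (auto simp: content_def row_def col_def prod_eq_iff)
  qed
  moreover have "S i = T i" if "i \<notin> {1..N}" for i
    using that S T by (simp add: RSYT_iff)
  ultimately show ?thesis by blast
qed

section \<open>Consecutive entries, their content difference and their exchange\<close>

definition gap :: "nat \<Rightarrow> tableau \<Rightarrow> int" where
  "gap i T = content i T - content (Suc i) T"

lemma content_comp: "content i (T \<circ> w) = content (w i) T"
  by (simp add: content_def row_def col_def)

text \<open>Every cell of the rectangle spanned by \<open>Suc i\<close> (upper left) and
  \<open>i\<close> (lower right) holds \<open>i\<close> or \<open>Suc i\<close>. Hence in a common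
  row or column the two are neighbours, and \<open>i\<close> cannot be both strictly below and
  strictly to the right. In the remaining positions the row and column differences reinforce each
  other in the content.\<close>

lemma gap_cases:
  assumes T: "T \<in> Y" and i: "1 \<le> i" "i < N"
  shows "row i T = row (Suc i) T \<and> gap i T = 1 \<or> col i T = col (Suc i) T \<and> gap i T = -1 \<or>
    row i T \<noteq> row (Suc i) T \<and> col i T \<noteq> col (Suc i) T \<and> 2 \<le> \<bar>gap i T\<bar>"
proof -
  have iN: "i \<in> {1..N}" "Suc i \<in> {1..N}" using i by auto
  note ci = tableau_cell[OF T iN(1)] and cj = tableau_cell[OF T iN(2)]
  have nle: "\<not> (row i T \<le> row (Suc i) T \<and> col i T \<le> col (Suc i) T)"
    using tableau_antimono[OF T iN] by auto
  have between: "\<not> ((r, c) \<in> cells tau \<and> row (Suc i) T \<le> r \<and> col (Suc i) T \<le> c \<and>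
      r \<le> row i T \<and> c \<le> col i T \<and> (r, c) \<noteq> T i \<and> (r, c) \<noteq> T (Suc i))" for r c
  proof
    assume a: "(r, c) \<in> cells tau \<and> row (Suc i) T \<le> r \<and> col (Suc i) T \<le> c \<and>
      r \<le> row i T \<and> c \<le> col i T \<and> (r, c) \<noteq> T i \<and> (r, c) \<noteq> T (Suc i)"
    then obtain k where k: "k \<in> {1..N}" "T k = (r, c)"
      using tableau_surj[OF T] by metis
    have "i \<le> k" "k \<le> Suc i"
      using tableau_antimono[OF T k(1) iN(1)] tableau_antimono[OF T iN(2) k(1)] a k(2)
      by (auto simp: row_def col_def)
    then show False using a k(2) by (cases "k = i") (auto simp: le_Suc_eq)
  qed
  have cell: "(r, c) \<in> cells tau" if "row (Suc i) T \<le> r" "col (Suc i) T \<le> c"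
    "r \<le> row i T" "c \<le> col i T" for r c
    by (rule cells_closed[OF part ci]) (use that cj in \<open>auto simp: cells_def\<close>)
  consider "row i T = row (Suc i) T" | "col i T = col (Suc i) T"
    | "row i T < row (Suc i) T" "col (Suc i) T < col i T"
    | "row (Suc i) T < row i T" "col i T < col (Suc i) T"
    | "row (Suc i) T < row i T" "col (Suc i) T < col i T"
    using nle by linarith
  then show ?thesis
  proof cases
    case 1
    have "col (Suc i) T < col i T" using 1 nle by auto
    then show ?thesis
      using between[of "row i T" "Suc (col (Suc i) T)"] cell[of "row i T" "Suc (col (Suc i) T)"] 1
      by (auto simp: gap_def content_def row_def col_def prod_eq_iff)
  next
    case 2
    have "row (Suc i) T < row i T" using 2 nle by auto
    then show ?thesis
      using between[of "Suc (row (Suc i) T)" "col i T"] cell[of "Suc (row (Suc i) T)" "col i T"] 2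
      by (auto simp: gap_def content_def row_def col_def prod_eq_iff)
  next
    case 5
    then show ?thesis
      using between[of "row i T" "col (Suc i) T"] cell[of "row i T" "col (Suc i) T"]
      by (auto simp: row_def col_def prod_eq_iff)
  qed (auto simp: gap_def content_def)
qed

lemma gap_nonzero:
  assumes "T \<in> Y" "1 \<le> i" "i < N"
  shows "gap i T \<noteq> 0"
  using gap_cases[OF assms] by auto

lemma gap_swap: "gap i (T \<circ> tr i (Suc i)) = - gap i T"
  by (simp add: gap_def content_comp)

text \<open>Exchanging consecutive values reverses the comparison of just these two, and a gap of at
  least 2 keeps them out of a common row or column.\<close>

lemma swap_in_RSYT:
  assumes T: "T \<in> Y" and i: "1 \<le> i" "i < N" and g: "2 \<le> \<bar>gap i T\<bar>"
  shows "T \<circ> tr i (Suc i) \<in> Y"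
proof -
  let ?s = "tr i (Suc i)"
  have perm: "?s permutes {1..N}" using i by (intro tr_permutes) auto
  have ne: "row i T \<noteq> row (Suc i) T" "col i T \<noteq> col (Suc i) T"
    using gap_cases[OF T i] g by auto
  have bij: "bij_betw (T \<circ> ?s) {1..N} (cells tau)"
    using bij_betw_trans[OF permutes_imp_bij[OF perm]] T unfolding RSYT_iff by blast
  have order: "j < k" if "k \<in> {1..N}" "j \<in> {1..N}" "?s j < ?s k"
    "row (?s k) T = row (?s j) T \<or> col (?s k) T = col (?s j) T" for j k
    using that ne by (auto simp: tr_def split: if_splits)
  have mem: "?s k \<in> {1..N}" if "k \<in> {1..N}" for k
    using permutes_in_image[OF perm] that by blast
  have rc: "row k (T \<circ> ?s) = row (?s k) T" "col k (T \<circ> ?s) = col (?s k) T" for k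
    by (simp_all add: row_def col_def)
  show ?thesis
    unfolding RSYT_iff
  proof (intro conjI ballI allI impI)
    show "(T \<circ> ?s) k = (0, 0)" if "k \<notin> {1..N}" for k
      using that T i unfolding RSYT_iff by (auto simp: tr_def)
    show "bij_betw (T \<circ> ?s) {1..N} (cells tau)" by (rule bij)
    show "k < j" if "j \<in> {1..N}" "k \<in> {1..N}"
      "row j (T \<circ> ?s) = row k (T \<circ> ?s) \<and> col j (T \<circ> ?s) < col k (T \<circ> ?s)" for j k
      using T order[of j k] mem[of j] mem[of k] that unfolding RSYT_iff rc by metis
    show "k < j" if "j \<in> {1..N}" "k \<in> {1..N}"
      "col j (T \<circ> ?s) = col k (T \<circ> ?s) \<and> row j (T \<circ> ?s) < row k (T \<circ> ?s)" for j k
      using T order[of j k] mem[of j] mem[of k] that unfolding RSYT_iff rc by metis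
  qed
qed

end

section \<open>The seminormal representation\<close>

text \<open>The coefficient of \<open>T \<circ> tr i (Suc i)\<close> in \<open>tau_s_basis i T\<close> for content difference \<open>b\<close>;
  it vanishes exactly when the exchanged filling is not a tableau.\<close>

definition swap_coeff :: "int \<Rightarrow> K" where
  "swap_coeff b = (if 2 \<le> b then 1 else if b \<le> -2 then 1 - 1 / (of_int b)^2 else 0)"

lemma swap_coeff_mult_minus: "b \<noteq> 0 \<Longrightarrow> swap_coeff b * swap_coeff (- b) = 1 - 1 / (of_int b)^2"
  by (cases "b = 1 \<or> b = -1") (auto simp: swap_coeff_def)

lemma swap_coeff_nonzeroD: "swap_coeff b \<noteq> 0 \<Longrightarrow> 2 \<le> \<bar>b\<bar>"
  by (auto simp: swap_coeff_def split: if_splits)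

context young_shape
begin

definition V :: "vec set" where
  "V = {v. \<forall>S. v S \<noteq> 0 \<longrightarrow> S \<in> Y}"

lemma V_outside: "v \<in> V \<Longrightarrow> S \<notin> Y \<Longrightarrow> v S = 0"
  by (auto simp: V_def)

lemma V_eqI: "v \<in> V \<Longrightarrow> u \<in> V \<Longrightarrow> (\<And>S. S \<in> Y \<Longrightarrow> v S = u S) \<Longrightarrow> v = u"
  by (rule ext) (metis V_outside)

lemma bvec_in_V: "T \<in> Y \<Longrightarrow> bvec T \<in> V"
  by (auto simp: V_def bvec_def)

lemma vzero_in_V [simp]: "vzero \<in> V"
  by (auto simp: V_def vzero_def)

text \<open>One formula for all four cases: in a common row or column the gap is 1 or -1, so
  \<open>1 / gap\<close> is the sign and \<open>swap_coeff\<close> vanishes.\<close>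

lemma tau_s_basis_apply:
  assumes T: "T \<in> Y" and i: "1 \<le> i" "i < N"
  shows "tau_s_basis i T S =
    1 / of_int (gap i T) * bvec T S + swap_coeff (gap i T) * bvec (T \<circ> tr i (Suc i)) S"
proof -
  have "i \<in> {1..N}" "Suc i \<in> {1..N}" using i by auto
  then have "T i \<noteq> T (Suc i)"
    using tableau_inj[OF T, of i "Suc i"] by auto
  have "row i T \<noteq> row (Suc i) T \<or> col i T \<noteq> col (Suc i) T"
    using \<open>T i \<noteq> T (Suc i)\<close> by (auto simp: row_def col_def prod_eq_iff)
  with gap_cases[OF T i] consider
    "row i T = row (Suc i) T" "gap i T = 1"
    | "row i T \<noteq> row (Suc i) T" "col i T = col (Suc i) T" "gap i T = -1"
    | "row i T \<noteq> row (Suc i) T" "col i T \<noteq> col (Suc i) T" "2 \<le> \<bar>gap i T\<bar>"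
    by auto
  then show ?thesis
    by cases (auto simp: tau_s_basis_def swap_coeff_def gap_def[symmetric] Let_def)
qed

lemma sum_mult_bvec: "(\<Sum>T\<in>Y. f T * bvec S T) = (if S \<in> Y then f S else 0)"
proof -
  have "(\<Sum>T\<in>Y. f T * bvec S T) = (\<Sum>T\<in>Y. if T = S then f T else 0)"
    by (rule sum.cong) (auto simp: bvec_def)
  then show ?thesis by (simp add: finite_RSYT)
qed

text \<open>The transposed form, giving the coefficient at \<open>S\<close> of the image. Only
  \<open>S\<close> and its exchange contribute, and the exchange has the negated gap. If it is not a
  tableau, \<open>swap_coeff\<close> removes its term.\<close>

lemma tau_s_apply:
  assumes S: "S \<in> Y" and i: "1 \<le> i" "i < N"
  shows "tau_s tau i v S = v S / of_int (gap i S) + swap_coeff (- gap i S) * v (S \<circ> tr i (Suc i))"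
proof -
  let ?s = "tr i (Suc i)"
  have eq: "S = T \<circ> ?s \<longleftrightarrow> T = S \<circ> ?s" for T
    by (metis tr_comp_tr_assoc)
  have b: "bvec T S = bvec S T" "bvec (T \<circ> ?s) S = bvec (S \<circ> ?s) T" for T
    by (simp_all only: bvec_def eq eq_commute[of S T])
  have "tau_s tau i v S = (\<Sum>T\<in>Y. v T / of_int (gap i T) * bvec S T) +
      (\<Sum>T\<in>Y. v T * swap_coeff (gap i T) * bvec (S \<circ> ?s) T)"
    unfolding tau_s_def sum.distrib[symmetric]
    by (rule sum.cong[OF refl], subst tau_s_basis_apply[OF _ i], assumption, subst b(2), subst b(1))
       (simp add: algebra_simps)
  also have "\<dots> = v S / of_int (gap i S) + (if S \<circ> ?s \<in> Y then v (S \<circ> ?s) * swap_coeff (- gap i S) else 0)"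
    using S by (simp only: sum_mult_bvec gap_swap if_True)
  also have "(if S \<circ> ?s \<in> Y then v (S \<circ> ?s) * swap_coeff (- gap i S) else 0) = swap_coeff (- gap i S) * v (S \<circ> ?s)"
    using swap_in_RSYT[OF S i] swap_coeff_nonzeroD[of "- gap i S"] by auto
  finally show ?thesis .
qed

lemma tau_s_outside:
  assumes S: "S \<notin> Y" and i: "1 \<le> i" "i < N"
  shows "tau_s tau i v S = 0"
  unfolding tau_s_def
proof (rule sum.neutral, rule ballI)
  fix T assume T: "T \<in> Y"
  then have "bvec T S = 0" "swap_coeff (gap i T) * bvec (T \<circ> tr i (Suc i)) S = 0"
    using S swap_in_RSYT[OF T i] swap_coeff_nonzeroD[of "gap i T"]
    by (auto simp only: bvec_def mult_eq_0_iff split: if_split)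
  then show "v T * tau_s_basis i T S = 0"
    by (simp add: tau_s_basis_apply[OF T i])
qed

lemma tau_s_in_V: "1 \<le> i \<Longrightarrow> i < N \<Longrightarrow> tau_s tau i v \<in> V"
  using tau_s_outside by (auto simp: V_def)

text \<open>The common factor acts as a guard: it is 0 unless the exchange of \<open>S\<close> is a
  tableau, so \<open>tau_s_apply\<close> can be used at the exchanged filling without a case
  split.\<close>

lemma swap_coeff_tau_s_apply:
  assumes S: "S \<in> Y" and j: "1 \<le> j" "j < N" and i: "1 \<le> i" "i < N"
  shows "swap_coeff (- gap j S) * tau_s tau i v (S \<circ> tr j (Suc j)) = swap_coeff (- gap j S) *
    (v (S \<circ> tr j (Suc j)) / of_int (gap i (S \<circ> tr j (Suc j))) +
     swap_coeff (- gap i (S \<circ> tr j (Suc j))) * v (S \<circ> tr j (Suc j) \<circ> tr i (Suc i)))"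
  using tau_s_apply[OF swap_in_RSYT[OF S j] i] swap_coeff_nonzeroD[of "- gap j S"] by auto

text \<open>The diagonal part is \<open>1 / b\<^sup>2 + swap_coeff b * swap_coeff (- b) = 1\<close>;
  the off-diagonal parts cancel because the exchange negates the gap.\<close>

lemma tau_s_involution:
  assumes v: "v \<in> V" and i: "1 \<le> i" "i < N"
  shows "tau_s tau i (tau_s tau i v) = v"
proof (rule V_eqI)
  fix S assume S: "S \<in> Y"
  let ?b = "of_int (gap i S) :: K"
  have b: "?b \<noteq> 0" using gap_nonzero[OF S i] by simp
  have "tau_s tau i (tau_s tau i v) S
      = tau_s tau i v S / ?b + swap_coeff (- gap i S) * tau_s tau i v (S \<circ> tr i (Suc i))"
    by (rule tau_s_apply[OF S i])
  also have "\<dots> = v S / ?b^2 + (swap_coeff (gap i S) * swap_coeff (- gap i S)) * v S"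
    using b unfolding swap_coeff_tau_s_apply[OF S i i] tau_s_apply[OF S i] gap_swap
    by (simp add: field_simps power2_eq_square)
  also have "\<dots> = v S"
    using b gap_nonzero[OF S i] by (simp add: swap_coeff_mult_minus field_simps)
  finally show "tau_s tau i (tau_s tau i v) S = v S" .
qed (use v tau_s_in_V[OF i] in auto)

lemma tau_s_commute:
  assumes i: "1 \<le> i" and ij: "Suc i < j" and j: "j < N"
  shows "tau_s tau i (tau_s tau j v) = tau_s tau j (tau_s tau i v)"
proof (rule V_eqI)
  fix S assume S: "S \<in> Y"
  have i': "i < N" and j': "1 \<le> j" using assms by auto
  have g: "gap i (S \<circ> tr j (Suc j)) = gap i S" "gap j (S \<circ> tr i (Suc i)) = gap j S"
    using ij by (auto simp: gap_def content_comp)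
  have c: "S \<circ> tr i (Suc i) \<circ> tr j (Suc j) = S \<circ> tr j (Suc j) \<circ> tr i (Suc i)"
    using ij by (auto simp: fun_eq_iff tr_def)
  show "tau_s tau i (tau_s tau j v) S = tau_s tau j (tau_s tau i v) S"
    unfolding tau_s_apply[OF S i i'] tau_s_apply[OF S j' j]
      swap_coeff_tau_s_apply[OF S i i' j' j] swap_coeff_tau_s_apply[OF S j' j i i'] g c
    by (simp add: algebra_simps add_divide_distrib)
qed (use assms tau_s_in_V in auto)

text \<open>Evaluated at \<open>S\<close>, both sides involve the six fillings generated by two
  adjacent exchanges, with gaps \<open>p\<close>, \<open>q\<close>, \<open>p + q\<close> up to sign.
  After naming the off-diagonal coefficients and the six values of \<open>v\<close>, the claim is an
  identity of rational expressions in \<open>P\<close> and \<open>Q\<close>.\<close>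

lemma tau_s_braid:
  assumes i: "1 \<le> i" and i2: "Suc i < N"
  shows "tau_s tau i (tau_s tau (Suc i) (tau_s tau i v)) =
    tau_s tau (Suc i) (tau_s tau i (tau_s tau (Suc i) v))"
proof (rule V_eqI)
  fix S assume S: "S \<in> Y"
  let ?j = "Suc i"
  have i': "i < N" and j': "1 \<le> ?j" using assms by auto
  let ?s = "tr i (Suc i)" and ?t = "tr (Suc i) (Suc (Suc i))"
  define p q where "p = gap i S" and "q = gap ?j S"
  have p0: "p \<noteq> 0" and q0: "q \<noteq> 0"
    using gap_nonzero[OF S i i'] gap_nonzero[OF S j' i2] by (auto simp: p_def q_def)
  \<comment> \<open>\<open>p + q\<close> is the content difference of \<open>i\<close> and
    \<open>i + 2\<close>; entries on one diagonal are at least 3 apart.\<close>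
  have pq0: "p + q \<noteq> 0"
    using same_diagonal_gap[OF S, of i "Suc (Suc i)"] assms by (auto simp: p_def q_def gap_def)
  have g: "gap i (S \<circ> ?s) = - p" "gap ?j (S \<circ> ?s) = p + q" "gap i (S \<circ> ?t) = p + q"
    "gap ?j (S \<circ> ?t) = - q"
    "gap i (S \<circ> ?s \<circ> ?t) = q" "gap ?j (S \<circ> ?t \<circ> ?s) = p"
    "gap ?j (S \<circ> ?s \<circ> ?t) = - (p + q)" "gap i (S \<circ> ?t \<circ> ?s) = - (p + q)"
    by (simp_all add: gap_def p_def q_def content_comp)
  have st: "S \<circ> ?s \<circ> ?t \<circ> ?s = S \<circ> ?t \<circ> ?s \<circ> ?t"
    by (auto simp: fun_eq_iff tr_def)
  \<comment> \<open>The guard in two layers: unless both coefficients in front are nonzero there is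
    nothing to show, and if they are, both successive exchanges give tableaux.\<close>
  have two: "swap_coeff (- gap j S) * (swap_coeff (- gap k (S \<circ> tr j (Suc j))) * tau_s tau l w (S \<circ> tr j (Suc j) \<circ> tr k (Suc k))) =
     swap_coeff (- gap j S) * (swap_coeff (- gap k (S \<circ> tr j (Suc j))) *
     (w (S \<circ> tr j (Suc j) \<circ> tr k (Suc k)) / of_int (gap l (S \<circ> tr j (Suc j) \<circ> tr k (Suc k))) +
      swap_coeff (- gap l (S \<circ> tr j (Suc j) \<circ> tr k (Suc k))) * w (S \<circ> tr j (Suc j) \<circ> tr k (Suc k) \<circ> tr l (Suc l))))"
    if "1 \<le> j" "j < N" "1 \<le> k" "k < N" "1 \<le> l" "l < N" for j k l w
    using swap_coeff_tau_s_apply[OF swap_in_RSYT[OF S that(1,2)] that(3-6)] swap_coeff_nonzeroD[of "- gap j S"]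
    by auto
  have two1: "swap_coeff (- p) * (swap_coeff (- (p + q)) * tau_s tau i w (S \<circ> ?s \<circ> ?t)) =
      swap_coeff (- p) * (swap_coeff (- (p + q)) * (w (S \<circ> ?s \<circ> ?t) / of_int q + swap_coeff (- q) * w (S \<circ> ?s \<circ> ?t \<circ> ?s)))"
    and two2: "swap_coeff (- q) * (swap_coeff (- (p + q)) * tau_s tau ?j w (S \<circ> ?t \<circ> ?s)) =
      swap_coeff (- q) * (swap_coeff (- (p + q)) * (w (S \<circ> ?t \<circ> ?s) / of_int p + swap_coeff (- p) * w (S \<circ> ?t \<circ> ?s \<circ> ?t)))" for w
    using two[OF i i' j' i2 i i', of w] two[OF j' i2 i i' j' i2, of w]
    unfolding g p_def[symmetric] q_def[symmetric] by simp_all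
  have one: "swap_coeff (- p) * tau_s tau i w (S \<circ> ?s) = swap_coeff (- p) * (w (S \<circ> ?s) / of_int (- p) + swap_coeff p * w S)"
    "swap_coeff (- p) * tau_s tau ?j w (S \<circ> ?s) = swap_coeff (- p) * (w (S \<circ> ?s) / of_int (p + q) + swap_coeff (- (p + q)) * w (S \<circ> ?s \<circ> ?t))"
    "swap_coeff (- q) * tau_s tau ?j w (S \<circ> ?t) = swap_coeff (- q) * (w (S \<circ> ?t) / of_int (- q) + swap_coeff q * w S)"
    "swap_coeff (- q) * tau_s tau i w (S \<circ> ?t) = swap_coeff (- q) * (w (S \<circ> ?t) / of_int (p + q) + swap_coeff (- (p + q)) * w (S \<circ> ?t \<circ> ?s))" for w
    using swap_coeff_tau_s_apply[OF S i i' i i', of w] swap_coeff_tau_s_apply[OF S i i' j' i2, of w]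
      swap_coeff_tau_s_apply[OF S j' i2 j' i2, of w] swap_coeff_tau_s_apply[OF S j' i2 i i', of w]
    unfolding g p_def[symmetric] q_def[symmetric] by (simp_all add: fun.map_comp)
  have zero: "tau_s tau i w S = w S / of_int p + swap_coeff (- p) * w (S \<circ> ?s)"
    "tau_s tau ?j w S = w S / of_int q + swap_coeff (- q) * w (S \<circ> ?t)" for w
    using tau_s_apply[OF S i i'] tau_s_apply[OF S j' i2] by (simp_all add: p_def q_def)
  define P Q where "P = (of_int p :: K)" and "Q = (of_int q :: K)"
  have nz: "P \<noteq> 0" "Q \<noteq> 0" "P + Q \<noteq> 0"
    using p0 q0 pq0 unfolding P_def Q_def of_int_add[symmetric] by (simp_all only: of_int_eq_0_iff not_False_eq_True)
  have of_ints: "of_int (- p) = - P" "of_int (- q) = - Q" "of_int (p + q) = P + Q"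
    by (simp_all add: P_def Q_def)
  define a b c where "a = swap_coeff (- p)" and "b = swap_coeff (- q)" and "c = swap_coeff (- (p + q))"
  define v0 v1 v2 v12 v21 v121 where "v0 = v S" and "v1 = v (S \<circ> ?s)" and "v2 = v (S \<circ> ?t)"
    and "v12 = v (S \<circ> ?s \<circ> ?t)" and "v21 = v (S \<circ> ?t \<circ> ?s)" and "v121 = v (S \<circ> ?t \<circ> ?s \<circ> ?t)"
  note defs = P_def[symmetric] Q_def[symmetric] a_def[symmetric] b_def[symmetric] c_def[symmetric]
    v0_def[symmetric] v1_def[symmetric] v2_def[symmetric] v12_def[symmetric] v21_def[symmetric]
    v121_def[symmetric] st of_ints
  \<comment> \<open>This product has the same form for either sign of \<open>p\<close>, which avoids
    deciding which of the two fillings carries the coefficient 1.\<close>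
  have aa: "a * swap_coeff p = 1 - 1 / P^2" and bb: "b * swap_coeff q = 1 - 1 / Q^2"
    using swap_coeff_mult_minus[OF p0] swap_coeff_mult_minus[OF q0] by (simp_all add: a_def b_def P_def Q_def mult.commute)
  have L: "tau_s tau i (tau_s tau ?j (tau_s tau i v)) S =
      ((v0 / P + a * v1) / Q + b * (v2 / (P + Q) + c * v21)) / P
      + ((a * v1 / (- P) + (1 - 1 / P^2) * v0) / (P + Q)
        + a * c * (v12 / Q + b * v121))"
  proof -
    let ?u = "tau_s tau i v" and ?w = "tau_s tau ?j (tau_s tau i v)"
    have "tau_s tau i ?w S = ?w S / P + a * ?w (S \<circ> ?s)"
      by (simp add: zero defs)
    also have "?w S = ?u S / Q + b * ?u (S \<circ> ?t)"
      by (simp add: zero defs)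
    also have "b * ?u (S \<circ> ?t) = b * (v2 / (P + Q) + c * v21)"
      using one(4)[of v] unfolding defs .
    also have "?u S = v0 / P + a * v1"
      by (simp add: zero defs)
    also have "a * ?w (S \<circ> ?s) = (a * ?u (S \<circ> ?s)) / (P + Q) + a * (c * ?u (S \<circ> ?s \<circ> ?t))"
      using one(2)[of ?u] unfolding defs by (simp add: algebra_simps)
    also have "a * (c * ?u (S \<circ> ?s \<circ> ?t)) = a * (c * (v12 / Q + b * v121))"
      using two1[of v] unfolding defs .
    also have "a * ?u (S \<circ> ?s) = a * v1 / (- P) + (a * swap_coeff p) * v0"
      using one(1)[of v] unfolding defs by (simp add: algebra_simps)
    finally show ?thesis unfolding aa by (simp add: mult.assoc)
  qed
  have R: "tau_s tau ?j (tau_s tau i (tau_s tau ?j v)) S =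
      ((v0 / Q + b * v2) / P + a * (v1 / (P + Q) + c * v12)) / Q
      + ((b * v2 / (- Q) + (1 - 1 / Q^2) * v0) / (P + Q)
        + b * c * (v21 / P + a * v121))"
  proof -
    let ?u = "tau_s tau ?j v" and ?w = "tau_s tau i (tau_s tau ?j v)"
    have "tau_s tau ?j ?w S = ?w S / Q + b * ?w (S \<circ> ?t)"
      by (simp add: zero defs)
    also have "?w S = ?u S / P + a * ?u (S \<circ> ?s)"
      by (simp add: zero defs)
    also have "a * ?u (S \<circ> ?s) = a * (v1 / (P + Q) + c * v12)"
      using one(2)[of v] unfolding defs .
    also have "?u S = v0 / Q + b * v2"
      by (simp add: zero defs)
    also have "b * ?w (S \<circ> ?t) = (b * ?u (S \<circ> ?t)) / (P + Q) + b * (c * ?u (S \<circ> ?t \<circ> ?s))"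
      using one(4)[of ?u] unfolding defs by (simp add: algebra_simps)
    also have "b * (c * ?u (S \<circ> ?t \<circ> ?s)) = b * (c * (v21 / P + a * v121))"
      using two2[of v] unfolding defs .
    also have "b * ?u (S \<circ> ?t) = b * v2 / (- Q) + (b * swap_coeff q) * v0"
      using one(3)[of v] unfolding defs by (simp add: algebra_simps)
    finally show ?thesis unfolding bb by (simp add: mult.assoc)
  qed
  show "tau_s tau i (tau_s tau ?j (tau_s tau i v)) S = tau_s tau ?j (tau_s tau i (tau_s tau ?j v)) S"
    unfolding L R using nz by (simp add: divide_simps) algebra
qed (use assms tau_s_in_V in auto)

end

section \<open>Words in the adjacent transpositions\<close>

lemma wprod_append [simp]: "wprod (xs @ ys) = wprod xs \<circ> wprod ys"
  by (induction xs) (auto simp: comp_assoc)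

lemma tau_word_append: "tau_word tau (xs @ ys) v = tau_word tau xs (tau_word tau ys v)"
  by (induction xs) auto

lemma wprod_permutes:
  assumes "set xs \<subseteq> {1..<n}"
  shows "wprod xs permutes {1..n}"
  using assms
proof (induction xs)
  case (Cons i xs)
  then have "tr i (Suc i) permutes {1..n}"
    unfolding tr_eq_transpose by (intro permutes_swap_id) auto
  then show ?case
    unfolding wprod.simps(2) using Cons by (intro permutes_compose) auto
qed (simp add: permutes_id[unfolded id_def] id_def)

lemma wprod_fixes: "set xs \<subseteq> {1..<n} \<Longrightarrow> n < k \<Longrightarrow> wprod xs k = k"
  using permutes_not_in[OF wprod_permutes] by auto

lemma wprod_rev_upt: "k \<le> n \<Longrightarrow> wprod (rev [k..<n]) k = n"
proof (induction n)
  case (Suc n)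
  then show ?case by (cases "k = Suc n") auto
qed simp

text \<open>Congruence of words under the Coxeter relations of the symmetric group. The suffix
  \<open>ys\<close> stays in range because cancellation is sound for \<open>tau_s\<close> on
  \<open>V\<close>, and in-range letters send \<open>V\<close> into \<open>V\<close>.\<close>

inductive word_eq :: "nat \<Rightarrow> nat list \<Rightarrow> nat list \<Rightarrow> bool" for n where
  word_eq_refl: "word_eq n xs xs"
| word_eq_sym: "word_eq n xs ys \<Longrightarrow> word_eq n ys xs"
| word_eq_trans: "word_eq n xs ys \<Longrightarrow> word_eq n ys zs \<Longrightarrow> word_eq n xs zs"
| word_eq_cancel: "i \<in> {1..<n} \<Longrightarrow> set ys \<subseteq> {1..<n} \<Longrightarrow> word_eq n (xs @ [i, i] @ ys) (xs @ ys)"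
| word_eq_comm: "1 \<le> i \<Longrightarrow> Suc i < j \<Longrightarrow> j < n \<Longrightarrow> set ys \<subseteq> {1..<n} \<Longrightarrow>
    word_eq n (xs @ [i, j] @ ys) (xs @ [j, i] @ ys)"
| word_eq_braid: "1 \<le> i \<Longrightarrow> Suc i < n \<Longrightarrow> set ys \<subseteq> {1..<n} \<Longrightarrow>
    word_eq n (xs @ [i, Suc i, i] @ ys) (xs @ [Suc i, i, Suc i] @ ys)"

lemma word_eq_context: "word_eq n xs ys \<Longrightarrow> set vs \<subseteq> {1..<n} \<Longrightarrow> word_eq n (us @ xs @ vs) (us @ ys @ vs)"
proof (induction rule: word_eq.induct)
  case (word_eq_cancel i ys xs)
  then show ?case using word_eq.word_eq_cancel[of i n "ys @ vs" "us @ xs"] by auto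
next
  case (word_eq_comm i j ys xs)
  then show ?case using word_eq.word_eq_comm[of i j n "ys @ vs" "us @ xs"] by auto
next
  case (word_eq_braid i ys xs)
  then show ?case using word_eq.word_eq_braid[of i n "ys @ vs" "us @ xs"] by auto
qed (auto intro: word_eq.intros)

lemma word_eq_append: "word_eq n xs ys \<Longrightarrow> set vs \<subseteq> {1..<n} \<Longrightarrow> word_eq n (xs @ vs) (ys @ vs)"
  using word_eq_context[of n xs ys vs "[]"] by simp

lemma word_eq_prepend: "word_eq n xs ys \<Longrightarrow> word_eq n (us @ xs) (us @ ys)"
  using word_eq_context[of n xs ys "[]" us] by simp

lemma tr_braid: "tr i (Suc i) \<circ> tr (Suc i) (Suc (Suc i)) \<circ> tr i (Suc i) =
    tr (Suc i) (Suc (Suc i)) \<circ> tr i (Suc i) \<circ> tr (Suc i) (Suc (Suc i))"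
  by (auto simp: fun_eq_iff tr_def)

lemma word_eq_wprod: "word_eq n xs ys \<Longrightarrow> wprod xs = wprod ys"
proof (induction rule: word_eq.induct)
  case (word_eq_comm i j ys xs)
  then have "tr i (Suc i) \<circ> tr j (Suc j) = tr j (Suc j) \<circ> tr i (Suc i)"
    by (auto simp: fun_eq_iff tr_def)
  then have "wprod [i, j] = wprod [j, i]" by simp
  then show ?case unfolding wprod_append by simp
next
  case (word_eq_braid i ys xs)
  have "wprod [i, Suc i, i] = wprod [Suc i, i, Suc i]"
    using tr_braid[of i] by (simp add: comp_assoc)
  then show ?case unfolding wprod_append by simp
qed (auto simp: fun_eq_iff)

lemma word_eq_move_left:
  assumes "1 \<le> i" "i < n" "set xs \<subseteq> {1..<n}" "set ys \<subseteq> {1..<n}"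
    and "\<And>j. j \<in> set xs \<Longrightarrow> Suc i < j \<or> Suc j < i"
  shows "word_eq n (xs @ i # ys) (i # xs @ ys)"
  using assms
proof (induction xs)
  case (Cons j xs)
  have "word_eq n (j # xs @ i # ys) (j # i # xs @ ys)"
    using word_eq_prepend[OF Cons.IH, of "[j]"] Cons.prems by auto
  moreover have "word_eq n (j # i # xs @ ys) (i # j # xs @ ys)"
  proof (cases "Suc i < j")
    case True
    then show ?thesis
      using word_eq_sym[OF word_eq_comm[of i j n "xs @ ys" "[]"]] Cons.prems by auto
  next
    case False
    then have "Suc j < i" using Cons.prems by auto
    then show ?thesis
      using word_eq_comm[of j i n "xs @ ys" "[]"] Cons.prems by auto
  qed
  ultimately show ?case by (auto intro: word_eq_trans)
qed (simp add: word_eq_refl)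

lemma rev_upt_split: "k \<le> m \<Longrightarrow> m \<le> n \<Longrightarrow> rev [k..<n] = rev [m..<n] @ rev [k..<m]"
  by (metis le_Suc_ex rev_append upt_add_eq_append)

text \<open>Coset decomposition of the symmetric group on \<open>n\<close> letters by that on
  \<open>n - 1\<close>, with descending runs as representatives. A further letter on the right
  commutes through the run, extends it, shortens it, or passes through it lowered by one.\<close>

lemma word_eq_normal_form:
  assumes "set xs \<subseteq> {1..<n}" "1 \<le> n" "n \<le> N"
  shows "\<exists>u k. set u \<subseteq> {1..<n - 1} \<and> 1 \<le> k \<and> k \<le> n \<and> word_eq N xs (u @ rev [k..<n])"
  using assms(1)
proof (induction xs rule: rev_induct)
  case Nil
  show ?case using assms by (intro exI[of _ "[]"] exI[of _ n]) (auto intro: word_eq_refl)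
next
  case (snoc i xs)
  then obtain u k where u: "set u \<subseteq> {1..<n - 1}" and k: "1 \<le> k" "k \<le> n"
    and eq: "word_eq N xs (u @ rev [k..<n])" by auto
  have i: "1 \<le> i" "i < n" using snoc.prems by auto
  have subN: "set (rev [a..<b]) \<subseteq> {1..<N}" if "1 \<le> a" "b \<le> n" for a b
    using that assms by auto
  have eq1: "word_eq N (xs @ [i]) (u @ rev [k..<n] @ [i])"
    using word_eq_append[OF eq, of "[i]"] i assms by auto
  consider "Suc i < k" | "Suc i = k" | "i = k" | "k < i" by linarith
  then show ?case
  proof cases
    case 1
    have "word_eq N (rev [k..<n] @ [i]) (i # rev [k..<n] @ [])"
      by (rule word_eq_move_left) (use 1 i assms k in auto)
    from word_eq_trans[OF eq1 word_eq_prepend[OF this, of u]]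
    have "word_eq N (xs @ [i]) ((u @ [i]) @ rev [k..<n])" by simp
    then show ?thesis
      using u i k 1 by (intro exI[of _ "u @ [i]"] exI[of _ k]) auto
  next
    case 2
    have "rev [k..<n] @ [i] = rev [i..<n]"
      using 2 rev_upt_split[of i k n] k by auto
    then show ?thesis
      using u i k eq1 by (intro exI[of _ u] exI[of _ i]) auto
  next
    case 3
    have *: "rev [k..<n] @ [i] = rev [Suc k..<n] @ [k, k] @ []"
      using 3 rev_upt_split[of k "Suc k" n] i by auto
    have "word_eq N (rev [k..<n] @ [i]) (rev [Suc k..<n] @ [])"
      unfolding * by (rule word_eq_cancel) (use 3 i assms in auto)
    from word_eq_trans[OF eq1 word_eq_prepend[OF this, of u]] show ?thesis
      using u i 3 by (intro exI[of _ u] exI[of _ "Suc k"]) auto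
  next
    case 4
    \<comment> \<open>The letter \<open>i\<close> meets the pair \<open>i, h\<close> inside the run:
      a braid move turns \<open>i h i\<close> into \<open>h i h\<close>, and the leading
      \<open>h\<close> commutes out to the left.\<close>
    then obtain h where h: "i = Suc h" "1 \<le> h" "k \<le> h" using k by (cases i) auto
    have split: "rev [k..<n] = rev [Suc i..<n] @ [i, h] @ rev [k..<h]"
      using rev_upt_split[of k h n] rev_upt_split[of h "Suc i" n] h i by simp
    have "word_eq N (rev [k..<n] @ [i]) ((rev [Suc i..<n] @ [i, h]) @ i # rev [k..<h] @ [])"
      unfolding split append_assoc using word_eq_prepend[OF word_eq_move_left[of i N "rev [k..<h]" "[]"], of "rev [Suc i..<n] @ [i, h]"]
        h i k assms by auto
    moreover have "word_eq N ((rev [Suc i..<n] @ [i, h]) @ i # rev [k..<h] @ [])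
        (rev [Suc i..<n] @ [h, i, h] @ rev [k..<h])"
      using word_eq_sym[OF word_eq_braid[of h N "rev [k..<h]" "rev [Suc i..<n]"]] h i k assms by auto
    moreover have "word_eq N (rev [Suc i..<n] @ [h, i, h] @ rev [k..<h]) (h # rev [k..<n])"
      unfolding split using word_eq_move_left[of h N "rev [Suc i..<n]" "[i, h] @ rev [k..<h]"] h i k assms
      by auto
    ultimately have "word_eq N (rev [k..<n] @ [i]) (h # rev [k..<n])"
      by (blast intro: word_eq_trans)
    from word_eq_trans[OF eq1 word_eq_prepend[OF this, of u]]
    have "word_eq N (xs @ [i]) ((u @ [h]) @ rev [k..<n])" by simp
    then show ?thesis
      using u i k h by (intro exI[of _ "u @ [h]"] exI[of _ k]) auto
  qed
qed

text \<open>In the normal form \<open>u @ rev [k..<n]\<close> the index \<open>k\<close> is the preimage of \<open>n\<close>, so the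
  permutation determines the word up to \<open>word_eq\<close> by induction on \<open>n\<close>.\<close>

lemma word_eq_if_wprod_eq:
  assumes "set xs \<subseteq> {1..<n}" "set ys \<subseteq> {1..<n}" "n \<le> N" "wprod xs = wprod ys"
  shows "word_eq N xs ys"
  using assms
proof (induction n arbitrary: xs ys)
  case (Suc n)
  show ?case
  proof (cases "n = 0")
    case True
    then have "xs = []" "ys = []" using Suc.prems by auto
    then show ?thesis by (simp add: word_eq_refl)
  next
    case False
    let ?c = "\<lambda>k. rev [k..<Suc n]"
    obtain u k where u: "set u \<subseteq> {1..<n}" "1 \<le> k" "k \<le> Suc n" "word_eq N xs (u @ ?c k)"
      using word_eq_normal_form[OF Suc.prems(1) _ Suc.prems(3)] by auto
    obtain u' k' where u': "set u' \<subseteq> {1..<n}" "1 \<le> k'" "k' \<le> Suc n" "word_eq N ys (u' @ ?c k')"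
      using word_eq_normal_form[OF Suc.prems(2) _ Suc.prems(3)] by auto
    have x: "wprod xs = wprod u \<circ> wprod (?c k)" and y: "wprod xs = wprod u' \<circ> wprod (?c k')"
      using word_eq_wprod[OF u(4)] word_eq_wprod[OF u'(4)] Suc.prems(4) by (simp_all only: wprod_append)
    have "wprod xs k = Suc n" "wprod xs k' = Suc n"
      using fun_cong[OF x, of k] fun_cong[OF y, of k'] wprod_rev_upt u(3) u'(3)
        wprod_fixes[OF u(1)] wprod_fixes[OF u'(1)] by (auto simp del: upt_Suc)
    then have "k = k'"
      using permutes_inj[OF wprod_permutes[OF Suc.prems(1)]] by (metis injD)
    have "surj (wprod (?c k))"
      by (rule permutes_surj[OF wprod_permutes[of _ "Suc n"]]) (use u in auto)
    have "wprod u = wprod u'"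
    proof (intro ext)
      fix z
      obtain a where "z = wprod (?c k) a"
        using \<open>surj (wprod (?c k))\<close> by (rule surjE)
      then show "wprod u z = wprod u' z"
        using fun_cong[OF x, of a] fun_cong[OF y, of a] \<open>k = k'\<close> by (simp only: comp_apply)
    qed
    then have "word_eq N u u'"
      using Suc.IH u(1) u'(1) Suc.prems(3) by auto
    then have "word_eq N (u @ ?c k) (u' @ ?c k)"
      by (rule word_eq_append) (use u Suc.prems(3) in auto)
    then show ?thesis
      using u(4) u'(4) \<open>k = k'\<close> by (metis word_eq_trans word_eq_sym)
  qed
qed (simp add: word_eq_refl)

lemma tr_as_word:
  assumes "1 \<le> a" "a < b" "b \<le> n"
  shows "\<exists>xs. set xs \<subseteq> {1..<n} \<and> wprod xs = tr a b"
  using assms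
proof (induction b)
  case (Suc b)
  show ?case
  proof (cases "a = b")
    case True
    then show ?thesis using Suc.prems by (intro exI[of _ "[a]"]) auto
  next
    case False
    then obtain xs where xs: "set xs \<subseteq> {1..<n}" "wprod xs = tr a b"
      using Suc by auto
    have "tr b (Suc b) \<circ> (tr a b \<circ> tr b (Suc b)) = tr a (Suc b)"
      using False Suc.prems by (auto simp: fun_eq_iff tr_def)
    then show ?thesis
      using xs Suc.prems by (intro exI[of _ "[b] @ xs @ [b]"]) auto
  qed
qed simp

lemma permutes_as_word:
  assumes "w permutes {1..n::nat}"
  shows "\<exists>xs. set xs \<subseteq> {1..<n} \<and> wprod xs = w"
  using assms finite_atLeastAtMost[of 1 n]
proof (induction w rule: permutes_induct)
  case id
  show ?case by (intro exI[of _ "[]"]) auto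
next
  case (swap a b p)
  note a = swap(1) and b = swap(2)
  from swap.IH obtain xs where xs: "set xs \<subseteq> {1..<n}" "wprod xs = p" by auto
  have "\<exists>ys. set ys \<subseteq> {1..<n} \<and> wprod ys = tr a b"
  proof -
    consider "a < b" | "b < a" | "a = b" by linarith
    then show ?thesis
    proof cases
      case 2
      have "tr a b = tr b a" by (auto simp: fun_eq_iff tr_def)
      then show ?thesis using tr_as_word[of b a n] 2 a b by auto
    next
      case 3
      then show ?thesis by (intro exI[of _ "[]"]) (auto simp: fun_eq_iff tr_def)
    qed (use tr_as_word[of a b n] a b in auto)
  qed
  then obtain ys where "set ys \<subseteq> {1..<n}" "wprod ys = tr a b" by auto
  then show ?case
    using xs by (intro exI[of _ "ys @ xs"]) (auto simp: tr_eq_transpose)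
qed

lemma tau_s_add: "tau_s tau i (\<lambda>S. v S + u S) = (\<lambda>S. tau_s tau i v S + tau_s tau i u S)"
  by (simp add: tau_s_def fun_eq_iff sum.distrib algebra_simps)

lemma tau_s_scale: "tau_s tau i (\<lambda>S. c * v S) = (\<lambda>S. c * tau_s tau i v S)"
  by (simp add: tau_s_def fun_eq_iff sum_distrib_left algebra_simps)

lemma tau_s_sum: "tau_s tau i (\<lambda>S. \<Sum>x\<in>A. f x S) = (\<lambda>S. \<Sum>x\<in>A. tau_s tau i (f x) S)"
  unfolding tau_s_def sum_distrib_right by (subst sum.swap) rule

lemma tau_rep_add: "tau_rep tau w (\<lambda>S. v S + u S) = (\<lambda>S. tau_rep tau w v S + tau_rep tau w u S)"
proof -
  have "tau_word tau xs (\<lambda>S. v S + u S) = (\<lambda>S. tau_word tau xs v S + tau_word tau xs u S)" for xs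
    by (induction xs) (auto simp: tau_s_add)
  then show ?thesis by (simp add: tau_rep_def)
qed

lemma tau_rep_scale: "tau_rep tau w (\<lambda>S. c * v S) = (\<lambda>S. c * tau_rep tau w v S)"
proof -
  have "tau_word tau xs (\<lambda>S. c * v S) = (\<lambda>S. c * tau_word tau xs v S)" for xs
    by (induction xs) (auto simp: tau_s_scale)
  then show ?thesis by (simp add: tau_rep_def)
qed

lemma tau_rep_sum: "tau_rep tau w (\<lambda>S. \<Sum>x\<in>A. f x S) = (\<lambda>S. \<Sum>x\<in>A. tau_rep tau w (f x) S)"
proof -
  have "tau_word tau xs (\<lambda>S. \<Sum>x\<in>A. f x S) = (\<lambda>S. \<Sum>x\<in>A. tau_word tau xs (f x) S)" for xs
    by (induction xs) (auto simp: tau_s_sum)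
  then show ?thesis by (simp add: tau_rep_def)
qed

lemma tau_rep_diff: "tau_rep tau w (\<lambda>S. v S - u S) = (\<lambda>S. tau_rep tau w v S - tau_rep tau w u S)"
  using tau_rep_add[of tau w v "\<lambda>S. -1 * u S"] tau_rep_scale[of tau w "-1" u] by simp

lemma tau_rep_vzero [simp]: "tau_rep tau w vzero = vzero"
  using tau_rep_scale[of tau w 0 vzero] by (simp add: vzero_def fun_eq_iff)

section \<open>The representation on arbitrary permutations and its Jucys--Murphy elements\<close>

context young_shape
begin

lemma tau_word_in_V: "set xs \<subseteq> {1..<N} \<Longrightarrow> v \<in> V \<Longrightarrow> tau_word tau xs v \<in> V"
  by (induction xs) (auto simp: tau_s_in_V)

lemma word_eq_tau_word: "word_eq N xs ys \<Longrightarrow> v \<in> V \<Longrightarrow> tau_word tau xs v = tau_word tau ys v"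
proof (induction rule: word_eq.induct)
  case (word_eq_cancel i ys xs)
  then show ?case
    using tau_s_involution[OF tau_word_in_V] by (simp add: tau_word_append)
next
  case (word_eq_comm i j ys xs)
  then show ?case using tau_s_commute[of i j] by (simp add: tau_word_append)
next
  case (word_eq_braid i ys xs)
  then show ?case using tau_s_braid[of i] by (simp add: tau_word_append)
qed auto

abbreviation "rho \<equiv> tau_rep tau"

lemma rho_word_ex:
  assumes "w permutes {1..N}"
  shows "\<exists>xs. set xs \<subseteq> {1..<N} \<and> wprod xs = w \<and> rho w = tau_word tau xs"
  using someI_ex[OF permutes_as_word[OF assms]] unfolding tau_rep_def size by blast

text \<open>Independence of the word chosen by \<open>SOME\<close>: words of one permutation are
  connected by Coxeter moves, and these do not change \<open>tau_word\<close> on \<open>V\<close>.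
  Multiplicativity follows by concatenating words.\<close>

lemma rho_wprod:
  assumes "set xs \<subseteq> {1..<N}" "v \<in> V"
  shows "rho (wprod xs) v = tau_word tau xs v"
proof -
  obtain ys where "set ys \<subseteq> {1..<N}" "wprod ys = wprod xs" "rho (wprod xs) = tau_word tau ys"
    using rho_word_ex[OF wprod_permutes[OF assms(1)]] by auto
  then show ?thesis
    using word_eq_tau_word[OF word_eq_if_wprod_eq[of ys N xs N] assms(2)] assms by auto
qed

lemma rho_in_V: "w permutes {1..N} \<Longrightarrow> v \<in> V \<Longrightarrow> rho w v \<in> V"
  using rho_word_ex tau_word_in_V by metis

lemma rho_id [simp]: "v \<in> V \<Longrightarrow> rho id v = v"
  using rho_wprod[of "[]" v] by simp

lemma rho_comp:
  assumes w: "w permutes {1..N}" and u: "u permutes {1..N}" and v: "v \<in> V"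
  shows "rho (w \<circ> u) v = rho w (rho u v)"
proof -
  obtain xs where xs: "set xs \<subseteq> {1..<N}" "wprod xs = w" "rho w = tau_word tau xs"
    using rho_word_ex[OF w] by auto
  obtain ys where ys: "set ys \<subseteq> {1..<N}" "wprod ys = u" "rho u = tau_word tau ys"
    using rho_word_ex[OF u] by auto
  show ?thesis
    using rho_wprod[of "xs @ ys" v] xs ys v by (simp add: tau_word_append)
qed

lemma rho_adjacent: "1 \<le> i \<Longrightarrow> i < N \<Longrightarrow> v \<in> V \<Longrightarrow> rho (tr i (Suc i)) v = tau_s tau i v"
  using rho_wprod[of "[i]" v] by simp

lemma rho_inj:
  assumes "w permutes {1..N}" "v \<in> V" "u \<in> V" "rho w v = rho w u"
  shows "v = u"
proof -
  have "rho (inv w \<circ> w) v = rho (inv w \<circ> w) u"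
    using assms by (simp add: rho_comp permutes_inv del: permutes_inv_o)
  then show ?thesis using assms by (simp add: permutes_inv_o)
qed

text \<open>Since entries decrease, the sum runs over \<open>j > i\<close>. With
  \<open>J\<^sub>i\<close> for this sum, \<open>J\<^sub>i = s\<^sub>i + s\<^sub>i
  J\<^sub>i\<^sub>+\<^sub>1 s\<^sub>i\<close>, and the induction starts from the empty sum at
  \<open>N\<close>, where the content is 0.\<close>

lemma jucys_murphy:
  assumes i: "i \<in> {1..N}" and v: "v \<in> V" and S: "S \<in> Y"
  shows "(\<Sum>j\<in>{i<..N}. rho (tr i j) v S) = of_int (content i S) * v S"
  using i v S
proof (induction "N - i" arbitrary: i v S)
  case 0
  then show ?case using content_last[of S] by auto
next
  case (Suc d)
  then have i: "1 \<le> i" "i < N" by auto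
  let ?s = "tr i (Suc i)"
  have s: "?s permutes {1..N}" using i by (intro tr_permutes) auto
  define u where "u = tau_s tau i v"
  have uV: "u \<in> V" and ru: "u = rho ?s v" and su: "tau_s tau i u = v"
    using tau_s_in_V[OF i] rho_adjacent[OF i] tau_s_involution[OF _ i] Suc.prems by (auto simp: u_def)
  define b where "b = (of_int (gap i S) :: K)"
  have conj: "rho (tr i j) v = tau_s tau i (rho (tr (Suc i) j) u)" if "j \<in> {Suc i<..N}" for j
  proof -
    have j: "tr (Suc i) j permutes {1..N}" using that i by (intro tr_permutes) auto
    have "tr i j = ?s \<circ> (tr (Suc i) j \<circ> ?s)"
      using that by (auto simp: fun_eq_iff tr_def)
    then have "rho (tr i j) v = rho ?s (rho (tr (Suc i) j) (rho ?s v))"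
      using rho_comp[OF s permutes_compose[OF s j]] rho_comp[OF j s] Suc.prems by simp
    then show ?thesis
      using rho_adjacent[OF i] rho_in_V[OF j uV] ru by simp
  qed
  define g where "g = (\<lambda>S. \<Sum>j\<in>{Suc i<..N}. rho (tr (Suc i) j) u S)"
  have gT: "g T = of_int (content (Suc i) T) * u T" if "T \<in> Y" for T
    unfolding g_def using Suc.hyps(1)[of "Suc i" u T] Suc.hyps(2) i uV that by auto
  have "(\<Sum>j\<in>{i<..N}. rho (tr i j) v S) = u S + (\<Sum>j\<in>{Suc i<..N}. rho (tr i j) v S)"
  proof -
    have "{i<..N} = insert (Suc i) {Suc i<..N}" using i by auto
    then show ?thesis by (simp add: ru)
  qed
  also have "(\<Sum>j\<in>{Suc i<..N}. rho (tr i j) v S) = tau_s tau i g S"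
    unfolding g_def tau_s_sum using conj by simp
  also have "\<dots> = g S / b + swap_coeff (- gap i S) * g (S \<circ> ?s)"
    using tau_s_apply[OF Suc.prems(3) i] by (simp add: b_def)
  also have "swap_coeff (- gap i S) * g (S \<circ> ?s) = of_int (content i S) * (swap_coeff (- gap i S) * u (S \<circ> ?s))"
    using swap_in_RSYT[OF Suc.prems(3) i] swap_coeff_nonzeroD[of "- gap i S"] gT[of "S \<circ> ?s"]
    by (auto simp: content_comp)
  also have "swap_coeff (- gap i S) * u (S \<circ> ?s) = v S - u S / b"
    using tau_s_apply[OF Suc.prems(3) i, of u] su by (simp add: b_def)
  also have "g S = of_int (content (Suc i) S) * u S" using gT Suc.prems by simp
  also have "u S + (of_int (content (Suc i) S) * u S / b + of_int (content i S) * (v S - u S / b))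
      = of_int (content i S) * v S"
  proof -
    have "of_int (content i S) = b + of_int (content (Suc i) S)" "b \<noteq> 0"
      using gap_nonzero[OF Suc.prems(3) i] by (auto simp: b_def gap_def)
    then show ?thesis by (simp add: field_simps)
  qed
  finally show ?case .
qed

end

section \<open>Dunkl operators\<close>

text \<open>For exponents \<open>p > q\<close> the quotient is the sum of all monomials of total
  degree \<open>p + q - 1\<close> with both exponents at least \<open>q\<close>. So
  \<open>\<gamma>\<close> receives a contribution exactly when the smaller exponent is at most
  \<open>min (\<gamma> i) (\<gamma> j)\<close>, with a sign telling which variable carries
  it.\<close>

lemma ddiff_closed:
  assumes "i \<noteq> j"
  shows "ddiff i j f \<gamma> S = (\<Sum>a\<le>min (\<gamma> i) (\<gamma> j).
     f (\<gamma>(i := \<gamma> i + \<gamma> j + 1 - a, j := a)) S - f (\<gamma>(i := a, j := \<gamma> i + \<gamma> j + 1 - a)) S)"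
proof -
  let ?s = "\<gamma> i + \<gamma> j + 1" and ?m = "min (\<gamma> i) (\<gamma> j)"
  define g where "g a = f (\<gamma>(i := a, j := ?s - a)) S" for a
  have "ddiff i j f \<gamma> S = (\<Sum>a\<in>{0..?s}. (if ?s - ?m \<le> a then g a else 0) - (if a \<le> ?m then g a else 0))"
    unfolding ddiff_def g_def
    by (rule sum.cong) (auto simp: ddiff_coef_def min_def)
  also have "\<dots> = (\<Sum>a\<in>{0..?s}. if ?s - ?m \<le> a then g a else 0) - (\<Sum>a\<in>{0..?s}. if a \<le> ?m then g a else 0)"
    by (rule sum_subtractf)
  also have "(\<Sum>a\<in>{0..?s}. if ?s - ?m \<le> a then g a else 0) = (\<Sum>a\<in>{?s - ?m..?s}. g a)"
    by (rule sum.mono_neutral_cong_right) auto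
  also have "\<dots> = (\<Sum>a\<le>?m. g (?s - a))"
    by (rule sum.reindex_bij_witness[of _ "\<lambda>a. ?s - a" "\<lambda>a. ?s - a"]) auto
  also have "(\<Sum>a\<in>{0..?s}. if a \<le> ?m then g a else 0) = (\<Sum>a\<le>?m. g a)"
    by (rule sum.mono_neutral_cong_right) auto
  also have "(\<Sum>a\<le>?m. g (?s - a)) - (\<Sum>a\<le>?m. g a) = (\<Sum>a\<le>?m. g (?s - a) - g a)"
    by (rule sum_subtractf[symmetric])
  also have "\<dots> = (\<Sum>a\<le>?m. f (\<gamma>(i := ?s - a, j := a)) S - f (\<gamma>(i := a, j := ?s - a)) S)"
    by (rule sum.cong) (auto simp: g_def)
  finally show ?thesis .
qed

lemma ddiff_antisym:
  assumes "i \<noteq> j"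
  shows "ddiff j i f \<gamma> S = - ddiff i j f \<gamma> S"
  using assms unfolding ddiff_closed[OF assms] ddiff_closed[OF assms[symmetric]] sum_negf[symmetric]
  by (intro sum.cong) (auto simp: fun_upd_twist min.commute add.commute)

lemma comp_tr_upd: "i \<noteq> j \<Longrightarrow> \<beta> \<circ> tr i j = \<beta>(i := \<beta> j, j := \<beta> i)"
  by (auto simp: fun_eq_iff tr_def)

text \<open>A twisted product rule: writing \<open>p'\<close> for \<open>p\<close> with
  \<open>x\<^sub>i\<close> and \<open>x\<^sub>k\<close> exchanged, \<open>x\<^sub>k p - x\<^sub>i p'
  = x\<^sub>k (p - p') - (x\<^sub>i - x\<^sub>k) p'\<close>. On coefficients the two sides differ by
  a single boundary summand.\<close>

lemma ddiff_mulx: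
  assumes "i \<noteq> k"
  shows "ddiff i k (mulx k f) \<beta> S = mulx k (ddiff i k f) \<beta> S - f (\<beta> \<circ> tr i k) S"
proof -
  let ?s = "\<beta> i + \<beta> k" and ?m = "min (\<beta> i) (\<beta> k)"
  define F where "F p q = f (\<beta>(i := p, k := q)) S" for p q
  have "ddiff i k (mulx k f) \<beta> S =
      (\<Sum>a\<le>?m. mulx k f (\<beta>(i := ?s + 1 - a, k := a)) S) - (\<Sum>a\<le>?m. mulx k f (\<beta>(i := a, k := ?s + 1 - a)) S)"
    unfolding ddiff_closed[OF assms] sum_subtractf ..
  also have "(\<Sum>a\<le>?m. mulx k f (\<beta>(i := ?s + 1 - a, k := a)) S) = (\<Sum>a<?m. F (?s - a) a)"
  proof -
    have "(\<Sum>a\<le>?m. mulx k f (\<beta>(i := ?s + 1 - a, k := a)) S) =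
        (\<Sum>a\<in>{1..?m}. F (?s + 1 - a) (a - 1))"
      by (rule sum.mono_neutral_cong_right) (use assms in \<open>auto simp: mulx_def F_def vzero_def\<close>)
    also have "\<dots> = (\<Sum>a<?m. F (?s - a) a)"
      by (rule sum.reindex_bij_witness[of _ Suc "\<lambda>a. a - 1"]) auto
    finally show ?thesis .
  qed
  also have "(\<Sum>a\<le>?m. mulx k f (\<beta>(i := a, k := ?s + 1 - a)) S) = (\<Sum>a\<le>?m. F a (?s - a))"
    by (rule sum.cong) (auto simp: mulx_def F_def min_def split: if_splits)
  finally have L: "ddiff i k (mulx k f) \<beta> S = (\<Sum>a<?m. F (?s - a) a) - (\<Sum>a\<le>?m. F a (?s - a))" .
  have F: "f (\<beta> \<circ> tr i k) S = F (\<beta> k) (\<beta> i)"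
    using assms by (simp add: comp_tr_upd F_def)
  show ?thesis
  proof (cases "\<beta> k = 0")
    case True
    then show ?thesis unfolding L F by (simp add: mulx_def vzero_def)
  next
    case False
    let ?m' = "min (\<beta> i) (\<beta> k - 1)"
    have "mulx k (ddiff i k f) \<beta> S = (\<Sum>a\<le>?m'. F (?s - a) a) - (\<Sum>a\<le>?m'. F a (?s - a))"
      using False assms unfolding mulx_def ddiff_closed[OF assms] sum_subtractf F_def
      by (auto simp: fun_upd_twist)
    moreover have "(\<Sum>a<?m. F (?s - a) a) - (\<Sum>a\<le>?m. F a (?s - a)) =
       (\<Sum>a\<le>?m'. F (?s - a) a) - (\<Sum>a\<le>?m'. F a (?s - a)) - F (\<beta> k) (\<beta> i)"
    \<comment> \<open>The boundary summand is the top index of the first sum if \<beta> i < \<beta>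
      k, and of the second sum otherwise, where the two bounds differ by one.\<close>
    proof (cases "\<beta> i < \<beta> k")
      case True
      then have "?m = \<beta> i" "?m' = \<beta> i" by auto
      moreover have "(\<Sum>a\<le>\<beta> i. F (?s - a) a) = (\<Sum>a<\<beta> i. F (?s - a) a) + F (\<beta> k) (\<beta> i)"
        by (simp add: lessThan_Suc_atMost[symmetric])
      ultimately show ?thesis by simp
    next
      case False2: False
      then obtain d where d: "\<beta> k = Suc d" using \<open>\<beta> k \<noteq> 0\<close> by (cases "\<beta> k") auto
      have "?m = Suc d" "?m' = d" using d False2 by auto
      then show ?thesis using d by (simp add: lessThan_Suc_atMost)
    qed
    ultimately show ?thesis unfolding L F by simp
  qed
qed

lemma ddiff_mulx_same:
  assumes "i \<noteq> j"
  shows "ddiff i j (mulx i f) \<beta> S = mulx i (ddiff i j f) \<beta> S + f (\<beta> \<circ> tr i j) S"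
proof -
  have "tr j i = tr i j" by (auto simp: fun_eq_iff tr_def)
  then show ?thesis
    using ddiff_mulx[of j i f \<beta> S] assms ddiff_antisym[of i j]
    by (auto simp: mulx_def vzero_def)
qed

lemma ddiff_mulx_other:
  assumes "i \<noteq> j" "k \<noteq> i" "k \<noteq> j"
  shows "ddiff i j (mulx k f) \<beta> S = mulx k (ddiff i j f) \<beta> S"
  using assms by (auto simp: ddiff_def mulx_def vzero_def fun_upd_twist intro!: sum.cong)

lemma ddiff_lin: "ddiff i j (\<lambda>\<beta> S. a * f \<beta> S + b * g \<beta> S) = (\<lambda>\<beta> S. a * ddiff i j f \<beta> S + b * ddiff i j g \<beta> S)"
  by (simp add: ddiff_def fun_eq_iff sum.distrib[symmetric] sum_distrib_left algebra_simps)

lemma tau_rep_lin: "tau_rep tau w (\<lambda>S. a * v S + b * u S) = (\<lambda>S. a * tau_rep tau w v S + b * tau_rep tau w u S)"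
  by (simp add: tau_rep_add tau_rep_scale)

lemma Dunkl_lin: "Dunkl tau i (\<lambda>\<beta> S. a * f \<beta> S + b * g \<beta> S) =
    (\<lambda>\<beta> S. a * Dunkl tau i f \<beta> S + b * Dunkl tau i g \<beta> S)"
  unfolding Dunkl_def ddiff_lin tau_rep_lin dx_def
  by (simp add: sum.distrib sum_distrib_left algebra_simps)

lemma mulx_lin: "mulx i (\<lambda>\<beta> S. a * f \<beta> S + b * g \<beta> S) = (\<lambda>\<beta> S. a * mulx i f \<beta> S + b * mulx i g \<beta> S)"
  by (simp add: mulx_def fun_eq_iff vzero_def)

lemma act_lin: "act tau w (\<lambda>\<beta> S. a * f \<beta> S + b * g \<beta> S) = (\<lambda>\<beta> S. a * act tau w f \<beta> S + b * act tau w g \<beta> S)"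
  by (simp add: act_def tau_rep_lin)

lemma Uop_lin: "Uop tau i (\<lambda>\<beta> S. a * f \<beta> S + b * g \<beta> S) =
    (\<lambda>\<beta> S. a * Uop tau i f \<beta> S + b * Uop tau i g \<beta> S)"
  unfolding Uop_def mulx_lin Dunkl_lin act_lin
  by (simp add: sum.distrib sum_distrib_left algebra_simps)

lemma Dunkl_scale: "Dunkl tau i (\<lambda>\<beta> S. a * f \<beta> S) = (\<lambda>\<beta> S. a * Dunkl tau i f \<beta> S)"
  using Dunkl_lin[of tau i a f 0 f] by simp

lemma act_scale: "act tau w (\<lambda>\<beta> S. a * f \<beta> S) = (\<lambda>\<beta> S. a * act tau w f \<beta> S)"
  using act_lin[of tau w a f 0 f] by simp

lemma mulx_scale: "mulx i (\<lambda>\<beta> S. a * f \<beta> S) = (\<lambda>\<beta> S. a * mulx i f \<beta> S)"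
  using mulx_lin[of i a f 0 f] by simp

lemma mulx_inj: "mulx i f = mulx i g \<Longrightarrow> f = g"
proof
  fix \<beta> assume "mulx i f = mulx i g"
  from fun_cong[OF this, of "\<beta>(i := Suc (\<beta> i))"] show "f \<beta> = g \<beta>"
    by (simp add: mulx_def)
qed

lemma mulx_commute: "mulx i (mulx j f) = mulx j (mulx i f)"
  by (cases "i = j") (auto simp: mulx_def fun_eq_iff fun_upd_twist)

section \<open>Equivariance and commutation relations of the operators\<close>

context young_shape
begin

definition PV :: "pvec set" where
  "PV = {f. \<forall>\<beta>. f \<beta> \<in> V}"

lemma PV_D: "f \<in> PV \<Longrightarrow> f \<beta> \<in> V"
  by (simp add: PV_def)

lemma V_lin: "v \<in> V \<Longrightarrow> u \<in> V \<Longrightarrow> (\<lambda>S. a * v S + b * u S) \<in> V"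
  by (force simp: V_def)

lemma PV_lin: "f \<in> PV \<Longrightarrow> g \<in> PV \<Longrightarrow> (\<lambda>\<beta> S. a * f \<beta> S + b * g \<beta> S) \<in> PV"
  by (auto simp: PV_def intro: V_lin)

lemma act_in_PV: "w permutes {1..N} \<Longrightarrow> f \<in> PV \<Longrightarrow> act tau w f \<in> PV"
  by (auto simp: PV_def act_def intro: rho_in_V)

lemma mulx_in_PV: "f \<in> PV \<Longrightarrow> mulx i f \<in> PV"
  by (auto simp: PV_def mulx_def)

lemma ddiff_in_V: "f \<in> PV \<Longrightarrow> ddiff i j f \<beta> \<in> V"
  unfolding V_def ddiff_def mem_Collect_eq
proof (intro allI impI, rule ccontr)
  fix S
  assume "f \<in> PV" "S \<notin> Y"
  then have "f \<gamma> S = 0" for \<gamma>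
    using V_outside PV_D by blast
  moreover assume "(\<Sum>a\<in>{0..\<beta> i + \<beta> j + 1}. ddiff_coef a (\<beta> i + \<beta> j + 1 - a) (\<beta> i) *
      f (\<beta>(i := a, j := \<beta> i + \<beta> j + 1 - a)) S) \<noteq> 0"
  ultimately show False by simp
qed

lemma act_comp:
  assumes "w permutes {1..N}" "u permutes {1..N}" "f \<in> PV"
  shows "act tau (w \<circ> u) f = act tau w (act tau u f)"
  using assms by (auto simp: act_def fun_eq_iff rho_comp PV_D comp_assoc)

lemma act_id [simp]: "f \<in> PV \<Longrightarrow> act tau id f = f"
  by (simp add: act_def PV_D)

lemma upd_comp_permutes: "w permutes A \<Longrightarrow> \<beta>(w i := c) \<circ> w = (\<beta> \<circ> w)(i := c)"
  by (auto simp: fun_eq_iff dest: permutes_inj[THEN injD])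

lemma act_mulx:
  assumes w: "w permutes {1..N}"
  shows "act tau w (mulx i f) = mulx (w i) (act tau w f)"
  unfolding act_def mulx_def by (rule ext) (simp add: upd_comp_permutes[OF w])

lemma act_dx:
  assumes w: "w permutes {1..N}"
  shows "act tau w (dx i f) = dx (w i) (act tau w f)"
  unfolding act_def dx_def by (rule ext) (simp add: upd_comp_permutes[OF w] tau_rep_scale)

lemma act_ddiff:
  assumes w: "w permutes {1..N}"
  shows "act tau w (ddiff i j f) = ddiff (w i) (w j) (act tau w f)"
  unfolding act_def ddiff_def
  by (rule ext) (simp only: upd_comp_permutes[OF w] tau_rep_scale tau_rep_sum comp_apply)

lemma tr_conj: "w permutes A \<Longrightarrow> w \<circ> tr i j = tr (w i) (w j) \<circ> w"
  by (auto simp: fun_eq_iff tr_def dest: permutes_inj[THEN injD])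

lemma rho_tr_conj:
  assumes w: "w permutes {1..N}" and "i \<in> {1..N}" "j \<in> {1..N}" and v: "v \<in> V"
  shows "rho w (rho (tr i j) v) = rho (tr (w i) (w j)) (rho w v)"
proof -
  have t: "tr i j permutes {1..N}" "tr (w i) (w j) permutes {1..N}"
    using assms(2,3) permutes_in_image[OF w, of i] permutes_in_image[OF w, of j]
    by (simp_all only: tr_permutes)
  show ?thesis
    using rho_comp[OF w t(1) v] rho_comp[OF t(2) w v] tr_conj[OF w, of i j] by simp
qed

lemma act_tr_conj:
  assumes w: "w permutes {1..N}" and "i \<in> {1..N}" "j \<in> {1..N}" and f: "f \<in> PV"
  shows "act tau w (act tau (tr i j) f) = act tau (tr (w i) (w j)) (act tau w f)"
proof -
  have t: "tr i j permutes {1..N}" "tr (w i) (w j) permutes {1..N}"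
    using assms(2,3) permutes_in_image[OF w, of i] permutes_in_image[OF w, of j]
    by (simp_all only: tr_permutes)
  show ?thesis
    using act_comp[OF w t(1) f] act_comp[OF t(2) w f] tr_conj[OF w, of i j] by simp
qed

text \<open>Conjugation by \<open>w\<close> renames the variables in derivative, divided differences
  and transpositions alike; the sum over \<open>j\<close> is then reindexed along
  \<open>w\<close>.\<close>

lemma act_Dunkl:
  assumes w: "w permutes {1..N}" and i: "i \<in> {1..N}" and f: "f \<in> PV"
  shows "act tau w (Dunkl tau i f) = Dunkl tau (w i) (act tau w f)"
proof (intro ext)
  fix \<beta> S
  have "act tau w (Dunkl tau i f) \<beta> S = act tau w (dx i f) \<beta> S +
     kappa * (\<Sum>j\<in>{1..N} - {i}. rho w (rho (tr i j) (ddiff i j f (\<beta> \<circ> w))) S)"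
    unfolding act_def Dunkl_def size by (simp add: tau_rep_add tau_rep_scale tau_rep_sum)
  also have "(\<Sum>j\<in>{1..N} - {i}. rho w (rho (tr i j) (ddiff i j f (\<beta> \<circ> w))) S) =
      (\<Sum>j\<in>{1..N} - {i}. rho (tr (w i) (w j)) (ddiff (w i) (w j) (act tau w f) \<beta>) S)"
  proof (intro sum.cong refl)
    fix j assume j: "j \<in> {1..N} - {i}"
    have "ddiff (w i) (w j) (act tau w f) \<beta> = rho w (ddiff i j f (\<beta> \<circ> w))"
      using act_ddiff[OF w, of i j f, symmetric] by (simp add: act_def[of tau w "ddiff i j f"])
    then show "rho w (rho (tr i j) (ddiff i j f (\<beta> \<circ> w))) S =
        rho (tr (w i) (w j)) (ddiff (w i) (w j) (act tau w f) \<beta>) S"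
      using rho_tr_conj[OF w i, of j] j f by (simp add: ddiff_in_V)
  qed
  also have "\<dots> = (\<Sum>j\<in>{1..N} - {w i}. rho (tr (w i) j) (ddiff (w i) j (act tau w f) \<beta>) S)"
  proof (rule sum.reindex_bij_betw)
    have "w ` ({1..N} - {i}) = {1..N} - {w i}"
      using permutes_image[OF w] permutes_inj[OF w] by (simp add: image_set_diff)
    then show "bij_betw w ({1..N} - {i}) ({1..N} - {w i})"
      using permutes_inj_on[OF w] by (auto simp: bij_betw_def)
  qed
  finally show "act tau w (Dunkl tau i f) \<beta> S = Dunkl tau (w i) (act tau w f) \<beta> S"
    unfolding act_dx[OF w] by (simp add: Dunkl_def size)
qed

text \<open>The commutator of \<open>D\<^sub>i\<close> and \<open>x\<^sub>i\<close>: the derivative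
  contributes the identity, and each divided difference contributes one transposition.\<close>

lemma Dunkl_mulx_same:
  assumes "i \<in> {1..N}"
  shows "Dunkl tau i (mulx i f) \<beta> S = mulx i (Dunkl tau i f) \<beta> S + f \<beta> S +
     kappa * (\<Sum>j\<in>{1..N} - {i}. act tau (tr i j) f \<beta> S)"
proof -
  have d: "dx i (mulx i f) \<beta> S = mulx i (dx i f) \<beta> S + f \<beta> S"
    by (auto simp: dx_def mulx_def vzero_def algebra_simps of_nat_diff)
  have j: "rho (tr i j) (ddiff i j (mulx i f) \<beta>) S =
      mulx i (\<lambda>\<beta>. rho (tr i j) (ddiff i j f \<beta>)) \<beta> S + act tau (tr i j) f \<beta> S"
    if "j \<in> {1..N} - {i}" for j
  proof -
    have "ddiff i j (mulx i f) \<beta> = (\<lambda>S. mulx i (ddiff i j f) \<beta> S + f (\<beta> \<circ> tr i j) S)"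
      using ddiff_mulx_same[of i j f \<beta>] that by auto
    then show ?thesis
      by (simp add: tau_rep_add act_def mulx_def)
  qed
  have "Dunkl tau i (mulx i f) \<beta> S = mulx i (dx i f) \<beta> S + f \<beta> S +
     kappa * (\<Sum>j\<in>{1..N} - {i}. mulx i (\<lambda>\<beta>. rho (tr i j) (ddiff i j f \<beta>)) \<beta> S + act tau (tr i j) f \<beta> S)"
    unfolding Dunkl_def size d
    by (intro arg_cong2[where f = "(+)"] arg_cong2[where f = "(*)"] refl sum.cong j)
  then show ?thesis
    by (auto simp: sum.distrib algebra_simps mulx_def Dunkl_def size vzero_def)
qed

lemma Dunkl_mulx_other:
  assumes "i \<in> {1..N}" "k \<in> {1..N}" "i \<noteq> k"
  shows "Dunkl tau i (mulx k f) \<beta> S = mulx k (Dunkl tau i f) \<beta> S - kappa * act tau (tr i k) f \<beta> S"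
proof -
  have d: "dx i (mulx k f) \<beta> S = mulx k (dx i f) \<beta> S"
    using assms by (auto simp: dx_def mulx_def vzero_def fun_upd_twist)
  have j: "rho (tr i j) (ddiff i j (mulx k f) \<beta>) S =
      mulx k (\<lambda>\<beta>. rho (tr i j) (ddiff i j f \<beta>)) \<beta> S - (if j = k then act tau (tr i k) f \<beta> S else 0)"
    if "j \<in> {1..N} - {i}" for j
  proof (cases "j = k")
    case True
    have "ddiff i k (mulx k f) \<beta> = (\<lambda>S. mulx k (ddiff i k f) \<beta> S - f (\<beta> \<circ> tr i k) S)"
      using ddiff_mulx[of i k f \<beta>] assms by auto
    then show ?thesis using True
      by (simp add: tau_rep_diff act_def mulx_def)
  next
    case False
    have "ddiff i j (mulx k f) \<beta> = mulx k (ddiff i j f) \<beta>"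
      using ddiff_mulx_other[of i j k f \<beta>] assms False that by auto
    then show ?thesis using False by (simp add: mulx_def)
  qed
  have "Dunkl tau i (mulx k f) \<beta> S = mulx k (dx i f) \<beta> S +
     kappa * (\<Sum>j\<in>{1..N} - {i}. mulx k (\<lambda>\<beta>. rho (tr i j) (ddiff i j f \<beta>)) \<beta> S -
       (if j = k then act tau (tr i k) f \<beta> S else 0))"
    unfolding Dunkl_def size d
    by (intro arg_cong2[where f = "(+)"] arg_cong2[where f = "(*)"] refl sum.cong j)
  also have "\<dots> = mulx k (dx i f) \<beta> S + kappa * (\<Sum>j\<in>{1..N} - {i}. mulx k (\<lambda>\<beta>. rho (tr i j) (ddiff i j f \<beta>)) \<beta> S) -
     kappa * act tau (tr i k) f \<beta> S"
    using assms by (simp add: sum_subtractf algebra_simps)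
  finally show ?thesis
    by (auto simp: mulx_def Dunkl_def size vzero_def)
qed

text \<open>Moving \<open>x\<^sub>i\<close> to the left creates all transpositions
  \<open>(i,j)\<close>, and the definition of \<open>Uop\<close> subtracts those with
  \<open>j < i\<close>. What remains besides \<open>x\<^sub>i D\<^sub>i + 1\<close> is a
  Jucys--Murphy sum, which is empty for \<open>i = N\<close>.\<close>

lemma Uop_eq:
  assumes i: "i \<in> {1..N}"
  shows "Uop tau i f \<beta> S = mulx i (Dunkl tau i f) \<beta> S + f \<beta> S +
     kappa * (\<Sum>j\<in>{i<..N}. act tau (tr i j) f \<beta> S)"
proof -
  have eq: "{1..N} - {i} = {1..<i} \<union> {i<..N}" using i by auto
  have "(\<Sum>j\<in>{1..N} - {i}. act tau (tr i j) f \<beta> S) =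
      (\<Sum>j\<in>{1..<i}. act tau (tr i j) f \<beta> S) + (\<Sum>j\<in>{i<..N}. act tau (tr i j) f \<beta> S)"
    unfolding eq by (rule sum.union_disjoint) auto
  then show ?thesis
    unfolding Uop_def Dunkl_mulx_same[OF i] by (simp add: algebra_simps)
qed

lemma tr_sym: "tr i j = tr j i"
  by (auto simp: fun_eq_iff tr_def)

lemma act_Uop:
  assumes w: "w permutes {1..N}" and k: "k \<in> {1..N}" and f: "f \<in> PV"
  shows "act tau w (Uop tau k f) \<beta> S = Dunkl tau (w k) (mulx (w k) (act tau w f)) \<beta> S -
     kappa * (\<Sum>j\<in>{1..<k}. act tau (tr (w k) (w j)) (act tau w f) \<beta> S)"
proof -
  have "act tau w (Uop tau k f) \<beta> S = act tau w (Dunkl tau k (mulx k f)) \<beta> S -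
     kappa * (\<Sum>j\<in>{1..<k}. act tau w (act tau (tr k j) f) \<beta> S)"
    unfolding Uop_def by (simp add: act_def tau_rep_diff tau_rep_scale tau_rep_sum)
  then show ?thesis
    using k f by (simp add: act_Dunkl[OF w] mulx_in_PV act_mulx[OF w] act_tr_conj[OF w])
qed

text \<open>The relations of the graded affine Hecke algebra. The range \<open>j < k\<close>
  subtracted in \<open>Uop\<close> is mapped to itself by the exchange unless \<open>k\<close> is
  \<open>i\<close> or \<open>Suc i\<close>; there one transposition is gained or lost, and it
  cancels against the exchange, leaving \<open>kappa * f\<close>.\<close>

lemma act_adj_Uop:
  assumes i: "1 \<le> i" "i < N" and f: "f \<in> PV"
  defines "s \<equiv> tr i (Suc i)"
  shows "act tau s (Uop tau i f) \<beta> S = Uop tau (Suc i) (act tau s f) \<beta> S + kappa * f \<beta> S" (is ?A)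
    and "act tau s (Uop tau (Suc i) f) \<beta> S = Uop tau i (act tau s f) \<beta> S - kappa * f \<beta> S" (is ?B)
    and "k \<in> {1..N} \<Longrightarrow> k \<noteq> i \<Longrightarrow> k \<noteq> Suc i \<Longrightarrow> act tau s (Uop tau k f) \<beta> S = Uop tau k (act tau s f) \<beta> S"
proof -
  have s: "s permutes {1..N}" unfolding s_def using i by (intro tr_permutes) auto
  have ss: "act tau s (act tau s f) = f"
    using act_comp[OF s s f] f by (simp add: s_def)
  note gen = act_Uop[OF s _ f, of _ \<beta> S]
  have "act tau s (Uop tau i f) \<beta> S = Dunkl tau (Suc i) (mulx (Suc i) (act tau s f)) \<beta> S -
     kappa * (\<Sum>j\<in>{1..<i}. act tau (tr (Suc i) j) (act tau s f) \<beta> S)"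
    using gen[of i] i by (simp add: s_def)
  moreover have "(\<Sum>j\<in>{1..<Suc i}. act tau (tr (Suc i) j) (act tau s f) \<beta> S) =
      (\<Sum>j\<in>{1..<i}. act tau (tr (Suc i) j) (act tau s f) \<beta> S) + f \<beta> S"
    using i ss by (simp add: s_def tr_sym[of "Suc i" i])
  ultimately show ?A
    by (simp add: Uop_def algebra_simps)
  have "act tau s (Uop tau (Suc i) f) \<beta> S = Dunkl tau i (mulx i (act tau s f)) \<beta> S -
     kappa * (\<Sum>j\<in>{1..<Suc i}. act tau (tr i (s j)) (act tau s f) \<beta> S)"
    using gen[of "Suc i"] i by (simp add: s_def)
  moreover have "(\<Sum>j\<in>{1..<Suc i}. act tau (tr i (s j)) (act tau s f) \<beta> S) =
      (\<Sum>j\<in>{1..<i}. act tau (tr i j) (act tau s f) \<beta> S) + f \<beta> S"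
    using i ss by (simp add: s_def)
  ultimately show ?B
    by (simp add: Uop_def algebra_simps)
  assume k: "k \<in> {1..N}" "k \<noteq> i" "k \<noteq> Suc i"
  have "(\<Sum>j\<in>{1..<k}. act tau (tr k (s j)) (act tau s f) \<beta> S) =
      (\<Sum>j\<in>{1..<k}. act tau (tr k j) (act tau s f) \<beta> S)"
    by (rule sum.reindex_bij_witness[of _ s s]) (use k i in \<open>auto simp: s_def tr_def\<close>)
  then show "act tau s (Uop tau k f) \<beta> S = Uop tau k (act tau s f) \<beta> S"
    using gen[OF k(1)] k by (simp add: Uop_def s_def)
qed

end

section \<open>Ranks and the dominance order\<close>

lemma rank_outside: "i \<notin> {1..N} \<Longrightarrow> rank N \<alpha> i = i"
  by (simp only: rank_def if_False)

lemma rank_eq_card: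
  assumes "i \<in> {1..N}"
  shows "rank N \<alpha> i = card {j\<in>{1..N}. \<alpha> i < \<alpha> j \<or> \<alpha> j = \<alpha> i \<and> j \<le> i}"
proof -
  have "{j\<in>{1..N}. \<alpha> i < \<alpha> j \<or> \<alpha> j = \<alpha> i \<and> j \<le> i} = {j\<in>{1..N}. \<alpha> i < \<alpha> j} \<union> {j\<in>{1..i}. \<alpha> j = \<alpha> i}"
    using assms by auto
  moreover have "card ({j\<in>{1..N}. \<alpha> i < \<alpha> j} \<union> {j\<in>{1..i}. \<alpha> j = \<alpha> i}) =
      card {j\<in>{1..N}. \<alpha> i < \<alpha> j} + card {j\<in>{1..i}. \<alpha> j = \<alpha> i}"
    by (rule card_Un_disjoint) auto
  ultimately show ?thesis
    using assms by (simp add: rank_def)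
qed

lemma rank_less_iff:
  assumes i: "i \<in> {1..N}" and j: "j \<in> {1..N}"
  shows "rank N \<alpha> i < rank N \<alpha> j \<longleftrightarrow> \<alpha> j < \<alpha> i \<or> \<alpha> j = \<alpha> i \<and> i < j"
proof -
  have *: "rank N \<alpha> i < rank N \<alpha> j"
    if i: "i \<in> {1..N}" and j: "j \<in> {1..N}" and ij: "\<alpha> j < \<alpha> i \<or> \<alpha> j = \<alpha> i \<and> i < j" for i j
    unfolding rank_eq_card[OF i] rank_eq_card[OF j]
  proof (rule psubset_card_mono)
    have "j \<notin> {k \<in> {1..N}. \<alpha> i < \<alpha> k \<or> \<alpha> k = \<alpha> i \<and> k \<le> i}"
      "j \<in> {k \<in> {1..N}. \<alpha> j < \<alpha> k \<or> \<alpha> k = \<alpha> j \<and> k \<le> j}"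
      "{k \<in> {1..N}. \<alpha> i < \<alpha> k \<or> \<alpha> k = \<alpha> i \<and> k \<le> i} \<subseteq> {k \<in> {1..N}. \<alpha> j < \<alpha> k \<or> \<alpha> k = \<alpha> j \<and> k \<le> j}"
      using ij j by auto
    then show "{k \<in> {1..N}. \<alpha> i < \<alpha> k \<or> \<alpha> k = \<alpha> i \<and> k \<le> i} \<subset> {k \<in> {1..N}. \<alpha> j < \<alpha> k \<or> \<alpha> k = \<alpha> j \<and> k \<le> j}"
      by blast
  qed simp
  consider "\<alpha> j < \<alpha> i \<or> \<alpha> j = \<alpha> i \<and> i < j" | "\<alpha> i < \<alpha> j \<or> \<alpha> i = \<alpha> j \<and> j < i" | "i = j"
    by linarith
  then show ?thesis
    by cases (use *[OF i j] *[OF j i] in auto)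
qed

lemma rank_permutes: "rank N \<alpha> permutes {1..N}"
proof (rule bij_imp_permutes)
  have "inj_on (rank N \<alpha>) {1..N}"
    using rank_less_iff[of _ N _ \<alpha>] by (intro inj_onI) (metis less_irrefl nat_neq_iff)
  moreover have "rank N \<alpha> ` {1..N} \<subseteq> {1..N}"
  proof
    fix r assume "r \<in> rank N \<alpha> ` {1..N}"
    then obtain i where i: "i \<in> {1..N}" "r = rank N \<alpha> i" by auto
    have "card {i} \<le> r"
      unfolding i(2) rank_eq_card[OF i(1)] using i(1) by (intro card_mono) auto
    moreover have "r \<le> card {1..N}"
      unfolding i(2) rank_eq_card[OF i(1)] by (intro card_mono) auto
    ultimately show "r \<in> {1..N}" by simp
  qed
  ultimately show "bij_betw (rank N \<alpha>) {1..N} {1..N}"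
    by (simp add: bij_betw_def card_image card_subset_eq)
qed (rule rank_outside)

text \<open>\<open>rank\<close> is the place in a total order on positions, larger exponent first
  and ties from left to right, so it is carried along by any order isomorphism.\<close>

lemma rank_transfer:
  assumes w: "w permutes {1..N}"
    and order: "\<And>j k. j \<in> {1..N} \<Longrightarrow> k \<in> {1..N} \<Longrightarrow>
      (\<alpha>' j < \<alpha>' k \<or> \<alpha>' k = \<alpha>' j \<and> k \<le> j) \<longleftrightarrow>
      (\<alpha> (w j) < \<alpha> (w k) \<or> \<alpha> (w k) = \<alpha> (w j) \<and> w k \<le> w j)"
  shows "rank N \<alpha>' = rank N \<alpha> \<circ> w"
proof
  fix j
  show "rank N \<alpha>' j = (rank N \<alpha> \<circ> w) j"
  proof (cases "j \<in> {1..N}")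
    case True
    then have wj: "w j \<in> {1..N}" using permutes_in_image[OF w] by blast
    let ?A = "{k\<in>{1..N}. \<alpha>' j < \<alpha>' k \<or> \<alpha>' k = \<alpha>' j \<and> k \<le> j}"
    let ?B = "{l\<in>{1..N}. \<alpha> (w j) < \<alpha> l \<or> \<alpha> l = \<alpha> (w j) \<and> l \<le> w j}"
    have "w ` ?A = ?B"
    proof
      show "w ` ?A \<subseteq> ?B"
        using order[OF True] permutes_in_image[OF w] by blast
      show "?B \<subseteq> w ` ?A"
      proof
        fix l assume l: "l \<in> ?B"
        obtain k where k: "l = w k" "k \<in> {1..N}"
          using l permutes_image[OF w] by blast
        then show "l \<in> w ` ?A" using order[OF True k(2)] l by blast
      qed
    qed
    then have "card ?B = card ?A"
      using card_image[OF permutes_inj_on[OF w, of ?A]] by simp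
    then show ?thesis
      using rank_eq_card[OF True] rank_eq_card[OF wj] by simp
  next
    case False
    then show ?thesis using permutes_not_in[OF w False] by (simp add: rank_outside)
  qed
qed

lemma rank_fixed:
  assumes "i \<in> {1..N}" and "\<And>j. j \<in> {1..N} \<Longrightarrow> (j \<le> i \<longrightarrow> \<alpha> i \<le> \<alpha> j) \<and> (i < j \<longrightarrow> \<alpha> j \<le> \<alpha> i)"
  shows "rank N \<alpha> i = i"
proof -
  have "\<alpha> i < \<alpha> j \<or> \<alpha> j = \<alpha> i \<and> j \<le> i \<longleftrightarrow> j \<le> i" if "j \<in> {1..N}" for j
    using assms(2)[OF that] by (cases "j \<le> i") auto
  then have "{j\<in>{1..N}. \<alpha> i < \<alpha> j \<or> \<alpha> j = \<alpha> i \<and> j \<le> i} = {j\<in>{1..N}. j \<le> i}"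
    by blast
  also have "\<dots> = {1..i}" using assms(1) by auto
  finally have "{j\<in>{1..N}. \<alpha> i < \<alpha> j \<or> \<alpha> j = \<alpha> i \<and> j \<le> i} = {1..i}" .
  then show ?thesis using rank_eq_card[OF assms(1)] by simp
qed

lemma rank_swap:
  assumes "1 \<le> i" "i < N" "\<alpha> i \<noteq> \<alpha> (Suc i)"
  shows "rank N (\<alpha> \<circ> tr i (Suc i)) = rank N \<alpha> \<circ> tr i (Suc i)"
proof (rule rank_transfer)
  show "tr i (Suc i) permutes {1..N}" using assms by (intro tr_permutes) auto
  fix j k
  have "k \<le> j \<longleftrightarrow> tr i (Suc i) k \<le> tr i (Suc i) j" if "\<not> (j = i \<and> k = Suc i)" "\<not> (j = Suc i \<and> k = i)"
    using that unfolding tr_def by presburger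
  then show "((\<alpha> \<circ> tr i (Suc i)) j < (\<alpha> \<circ> tr i (Suc i)) k \<or>
      (\<alpha> \<circ> tr i (Suc i)) k = (\<alpha> \<circ> tr i (Suc i)) j \<and> k \<le> j) \<longleftrightarrow>
    (\<alpha> (tr i (Suc i) j) < \<alpha> (tr i (Suc i) k) \<or>
      \<alpha> (tr i (Suc i) k) = \<alpha> (tr i (Suc i) j) \<and> tr i (Suc i) k \<le> tr i (Suc i) j)"
    using assms(3) by (cases "j = i \<and> k = Suc i \<or> j = Suc i \<and> k = i") auto
qed

section \<open>Nonincreasing rearrangements and dominance\<close>

lemma sort_eq_if_mset_eq: "mset xs = mset ys \<Longrightarrow> sort xs = sort (ys :: nat list)"
  by (metis mset_sort properties_for_sort sorted_sort)

lemma mset_map_interval: "mset (map \<alpha> [1..<N + 1]) = image_mset \<alpha> (mset_set {1..N})"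
proof -
  have "mset [1..<N + 1] = mset_set {1..N}"
    by (metis Suc_eq_plus1 atLeastLessThanSuc_atLeastAtMost mset_upt)
  then show ?thesis by (simp only: mset_map)
qed

lemma plus_rearr_permute:
  assumes w: "w permutes {1..N}"
  shows "plus_rearr N (\<alpha> \<circ> w) = plus_rearr N \<alpha>"
proof -
  have "image_mset (\<alpha> \<circ> w) (mset_set {1..N}) = image_mset \<alpha> (image_mset w (mset_set {1..N}))"
    by (simp only: multiset.map_comp)
  also have "image_mset w (mset_set {1..N}) = mset_set {1..N}"
    using image_mset_mset_set[OF permutes_inj_on[OF w]] permutes_image[OF w] by simp
  finally have "sort (map (\<alpha> \<circ> w) [1..<N + 1]) = sort (map \<alpha> [1..<N + 1])"
    by (intro sort_eq_if_mset_eq) (simp only: mset_map_interval)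
  then show ?thesis
    by (simp only: plus_rearr_def fun_eq_iff) simp
qed

lemma sum_plus_rearr:
  fixes \<phi> :: "nat \<Rightarrow> nat"
  shows "(\<Sum>j\<in>{1..N}. \<phi> (plus_rearr N \<alpha> j)) = (\<Sum>j\<in>{1..N}. \<phi> (\<alpha> j))"
proof -
  let ?xs = "rev (sort (map \<alpha> [1..<N + 1]))"
  have "(\<Sum>j\<in>{1..N}. \<phi> (plus_rearr N \<alpha> j)) = (\<Sum>j\<in>{0..<N}. \<phi> (?xs ! j))"
    by (rule sum.reindex_bij_witness[of _ Suc "\<lambda>j. j - 1"]) (auto simp: plus_rearr_def simp del: upt_Suc)
  also have "\<dots> = sum_list (map \<phi> ?xs)"
    by (subst sum_list_sum_nth) (auto simp del: upt_Suc)
  also have "\<dots> = sum_mset (image_mset \<phi> (mset ?xs))"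
    by (metis mset_map sum_mset_sum_list)
  also have "mset ?xs = image_mset \<alpha> (mset_set {1..N})"
    by (simp only: mset_rev mset_sort mset_map_interval)
  also have "sum_mset (image_mset \<phi> (image_mset \<alpha> (mset_set {1..N}))) = (\<Sum>j\<in>{1..N}. \<phi> (\<alpha> j))"
    by (simp add: sum_unfold_sum_mset multiset.map_comp comp_def)
  finally show ?thesis .
qed

lemma plus_rearr_antimono:
  assumes "i \<in> {1..N}" "j \<in> {1..N}" "i \<le> j"
  shows "plus_rearr N \<alpha> j \<le> plus_rearr N \<alpha> i"
proof -
  have "rev (sort (map \<alpha> [1..<N + 1])) ! (j - 1) \<le> rev (sort (map \<alpha> [1..<N + 1])) ! (i - 1)"
    using assms by (intro sorted_rev_nth_mono) (auto simp del: upt_Suc)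
  then show ?thesis using assms unfolding plus_rearr_def by simp
qed

text \<open>The sum of the \<open>k\<close> largest entries is the minimum over \<open>t\<close> of
  \<open>k * t + (\<Sum>j. max (\<alpha> j - t) 0)\<close>, so dominance can be tested on the convex
  functions \<open>x \<mapsto> max (x - t) 0\<close>; truncated subtraction on \<open>nat\<close> is intended here.\<close>

lemma plus_rearr_dominated:
  assumes le: "\<And>t. (\<Sum>j\<in>{1..N}. \<alpha> j - t) \<le> (\<Sum>j\<in>{1..N}. \<beta> j - t)" and k: "k \<in> {1..N}"
  shows "(\<Sum>j\<in>{1..k}. plus_rearr N \<alpha> j) \<le> (\<Sum>j\<in>{1..k}. plus_rearr N \<beta> j)"
proof -
  define t where "t = plus_rearr N \<beta> k"
  have "(\<Sum>j\<in>{1..k}. plus_rearr N \<alpha> j) \<le> (\<Sum>j\<in>{1..k}. t + (plus_rearr N \<alpha> j - t))"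
    by (rule sum_mono) simp
  also have "\<dots> = k * t + (\<Sum>j\<in>{1..k}. plus_rearr N \<alpha> j - t)"
    by (simp add: sum.distrib)
  also have "\<dots> \<le> k * t + (\<Sum>j\<in>{1..N}. plus_rearr N \<alpha> j - t)"
    using k by (intro add_left_mono sum_mono2) auto
  also have "(\<Sum>j\<in>{1..N}. plus_rearr N \<alpha> j - t) \<le> (\<Sum>j\<in>{1..N}. plus_rearr N \<beta> j - t)"
    using le[of t] sum_plus_rearr[of "\<lambda>x. x - t"] by simp
  also have "(\<Sum>j\<in>{1..N}. plus_rearr N \<beta> j - t) = (\<Sum>j\<in>{1..k}. plus_rearr N \<beta> j - t)"
    using k plus_rearr_antimono[of k N _ \<beta>]
    by (intro sum.mono_neutral_right) (auto simp: t_def)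
  also have "k * t + (\<Sum>j\<in>{1..k}. plus_rearr N \<beta> j - t) = (\<Sum>j\<in>{1..k}. t + (plus_rearr N \<beta> j - t))"
    by (simp add: sum.distrib)
  also have "\<dots> = (\<Sum>j\<in>{1..k}. plus_rearr N \<beta> j)"
    using k plus_rearr_antimono[of _ N k \<beta>] by (intro sum.cong) (auto simp: t_def)
  finally show ?thesis by simp
qed

lemma sum_upd2:
  fixes \<phi> \<beta> :: "nat \<Rightarrow> nat"
  assumes "i \<in> {1..N}" "j \<in> {1..N}" "i \<noteq> j"
  shows "(\<Sum>l\<in>{1..N}. \<phi> ((\<beta>(i := p, j := q)) l)) = \<phi> p + \<phi> q + (\<Sum>l\<in>{1..N} - {i, j}. \<phi> (\<beta> l))"
proof -
  have eq: "{1..N} = insert i (insert j ({1..N} - {i, j}))" using assms by auto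
  define g where "g l = \<phi> ((\<beta>(i := p, j := q)) l)" for l
  have "(\<Sum>l\<in>insert i (insert j ({1..N} - {i, j})). g l) = g i + (g j + (\<Sum>l\<in>{1..N} - {i, j}. g l))"
    using assms(3) by simp
  also have "g i = \<phi> p" using assms(3) by (simp add: g_def)
  also have "g j = \<phi> q" by (simp add: g_def)
  also have "(\<Sum>l\<in>{1..N} - {i, j}. g l) = (\<Sum>l\<in>{1..N} - {i, j}. \<phi> (\<beta> l))"
    by (rule sum.cong) (auto simp: g_def)
  finally show ?thesis by (simp only: eq[symmetric] add.assoc g_def)
qed

text \<open>Pushing two exponents apart at constant sum can only increase every sum of a convex
  function of the exponents, which is dominance of the rearrangements.\<close>

lemma dlt_spread:
  assumes ij: "i \<in> {1..N}" "j \<in> {1..N}" "i \<noteq> j" and pq: "p + q = \<beta> i + \<beta> j"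
    and min: "p < min (\<beta> i) (\<beta> j) \<or> q < min (\<beta> i) (\<beta> j)"
  shows "dlt N \<beta> (\<beta>(i := p, j := q))"
proof -
  let ?\<gamma> = "\<beta>(i := p, j := q)"
  have \<beta>: "\<beta> = \<beta>(i := \<beta> i, j := \<beta> j)" by simp
  note s\<beta> = sum_upd2[OF ij, of _ \<beta> "\<beta> i" "\<beta> j", unfolded \<beta>[symmetric]]
  note s\<gamma> = sum_upd2[OF ij, of _ \<beta> p q]
  have "(\<Sum>l\<in>{1..N}. \<beta> l) = (\<Sum>l\<in>{1..N}. ?\<gamma> l)"
    using s\<beta>[of "\<lambda>x. x"] s\<gamma>[of "\<lambda>x. x"] pq by linarith
  moreover have "prec N (plus_rearr N \<beta>) (plus_rearr N ?\<gamma>)"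
    unfolding prec_def
  proof (intro conjI ballI notI)
    have le: "(\<Sum>l\<in>{1..N}. \<beta> l - t) \<le> (\<Sum>l\<in>{1..N}. ?\<gamma> l - t)" for t
      unfolding s\<beta>[of "\<lambda>x. x - t"] s\<gamma>[of "\<lambda>x. x - t"] using pq min by linarith
    show "(\<Sum>l\<in>{1..k}. plus_rearr N \<beta> l) \<le> (\<Sum>l\<in>{1..k}. plus_rearr N ?\<gamma> l)" if "k \<in> {1..N}" for k
      using le that by (rule plus_rearr_dominated)
    \<comment> \<open>At this threshold the two old exponents contribute 0, while the larger of
      \<open>p\<close> and \<open>q\<close> exceeds it; so the truncated sums differ and the
      increase is strict.\<close>
    define t where "t = max (\<beta> i) (\<beta> j)"
    assume "plus_rearr N \<beta> = plus_rearr N ?\<gamma>"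
    then have "(\<Sum>l\<in>{1..N}. \<beta> l - t) = (\<Sum>l\<in>{1..N}. ?\<gamma> l - t)"
      using sum_plus_rearr[of "\<lambda>x. x - t"] by metis
    then show False
      unfolding s\<beta>[of "\<lambda>x. x - t"] s\<gamma>[of "\<lambda>x. x - t"] using pq min by (auto simp: t_def)
  qed
  ultimately show ?thesis by (simp add: dlt_def)
qed

text \<open>The rearrangement is unchanged, so the second clause of \<open>dlt\<close> decides:
  bringing the larger exponent forward raises exactly the partial sums that end before
  \<open>j\<close> and include \<open>i\<close>.\<close>

lemma dlt_swap:
  assumes ij: "i \<in> {1..N}" "j \<in> {1..N}" "i < j" and less: "\<beta> i < \<beta> j"
  shows "dlt N \<beta> (\<beta> \<circ> tr i j)"
proof -
  let ?w = "tr i j"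
  have w: "?w permutes {1..N}" using ij by (intro tr_permutes) auto
  have sum: "(\<Sum>l\<in>{1..k}. (\<beta> \<circ> ?w) l) = (\<Sum>l\<in>{1..k}. \<beta> l)" if "j \<le> k" for k
    using that ij sum.permute[of ?w "{1..k}" \<beta>] tr_permutes[of i k j] by auto
  have "prec N \<beta> (\<beta> \<circ> ?w)"
    unfolding prec_def
  proof (intro conjI ballI)
    show "\<beta> \<noteq> \<beta> \<circ> ?w"
      using less by (metis comp_apply less_irrefl tr_simps(1))
    fix k assume "k \<in> {1..N}"
    show "(\<Sum>l\<in>{1..k}. \<beta> l) \<le> (\<Sum>l\<in>{1..k}. (\<beta> \<circ> ?w) l)"
    proof (cases "j \<le> k")
      case False
      then show ?thesis using less by (intro sum_mono) (auto simp: tr_def)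
    qed (simp only: sum)
  qed
  then show ?thesis
    using sum[of N] ij plus_rearr_permute[OF w] by (simp add: dlt_def)
qed

lemma prec_antisym:
  assumes "monomial_exp N \<alpha>" "monomial_exp N \<beta>" "prec N \<alpha> \<beta>" "prec N \<beta> \<alpha>"
  shows False
proof -
  have eq: "(\<Sum>j\<in>{1..k}. \<alpha> j) = (\<Sum>j\<in>{1..k}. \<beta> j)" if "k \<le> N" for k
    using assms(3,4) that by (cases "k = 0") (auto simp: prec_def intro!: antisym)
  have "\<alpha> k = \<beta> k" for k
  proof (cases "k \<in> {1..N}")
    case True
    then obtain l where "k = Suc l" "l < N" by (cases k) auto
    then show ?thesis using eq[of k] eq[of l] by simp
  next
    case False
    then show ?thesis using assms(1,2) by (simp add: monomial_exp_def)
  qed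
  then show False using assms(3) by (auto simp: prec_def)
qed

lemma prec_trans:
  assumes "monomial_exp N \<alpha>" "monomial_exp N \<beta>" "prec N \<alpha> \<beta>" "prec N \<beta> \<gamma>"
  shows "prec N \<alpha> \<gamma>"
  using assms prec_antisym[OF assms(1,2)] unfolding prec_def by (blast intro: order_trans)

lemma monomial_exp_plus_rearr: "monomial_exp N (plus_rearr N \<alpha>)"
  by (auto simp: monomial_exp_def plus_rearr_def)

lemma dlt_trans:
  assumes "monomial_exp N \<alpha>" "monomial_exp N \<beta>" "dlt N \<alpha> \<beta>" "dlt N \<beta> \<gamma>"
  shows "dlt N \<alpha> \<gamma>"
  using assms(3,4) prec_trans[OF assms(1,2)] prec_trans[OF monomial_exp_plus_rearr monomial_exp_plus_rearr]
  unfolding dlt_def by metis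

lemma not_dlt_refl: "\<not> dlt N \<alpha> \<alpha>"
  by (simp add: dlt_def prec_def)

lemma dlt_asym:
  assumes "monomial_exp N \<alpha>" "monomial_exp N \<beta>" "dlt N \<alpha> \<beta>"
  shows "\<not> dlt N \<beta> \<alpha>"
  using dlt_trans[OF assms] not_dlt_refl by blast

lemma monomial_exp_permute: "w permutes {1..N} \<Longrightarrow> monomial_exp N \<beta> \<Longrightarrow> monomial_exp N (\<beta> \<circ> w)"
  unfolding monomial_exp_def using permutes_not_in by fastforce

lemma monomial_exp_upd: "i \<in> {1..N} \<Longrightarrow> monomial_exp N \<beta> \<Longrightarrow> monomial_exp N (\<beta>(i := c))"
  by (auto simp: monomial_exp_def)

section \<open>Triangularity of the commuting operators\<close>

context young_shape
begin

text \<open>Whatever lies above \<beta> is absent, and for each \<open>j\<close> the remaining terms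
  add up to the coefficient at \<beta> itself or to 0. For larger exponent at \<open>i\<close> it
  comes from the divided difference, for equal exponents with \<open>i < j\<close> from the
  Jucys--Murphy sum; together these are the \<open>j\<close> of larger rank.\<close>

lemma Uop_leading:
  assumes i: "i \<in> {1..N}" and f: "f \<in> PV" and \<beta>: "monomial_exp N \<beta>"
    and above: "\<And>\<gamma>. monomial_exp N \<gamma> \<Longrightarrow> dlt N \<beta> \<gamma> \<Longrightarrow> f \<gamma> = vzero"
  shows "Uop tau i f \<beta> S = of_nat (\<beta> i + 1) * f \<beta> S +
     kappa * (\<Sum>j | j \<in> {1..N} \<and> rank N \<beta> i < rank N \<beta> j. rho (tr i j) (f \<beta>) S)"
proof -
  \<comment> \<open>\<open>E j\<close> gathers the two vectors to which \<open>rho (tr i j)\<close>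
    is applied: one from the divided difference, one from the sum over \<open>j > i\<close>.\<close>
  define E where "E j = (\<lambda>S. mulx i (ddiff i j f) \<beta> S + (if i < j then f (\<beta> \<circ> tr i j) S else 0))" for j
  have E: "E j = (if rank N \<beta> i < rank N \<beta> j then f \<beta> else vzero)" if j: "j \<in> {1..N} - {i}" for j
  proof -
    have jN: "j \<in> {1..N}" "i \<noteq> j" using j by auto
    let ?s = "\<beta> i + \<beta> j"
    have tr: "\<beta> \<circ> tr i j = \<beta>(i := \<beta> j, j := \<beta> i)"
      using jN by (simp add: comp_tr_upd)
    have same: "\<beta> \<circ> tr i j = \<beta>" if "\<beta> j = \<beta> i"
      using that by (auto simp: fun_eq_iff tr_def)
    have small: "f (\<beta>(i := ?s - a, j := a)) = vzero" "f (\<beta>(i := a, j := ?s - a)) = vzero"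
      if "a < min (\<beta> i) (\<beta> j)" for a
      using that i jN \<beta> by (auto intro!: above dlt_spread monomial_exp_upd)
    have up: "f (\<beta> \<circ> tr i j) = vzero" if "i < j \<and> \<beta> i < \<beta> j \<or> j < i \<and> \<beta> j < \<beta> i"
      using that dlt_swap[of i N j \<beta>] dlt_swap[of j N i \<beta>] i jN \<beta> tr_sym[of j i]
        monomial_exp_permute[OF tr_permutes]
      by (metis above)
    have dd: "mulx i (ddiff i j f) \<beta> = (if \<beta> j < \<beta> i then (\<lambda>S. f \<beta> S - f (\<beta> \<circ> tr i j) S) else vzero)"
    proof (cases "\<beta> i = 0")
      case True
      then show ?thesis by (simp add: mulx_def)
    next
      case False
      have "ddiff i j f (\<beta>(i := \<beta> i - 1)) S = (\<Sum>a\<le>min (\<beta> i - 1) (\<beta> j).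
          f (\<beta>(i := ?s - a, j := a)) S - f (\<beta>(i := a, j := ?s - a)) S)" for S
        unfolding ddiff_closed[OF jN(2)] using False jN by (simp add: fun_upd_twist)
      \<comment> \<open>Each \<open>a\<close> below both exponents refers to spread exponents, which
        lie above \<beta>. The range reaches \<open>min (\<beta> i) (\<beta> j)\<close> only when
        \<beta> j < \<beta> i, at \<open>a = \<beta> j\<close>.\<close>
      also have "\<dots> S = (\<Sum>a\<le>min (\<beta> i - 1) (\<beta> j). if a = \<beta> j \<and> \<beta> j < \<beta> i then f \<beta> S - f (\<beta> \<circ> tr i j) S else 0)" for S
      proof (rule sum.cong[OF refl])
        fix a assume a: "a \<in> {..min (\<beta> i - 1) (\<beta> j)}"
        show "f (\<beta>(i := ?s - a, j := a)) S - f (\<beta>(i := a, j := ?s - a)) S =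
            (if a = \<beta> j \<and> \<beta> j < \<beta> i then f \<beta> S - f (\<beta> \<circ> tr i j) S else 0)"
        proof (cases "a = \<beta> j \<and> \<beta> j < \<beta> i")
          case True
          then show ?thesis by (simp add: tr)
        next
          case F: False
          then have "a < min (\<beta> i) (\<beta> j)" using a False by auto
          then show ?thesis using small[of a] F by (simp add: vzero_def)
        qed
      qed
      finally show ?thesis
        using False by (auto simp: mulx_def fun_eq_iff vzero_def sum.delta)
    qed
    show ?thesis
      unfolding E_def dd rank_less_iff[OF i jN(1)] using up jN
      by (cases "\<beta> j" "\<beta> i" rule: linorder_cases; cases "i < j")
         (auto simp: fun_eq_iff vzero_def same)
  qed
  have dx: "mulx i (dx i f) \<beta> S = of_nat (\<beta> i) * f \<beta> S"
    by (auto simp: mulx_def dx_def vzero_def of_nat_diff)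
  have "Uop tau i f \<beta> S = of_nat (\<beta> i + 1) * f \<beta> S +
     kappa * ((\<Sum>j\<in>{1..N} - {i}. mulx i (\<lambda>\<beta>. rho (tr i j) (ddiff i j f \<beta>)) \<beta> S) +
       (\<Sum>j\<in>{i<..N}. act tau (tr i j) f \<beta> S))"
  proof -
    have "mulx i (Dunkl tau i f) \<beta> S = mulx i (dx i f) \<beta> S +
       kappa * (\<Sum>j\<in>{1..N} - {i}. mulx i (\<lambda>\<beta>. rho (tr i j) (ddiff i j f \<beta>)) \<beta> S)"
      by (auto simp: mulx_def Dunkl_def size vzero_def)
    then show ?thesis
      unfolding Uop_eq[OF i] dx by (simp add: algebra_simps)
  qed
  also have "(\<Sum>j\<in>{i<..N}. act tau (tr i j) f \<beta> S) =
      (\<Sum>j\<in>{1..N} - {i}. if i < j then act tau (tr i j) f \<beta> S else 0)"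
    using i by (intro sum.mono_neutral_cong_left) auto
  also have "(\<Sum>j\<in>{1..N} - {i}. mulx i (\<lambda>\<beta>. rho (tr i j) (ddiff i j f \<beta>)) \<beta> S) + \<dots> =
      (\<Sum>j\<in>{1..N} - {i}. rho (tr i j) (E j) S)"
    unfolding sum.distrib[symmetric]
    by (intro sum.cong refl)
       (auto simp: E_def tau_rep_add act_def mulx_def fun_cong[OF vzero_def] simp flip: vzero_def)
  also have "\<dots> = (\<Sum>j\<in>{1..N} - {i}. if rank N \<beta> i < rank N \<beta> j then rho (tr i j) (f \<beta>) S else 0)"
    by (intro sum.cong refl) (simp add: E, simp add: vzero_def)
  also have "\<dots> = (\<Sum>j | j \<in> {1..N} \<and> rank N \<beta> i < rank N \<beta> j. rho (tr i j) (f \<beta>) S)"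
    by (intro sum.mono_neutral_cong_right) auto
  finally show ?thesis .
qed

end

section \<open>Joint eigenvectors\<close>

lemma of_int_K: "(of_int n :: K) = Fract [:of_int n:] 1"
proof (cases n)
  case (nonneg k)
  then show ?thesis by (simp add: of_nat_fract of_nat_poly)
next
  case (neg k)
  then have "(of_int n :: K) = - of_nat (Suc k)" by simp
  also have "\<dots> = Fract (- of_nat (Suc k)) 1" by (simp only: of_nat_fract minus_fract)
  finally show ?thesis using neg by (simp only: of_nat_poly) (simp del: of_nat_Suc)
qed

lemma kappa_transcendental:
  assumes "of_int a + kappa * of_int b = 0"
  shows "a = 0" "b = 0"
proof -
  have "of_int a + kappa * of_int b = Fract [:of_int a, of_int b:] 1"
    by (simp add: of_int_K kappa_def)
  then have "[:of_int a, of_int b :: real:] = 0"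
    using assms by (simp add: Zero_fract_def eq_fract)
  then show "a = 0" "b = 0" by simp_all
qed

text \<open>The integers \<open>c\<close> are arbitrary instead of contents of a tableau, because
  exchanging two positions with equal exponents permutes \<open>c\<close> into a pattern that may
  belong to no tableau.\<close>

definition spec :: "(nat \<Rightarrow> nat) \<Rightarrow> (nat \<Rightarrow> int) \<Rightarrow> nat \<Rightarrow> K" where
  "spec \<alpha> c i = of_nat (\<alpha> i + 1) + kappa * of_int (c i)"

lemma spec_diff: "spec \<alpha> c i - spec \<beta> d j = of_int (int (\<alpha> i) - int (\<beta> j)) + kappa * of_int (c i - d j)"
  by (simp add: spec_def algebra_simps)

context young_shape
begin

text \<open>The type \<open>pvec\<close> also contains formal series; finite support is what
  provides a maximal exponent.\<close>

definition Pol :: "pvec set" where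
  "Pol = {f \<in> PV. (\<forall>\<beta>. f \<beta> \<noteq> vzero \<longrightarrow> monomial_exp N \<beta>) \<and> finite {\<beta>. f \<beta> \<noteq> vzero}}"

definition eigv :: "(nat \<Rightarrow> K) \<Rightarrow> pvec \<Rightarrow> bool" where
  "eigv lam f \<longleftrightarrow> f \<in> Pol \<and> (\<forall>i\<in>{1..N}. Uop tau i f = (\<lambda>\<beta> S. lam i * f \<beta> S))"

lemma Pol_PV: "f \<in> Pol \<Longrightarrow> f \<in> PV"
  by (simp add: Pol_def)

lemma Pol_lin:
  assumes "f \<in> Pol" "g \<in> Pol"
  shows "(\<lambda>\<beta> S. a * f \<beta> S + b * g \<beta> S) \<in> Pol"
proof -
  have "(\<lambda>S. a * f \<beta> S + b * g \<beta> S) = vzero" if "f \<beta> = vzero" "g \<beta> = vzero" for \<beta>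
    using that by (simp add: vzero_def)
  then have sub: "f \<beta> \<noteq> vzero \<or> g \<beta> \<noteq> vzero" if "(\<lambda>S. a * f \<beta> S + b * g \<beta> S) \<noteq> vzero" for \<beta>
    using that by blast
  have "finite {\<beta>. (\<lambda>S. a * f \<beta> S + b * g \<beta> S) \<noteq> vzero}"
    by (rule finite_subset[of _ "{\<beta>. f \<beta> \<noteq> vzero} \<union> {\<beta>. g \<beta> \<noteq> vzero}"])
       (use sub assms in \<open>auto simp: Pol_def\<close>)
  moreover have "monomial_exp N \<beta>" if "(\<lambda>S. a * f \<beta> S + b * g \<beta> S) \<noteq> vzero" for \<beta>
    using sub[OF that] assms by (auto simp: Pol_def)
  ultimately show ?thesis
    using PV_lin[OF Pol_PV[OF assms(1)] Pol_PV[OF assms(2)]] by (simp add: Pol_def)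
qed

lemma act_in_Pol:
  assumes w: "w permutes {1..N}" and f: "f \<in> Pol"
  shows "act tau w f \<in> Pol"
proof -
  have sub: "f (\<beta> \<circ> w) \<noteq> vzero" if "act tau w f \<beta> \<noteq> vzero" for \<beta>
    using that by (auto simp: act_def)
  have inv: "\<beta> \<circ> w \<circ> inv w = \<beta>" for \<beta> :: "nat \<Rightarrow> nat"
    using permutes_inv_o[OF w] by (simp add: comp_assoc)
  have "finite {\<beta>. act tau w f \<beta> \<noteq> vzero}"
  proof (rule finite_subset)
    show "{\<beta>. act tau w f \<beta> \<noteq> vzero} \<subseteq> (\<lambda>\<beta>. \<beta> \<circ> inv w) ` {\<beta>. f \<beta> \<noteq> vzero}"
    proof
      fix \<beta> assume "\<beta> \<in> {\<beta>. act tau w f \<beta> \<noteq> vzero}"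
      then have "\<beta> \<circ> w \<in> {\<beta>. f \<beta> \<noteq> vzero}" using sub by simp
      then have "\<beta> \<circ> w \<circ> inv w \<in> (\<lambda>\<beta>. \<beta> \<circ> inv w) ` {\<beta>. f \<beta> \<noteq> vzero}" by (rule imageI)
      then show "\<beta> \<in> (\<lambda>\<beta>. \<beta> \<circ> inv w) ` {\<beta>. f \<beta> \<noteq> vzero}" by (simp only: inv)
    qed
  qed (use f in \<open>simp add: Pol_def\<close>)
  moreover have "monomial_exp N \<beta>" if "act tau w f \<beta> \<noteq> vzero" for \<beta>
  proof -
    have "monomial_exp N (\<beta> \<circ> w)" using sub[OF that] f by (simp add: Pol_def)
    then show ?thesis using monomial_exp_permute[OF permutes_inv[OF w]] inv by metis
  qed
  ultimately show ?thesis
    using act_in_PV[OF w Pol_PV[OF f]] by (auto simp: Pol_def)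
qed

lemma mulx_in_Pol:
  assumes i: "i \<in> {1..N}" and f: "f \<in> Pol"
  shows "mulx i f \<in> Pol"
proof -
  have sub: "f (\<beta>(i := \<beta> i - 1)) \<noteq> vzero \<and> \<beta> i > 0" if "mulx i f \<beta> \<noteq> vzero" for \<beta>
    using that by (auto simp: mulx_def split: if_splits)
  have "finite {\<beta>. mulx i f \<beta> \<noteq> vzero}"
  proof (rule finite_subset)
    show "{\<beta>. mulx i f \<beta> \<noteq> vzero} \<subseteq> (\<lambda>\<beta>. \<beta>(i := \<beta> i + 1)) ` {\<beta>. f \<beta> \<noteq> vzero}"
    proof
      fix \<beta> assume "\<beta> \<in> {\<beta>. mulx i f \<beta> \<noteq> vzero}"
      then have *: "f (\<beta>(i := \<beta> i - 1)) \<noteq> vzero" "\<beta> i > 0" using sub by auto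
      then have "\<beta> = (\<lambda>\<beta>. \<beta>(i := \<beta> i + 1)) (\<beta>(i := \<beta> i - 1))" by simp
      with * show "\<beta> \<in> (\<lambda>\<beta>. \<beta>(i := \<beta> i + 1)) ` {\<beta>. f \<beta> \<noteq> vzero}" by blast
    qed
  qed (use f in \<open>simp add: Pol_def\<close>)
  moreover have "monomial_exp N \<beta>" if "mulx i f \<beta> \<noteq> vzero" for \<beta>
  proof -
    have "monomial_exp N (\<beta>(i := \<beta> i - 1))" using sub[OF that] f by (auto simp: Pol_def)
    then show ?thesis using monomial_exp_upd[OF i, of "\<beta>(i := \<beta> i - 1)" "\<beta> i"] by simp
  qed
  ultimately show ?thesis
    using mulx_in_PV[OF Pol_PV[OF f]] by (auto simp: Pol_def)
qed

lemma eigv_lin: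
  assumes "eigv lam f" "eigv lam g"
  shows "eigv lam (\<lambda>\<beta> S. a * f \<beta> S + b * g \<beta> S)"
  using assms unfolding eigv_def by (auto simp: Pol_lin Uop_lin algebra_simps)

lemma sum_rank_reindex:
  assumes i: "i \<in> {1..N}"
  shows "(\<Sum>j | j \<in> {1..N} \<and> rank N \<beta> i < rank N \<beta> j. F (rank N \<beta> j)) = (\<Sum>l\<in>{rank N \<beta> i<..N}. F l)"
proof (rule sum.reindex_bij_betw)
  have "rank N \<beta> ` {j. j \<in> {1..N} \<and> rank N \<beta> i < rank N \<beta> j} =
      {l \<in> rank N \<beta> ` {1..N}. rank N \<beta> i < l}"
    by blast
  also have "\<dots> = {l\<in>{1..N}. rank N \<beta> i < l}"
    by (simp only: permutes_image[OF rank_permutes])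
  also have "\<dots> = {rank N \<beta> i<..N}" by auto
  finally show "bij_betw (rank N \<beta>) {j. j \<in> {1..N} \<and> rank N \<beta> i < rank N \<beta> j} {rank N \<beta> i<..N}"
    by (simp add: bij_betw_def permutes_inj_on[OF rank_permutes])
qed

text \<open>At a maximal exponent of the support, an eigenvector equation only involves the
  Jucys--Murphy elements; as \<open>kappa\<close> is transcendental, the integer parts force that
  exponent, and the \<open>kappa\<close>-parts are the contents of a single tableau.\<close>

lemma eigv_maximal_exponent:
  assumes f: "eigv (spec \<alpha> c) f" and \<alpha>: "monomial_exp N \<alpha>"
    and g: "monomial_exp N g" "f g \<noteq> vzero"
    and above: "\<And>\<gamma>. monomial_exp N \<gamma> \<Longrightarrow> dlt N g \<gamma> \<Longrightarrow> f \<gamma> = vzero"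
  shows "g = \<alpha>"
    and "\<exists>S\<in>Y. (\<forall>i\<in>{1..N}. c i = content (rank N g i) S) \<and>
      (\<exists>k. k \<noteq> 0 \<and> f g = (\<lambda>T. k * rho (inv (rank N g)) (bvec S) T))"
proof -
  have fP: "f \<in> PV" using f Pol_PV by (auto simp: eigv_def)
  \<comment> \<open>Conjugation by the rank permutation turns the transpositions towards positions
    of larger rank into the Jucys--Murphy sum over \<open>l > r i\<close>.\<close>
  define r u where "r = rank N g" and "u = rho r (f g)"
  have r: "r permutes {1..N}" unfolding r_def by (rule rank_permutes)
  have fg: "f g \<in> V" using fP by (rule PV_D)
  have u: "u \<in> V" unfolding u_def using r fg by (rule rho_in_V)
  have "u \<noteq> vzero"
    using rho_inj[OF r fg vzero_in_V] g(2) by (auto simp: u_def)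
  then obtain S where S: "u S \<noteq> 0" by (auto simp: vzero_def)
  have key: "\<alpha> i = g i \<and> c i = content (r i) T" if i: "i \<in> {1..N}" and T: "u T \<noteq> 0" for i T
  proof -
    have TY: "T \<in> Y" using u T by (auto simp: V_def)
    have ri: "r i \<in> {1..N}" using i permutes_in_image[OF r] by blast
    define J where "J = {j. j \<in> {1..N} \<and> r i < r j}"
    have "kappa * (\<Sum>j\<in>J. rho (tr i j) (f g) S) = (spec \<alpha> c i - of_nat (g i + 1)) * f g S" for S
    proof -
      have "Uop tau i f g S = spec \<alpha> c i * f g S"
        using f i by (simp add: eigv_def)
      then show ?thesis
        using Uop_leading[OF i fP g(1) above, of S] by (simp add: r_def J_def algebra_simps)
    qed
    then have "rho r (\<lambda>S. kappa * (\<Sum>j\<in>J. rho (tr i j) (f g) S)) T = rho r (\<lambda>S. (spec \<alpha> c i - of_nat (g i + 1)) * f g S) T"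
      by presburger
    then have "kappa * (\<Sum>j\<in>J. rho r (rho (tr i j) (f g)) T) = (spec \<alpha> c i - of_nat (g i + 1)) * u T"
      by (simp only: tau_rep_scale tau_rep_sum u_def)
    also have "(\<Sum>j\<in>J. rho r (rho (tr i j) (f g)) T) = (\<Sum>j\<in>J. rho (tr (r i) (r j)) u T)"
      using rho_tr_conj[OF r i _ fg] by (intro sum.cong) (auto simp: J_def u_def)
    also have "\<dots> = (\<Sum>l\<in>{r i<..N}. rho (tr (r i) l) u T)"
      unfolding J_def r_def using sum_rank_reindex[OF i, of "\<lambda>l. rho (tr (rank N g i) l) u T" g] .
    also have "\<dots> = of_int (content (r i) T) * u T"
      by (rule jucys_murphy[OF ri u TY])
    finally have "(spec \<alpha> c i - spec g (\<lambda>i. content (r i) T) i) * u T = 0"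
      by (simp add: spec_def algebra_simps)
    then have "spec \<alpha> c i - spec g (\<lambda>i. content (r i) T) i = 0"
      using T by simp
    from kappa_transcendental[OF this[unfolded spec_diff]] show ?thesis by simp
  qed
  have SY: "S \<in> Y" using u S by (auto simp: V_def)
  show "g = \<alpha>"
    using key[OF _ S] g(1) \<alpha> unfolding monomial_exp_def fun_eq_iff by metis
  have single: "T = S" if T: "u T \<noteq> 0" for T
  proof (rule tableau_eqI)
    show "T \<in> Y" using u T by (auto simp: V_def)
    fix l assume "l \<in> {1..N}"
    then obtain i where "i \<in> {1..N}" "l = r i" using permutes_image[OF r] by blast
    then show "content l T = content l S" using key[OF _ T] key[OF _ S] by metis
  qed (rule SY)
  then have u_eq: "u = (\<lambda>T. u S * bvec S T)"
  proof (intro ext)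
    fix T show "u T = u S * bvec S T"
      by (cases "T = S") (use single in \<open>auto simp: bvec_def\<close>)
  qed
  have "f g = rho (inv r) u"
    unfolding u_def using rho_comp[OF permutes_inv[OF r] r fg] fg by (simp add: permutes_inv_o[OF r])
  also have "\<dots> = (\<lambda>T. u S * rho (inv r) (bvec S) T)"
    by (subst u_eq) (rule tau_rep_scale)
  finally show "\<exists>S\<in>Y. (\<forall>i\<in>{1..N}. c i = content (rank N g i) S) \<and>
      (\<exists>k. k \<noteq> 0 \<and> f g = (\<lambda>T. k * rho (inv (rank N g)) (bvec S) T))"
    using SY S key[OF _ S] unfolding r_def[symmetric] by blast
qed

text \<open>Above any exponent of the support there is a maximal one, which has to be \<alpha>. So a
  nonzero eigenvector is automatically triangular and has a nonzero coefficient at \<alpha>.\<close>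

lemma eigv_leading:
  assumes f: "eigv (spec \<alpha> c) f" and \<alpha>: "monomial_exp N \<alpha>" and \<beta>: "f \<beta> \<noteq> vzero"
  shows "\<beta> = \<alpha> \<or> dlt N \<beta> \<alpha>"
    and "\<exists>S\<in>Y. (\<forall>i\<in>{1..N}. c i = content (rank N \<alpha> i) S) \<and>
      (\<exists>k. k \<noteq> 0 \<and> f \<alpha> = (\<lambda>T. k * rho (inv (rank N \<alpha>)) (bvec S) T))"
proof -
  have Pol: "f \<in> Pol" using f by (simp add: eigv_def)
  define A where "A = {g. f g \<noteq> vzero \<and> (g = \<beta> \<or> dlt N \<beta> g)}"
  have mono: "monomial_exp N g" if "f g \<noteq> vzero" for g
    using Pol that by (simp add: Pol_def)
  have "finite A"
    by (rule finite_subset[of _ "{g. f g \<noteq> vzero}"]) (use Pol in \<open>auto simp: A_def Pol_def\<close>)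
  moreover have "asymp_on A (dlt N)"
    using dlt_asym mono by (intro asymp_onI) (auto simp: A_def)
  moreover have "transp_on A (dlt N)"
  proof (rule transp_onI)
    fix x y z
    assume "x \<in> A" "y \<in> A" "dlt N x y" "dlt N y z"
    then show "dlt N x z"
      using dlt_trans[of N x y z] mono[of x] mono[of y] by (simp add: A_def)
  qed
  moreover have "A \<noteq> {}" using \<beta> by (auto simp: A_def)
  ultimately obtain g where g: "g \<in> A" and max: "\<And>h. h \<in> A \<Longrightarrow> h \<noteq> g \<Longrightarrow> \<not> dlt N g h"
    using Finite_Set.bex_max_element[of A "dlt N"] by blast
  have gA: "f g \<noteq> vzero" "g = \<beta> \<or> dlt N \<beta> g" using g by (auto simp: A_def)
  have above: "f \<gamma> = vzero" if \<gamma>: "monomial_exp N \<gamma>" "dlt N g \<gamma>" for \<gamma>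
  proof (rule ccontr)
    assume n: "f \<gamma> \<noteq> vzero"
    have "dlt N \<beta> \<gamma>"
      using gA(2) \<gamma> dlt_trans[OF mono[OF \<beta>] mono[OF gA(1)]] by auto
    then have "\<gamma> \<in> A" using n by (simp add: A_def)
    moreover have "\<gamma> \<noteq> g" using \<gamma>(2) not_dlt_refl by metis
    ultimately show False using max \<gamma>(2) by blast
  qed
  have g\<alpha>: "g = \<alpha>"
    using eigv_maximal_exponent(1)[OF f \<alpha> mono[OF gA(1)] gA(1)] above by blast
  show "\<beta> = \<alpha> \<or> dlt N \<beta> \<alpha>"
    using gA(2) g\<alpha> by metis
  show "\<exists>S\<in>Y. (\<forall>i\<in>{1..N}. c i = content (rank N \<alpha> i) S) \<and>
      (\<exists>k. k \<noteq> 0 \<and> f \<alpha> = (\<lambda>T. k * rho (inv (rank N \<alpha>)) (bvec S) T))"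
    using eigv_maximal_exponent(2)[OF f \<alpha> mono[OF gA(1)] gA(1)] above g\<alpha> by blast
qed

lemma rho_bvec_nonzero:
  assumes "w permutes {1..N}" "S \<in> Y"
  shows "rho w (bvec S) \<noteq> vzero"
proof
  assume "rho w (bvec S) = vzero"
  then have "bvec S = vzero"
    using rho_inj[OF assms(1) bvec_in_V[OF assms(2)] vzero_in_V] by simp
  from fun_cong[OF this, of S] show False by (simp add: bvec_def vzero_def)
qed

text \<open>The difference is an eigenvector for the same spectrum with coefficient 0 at \<alpha>,
  which a nonzero eigenvector cannot have.\<close>

lemma eigv_eqI:
  assumes f: "eigv (spec \<alpha> c) f" and g: "eigv (spec \<alpha> c) g" and \<alpha>: "monomial_exp N \<alpha>"
    and eq: "f \<alpha> = g \<alpha>"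
  shows "f = g"
proof (rule ccontr)
  assume "f \<noteq> g"
  then obtain \<beta> S where neq: "f \<beta> S \<noteq> g \<beta> S" by blast
  define h where "h = (\<lambda>\<beta> S. 1 * f \<beta> S + (-1) * g \<beta> S)"
  have h: "eigv (spec \<alpha> c) h" unfolding h_def by (rule eigv_lin[OF f g])
  have "h \<beta> \<noteq> vzero"
    using neq by (auto simp: h_def vzero_def dest: fun_cong)
  from eigv_leading(2)[OF h \<alpha> this] obtain S k where S: "S \<in> Y" "k \<noteq> 0"
    "h \<alpha> = (\<lambda>T. k * rho (inv (rank N \<alpha>)) (bvec S) T)" by blast
  moreover have "h \<alpha> = vzero" using eq by (simp add: h_def vzero_def)
  ultimately have "rho (inv (rank N \<alpha>)) (bvec S) = vzero"
    by (auto simp: vzero_def fun_eq_iff)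
  then show False
    using rho_bvec_nonzero[OF permutes_inv[OF rank_permutes] S(1)] by blast
qed

section \<open>Characterising \<open>zeta\<close>, and the steps between eigenvectors\<close>

abbreviation tspec :: "(nat \<Rightarrow> nat) \<Rightarrow> tableau \<Rightarrow> nat \<Rightarrow> K" where
  "tspec \<alpha> T \<equiv> spec \<alpha> (\<lambda>i. content (rank N \<alpha> i) T)"

lemma finite_lower_exponents: "finite {\<beta>. monomial_exp N \<beta> \<and> dlt N \<beta> \<alpha>}"
proof -
  define d where "d = (\<Sum>j\<in>{1..N}. \<alpha> j)"
  have "finite {\<beta>. \<forall>i. (i \<in> {1..N} \<longrightarrow> \<beta> i \<in> {..d}) \<and> (i \<notin> {1..N} \<longrightarrow> \<beta> i = 0)}"
    by (rule finite_set_of_finite_funs) auto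
  then show ?thesis
  proof (rule rev_finite_subset)
    have "\<beta> i \<le> d" if "dlt N \<beta> \<alpha>" "i \<in> {1..N}" for \<beta> i
      using that member_le_sum[of i "{1..N}" \<beta>] by (simp add: dlt_def d_def)
    then show "{\<beta>. monomial_exp N \<beta> \<and> dlt N \<beta> \<alpha>} \<subseteq>
        {\<beta>. \<forall>i. (i \<in> {1..N} \<longrightarrow> \<beta> i \<in> {..d}) \<and> (i \<notin> {1..N} \<longrightarrow> \<beta> i = 0)}"
      by (auto simp: monomial_exp_def)
  qed
qed

text \<open>Triangularity need not be checked by hand, since the spectrum implies it. Conversely a
  competitor for the definite description has finite support, as only finitely many exponents lie
  below \<alpha>, so uniqueness of eigenvectors applies to it.\<close>

lemma zeta_eqI:
  assumes \<alpha>: "monomial_exp N \<alpha>" and T: "T \<in> Y" and f: "eigv (tspec \<alpha> T) f"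
    and lead: "f \<alpha> = rho (inv (rank N \<alpha>)) (bvec T)"
  shows "zeta tau \<alpha> T = f"
  unfolding zeta_def
proof (rule the_equality)
  show "zeta_cond tau \<alpha> T f"
    unfolding zeta_cond_def size
  proof (intro conjI allI impI ballI)
    show "f \<alpha> = rho (inv (rank N \<alpha>)) (bvec T)" by (rule lead)
    show "f \<beta> = vzero" if "\<beta> \<noteq> \<alpha> \<and> \<not> (monomial_exp N \<beta> \<and> dlt N \<beta> \<alpha>)" for \<beta>
      using eigv_leading(1)[OF f \<alpha>, of \<beta>] f that by (auto simp: eigv_def Pol_def)
    show "S \<in> Y" if "f \<beta> S \<noteq> 0" for \<beta> S
      using f that by (auto simp: eigv_def Pol_def PV_def V_def)
    show "Uop tau i f = (\<lambda>\<beta> S. (of_nat (\<alpha> i + 1) + kappa * of_int (content (rank N \<alpha> i) T)) * f \<beta> S)"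
      if "i \<in> {1..N}" for i
      using f that unfolding eigv_def spec_def by blast
  qed
next
  fix g assume g: "zeta_cond tau \<alpha> T g"
  note g' = g[unfolded zeta_cond_def size]
  have supp: "\<beta> = \<alpha> \<or> monomial_exp N \<beta> \<and> dlt N \<beta> \<alpha>" if "g \<beta> \<noteq> vzero" for \<beta>
    using g' that by blast
  have "{\<beta>. g \<beta> \<noteq> vzero} \<subseteq> insert \<alpha> {\<beta>. monomial_exp N \<beta> \<and> dlt N \<beta> \<alpha>}"
    using supp by blast
  then have "finite {\<beta>. g \<beta> \<noteq> vzero}"
    using finite_lower_exponents by (rule finite_subset[OF _ finite.insertI])
  moreover have "monomial_exp N \<beta>" if "g \<beta> \<noteq> vzero" for \<beta>
    using supp[OF that] \<alpha> by blast
  moreover have "g \<in> PV"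
    using g' unfolding PV_def V_def by blast
  ultimately have "g \<in> Pol"
    by (simp add: Pol_def)
  then have "eigv (tspec \<alpha> T) g"
    using g' unfolding eigv_def spec_def by blast
  then show "g = f"
    by (rule eigv_eqI[OF _ f \<alpha>]) (use g' lead in simp)
qed

text \<open>The intertwiner of the graded Hecke algebra. The scalar is chosen so that the terms
  \<open>kappa * f\<close> from the commutation relations turn into the missing multiples of
  \<open>f\<close>.\<close>

lemma eigv_swap:
  assumes f: "eigv lam f" and i: "1 \<le> i" "i < N" and ne: "lam i \<noteq> lam (Suc i)"
  shows "eigv (lam \<circ> tr i (Suc i))
    (\<lambda>\<beta> S. act tau (tr i (Suc i)) f \<beta> S - kappa / (lam i - lam (Suc i)) * f \<beta> S)"
proof -
  let ?s = "tr i (Suc i)"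
  define b where "b = kappa / (lam i - lam (Suc i))"
  have b: "b * lam i - b * lam (Suc i) = kappa"
    unfolding right_diff_distrib[symmetric] b_def using ne by simp
  have s: "?s permutes {1..N}" using i by (intro tr_permutes) auto
  have fPol: "f \<in> Pol" and U: "\<And>k. k \<in> {1..N} \<Longrightarrow> Uop tau k f = (\<lambda>\<beta> S. lam k * f \<beta> S)"
    using f by (auto simp: eigv_def)
  have g: "(\<lambda>\<beta> S. act tau ?s f \<beta> S - b * f \<beta> S) = (\<lambda>\<beta> S. 1 * act tau ?s f \<beta> S + (- b) * f \<beta> S)"
    by simp
  note comm = act_adj_Uop[OF i Pol_PV[OF fPol]]
  have "Uop tau k (\<lambda>\<beta> S. act tau ?s f \<beta> S - b * f \<beta> S) =
      (\<lambda>\<beta> S. lam (?s k) * (act tau ?s f \<beta> S - b * f \<beta> S))" if k: "k \<in> {1..N}" for k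
    unfolding g Uop_lin
  proof (intro ext)
    fix \<beta> S
    have kf: "kappa * f \<beta> S = b * lam i * f \<beta> S - b * lam (Suc i) * f \<beta> S"
      by (simp add: b[symmetric] algebra_simps)
    consider "k = i" | "k = Suc i" | "k \<noteq> i" "k \<noteq> Suc i" by blast
    then show "1 * Uop tau k (act tau ?s f) \<beta> S + - b * Uop tau k f \<beta> S =
        lam (?s k) * (act tau ?s f \<beta> S - b * f \<beta> S)"
    proof cases
      case 1
      have "Uop tau i (act tau ?s f) \<beta> S = lam (Suc i) * act tau ?s f \<beta> S + kappa * f \<beta> S"
        using comm(2)[of \<beta> S] U[of "Suc i"] i by (simp add: act_scale)
      then show ?thesis
        using 1 U[OF k] kf by (simp add: algebra_simps)
    next
      case 2
      have "Uop tau (Suc i) (act tau ?s f) \<beta> S = lam i * act tau ?s f \<beta> S - kappa * f \<beta> S"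
        using comm(1)[of \<beta> S] U[of i] i by (simp add: act_scale)
      then show ?thesis
        using 2 U[OF k] kf by (simp add: algebra_simps)
    next
      case 3
      have "Uop tau k (act tau ?s f) \<beta> S = lam k * act tau ?s f \<beta> S"
        using comm(3)[OF k 3, of \<beta> S] U[OF k] by (simp add: act_scale)
      then show ?thesis
        using 3 U[OF k] by (simp add: algebra_simps)
    qed
  qed
  moreover have "(\<lambda>\<beta> S. act tau ?s f \<beta> S - b * f \<beta> S) \<in> Pol"
    unfolding g by (rule Pol_lin[OF act_in_Pol[OF s fPol] fPol])
  ultimately show ?thesis
    by (simp add: eigv_def b_def)
qed

text \<open>If the result were 0, the involution \<open>tr i (Suc i)\<close> would act on a nonzero
  \<open>f\<close> by the scalar \<open>b\<close>, forcing \<open>b\<^sup>2 = 1\<close>.\<close>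

lemma eigv_swap_nonzero:
  assumes f: "f \<in> PV" "f \<beta> \<noteq> vzero" and i: "1 \<le> i" "i < N" and b: "b^2 \<noteq> 1"
  shows "\<exists>\<gamma>. (\<lambda>S. act tau (tr i (Suc i)) f \<gamma> S - b * f \<gamma> S) \<noteq> vzero"
proof (rule ccontr)
  let ?s = "tr i (Suc i)"
  have s: "?s permutes {1..N}" using i by (intro tr_permutes) auto
  assume "\<not> ?thesis"
  then have eq: "act tau ?s f = (\<lambda>\<beta> S. b * f \<beta> S)"
    by (auto simp: vzero_def fun_eq_iff)
  have "f = act tau ?s (act tau ?s f)"
    using act_comp[OF s s f(1)] f(1) by simp
  also have "\<dots> = (\<lambda>\<beta> S. b * (b * f \<beta> S))"
    unfolding eq act_scale by simp
  finally have "f \<beta> S = b * (b * f \<beta> S)" for S by metis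
  then have "(1 - b^2) * f \<beta> S = 0" for S
    by (simp add: algebra_simps power2_eq_square)
  then show False using b f(2) by (auto simp: vzero_def fun_eq_iff)
qed

end

lemma theta_apply:
  assumes "1 \<le> m"
  shows "theta m i = (if i = m then 1 else if 1 \<le> i \<and> i < m then Suc i else i)"
  using assms
proof (induction m arbitrary: i rule: dec_induct)
  case base
  then show ?case by (simp add: theta_def)
next
  case (step m)
  have "theta (Suc m) = theta m \<circ> tr m (Suc m)"
    using step.hyps by (simp add: theta_def)
  then show ?case
    using step by (auto simp: tr_def)
qed

lemma theta_permutes: "m \<le> n \<Longrightarrow> theta m permutes {1..n}"
  unfolding theta_def by (rule wprod_permutes) auto

lemma inv_theta_apply:
  assumes "1 \<le> m"
  shows "inv (theta m) 1 = m" and "1 \<le> i \<Longrightarrow> i < m \<Longrightarrow> inv (theta m) (Suc i) = i"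
  using permutes_inverses(2)[OF theta_permutes[of m m]] theta_apply[OF assms, of m] theta_apply[OF assms, of i]
  by (metis order_refl less_irrefl)+

text \<open>The exponent of position 1 moves from the position that wins all ties to the one that
  loses them; raising it by one compensates exactly for this.\<close>

lemma rank_raise:
  assumes N: "1 \<le> N" and \<alpha>': "\<alpha>' = (\<alpha> \<circ> theta N)(N := Suc (\<alpha> 1))"
  shows "rank N \<alpha>' = rank N \<alpha> \<circ> theta N"
proof (rule rank_transfer)
  show "theta N permutes {1..N}" by (rule theta_permutes) simp
  fix j k assume "j \<in> {1..N}" "k \<in> {1..N}"
  then show "(\<alpha>' j < \<alpha>' k \<or> \<alpha>' k = \<alpha>' j \<and> k \<le> j) \<longleftrightarrow>
      (\<alpha> (theta N j) < \<alpha> (theta N k) \<or> \<alpha> (theta N k) = \<alpha> (theta N j) \<and> theta N k \<le> theta N j)"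
    unfolding \<alpha>' by (cases "j = N"; cases "k = N") (auto simp: theta_apply[OF N])
qed

lemma monomial_exp_raise:
  assumes "1 \<le> N" "monomial_exp N \<alpha>"
  shows "monomial_exp N ((\<alpha> \<circ> theta N)(N := c))"
  using monomial_exp_upd[OF _ monomial_exp_permute[OF theta_permutes[OF order_refl] assms(2)], of N c] assms(1)
  by simp

context young_shape
begin

text \<open>For \<open>i = N\<close> the value \<open>D\<^sub>N x\<^sub>N g\<close> is the
  transported \<open>D\<^sub>1 x\<^sub>1 f\<close>, that is \<open>lam 1 * g\<close>, and
  \<open>x\<^sub>N D\<^sub>N + 1\<close> adds one. For \<open>i < N\<close>, moving
  \<open>x\<^sub>N\<close> past \<open>D\<^sub>i\<close> produces \<open>- kappa (i,N)\<close>,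
  which is just the transported \<open>j = 1\<close> term of \<open>Uop tau (Suc i)\<close>.\<close>

lemma eigv_raise:
  assumes N: "1 \<le> N" and f: "eigv lam f"
  shows "eigv (\<lambda>i. if i = N then lam 1 + 1 else lam (Suc i)) (mulx N (act tau (inv (theta N)) f))"
proof -
  define w where "w = inv (theta N)"
  define g where "g = act tau w f"
  have w: "w permutes {1..N}"
    unfolding w_def by (intro permutes_inv theta_permutes order_refl)
  have wS: "w (Suc i) = i" if "1 \<le> i" "i < N" for i
    using inv_theta_apply(2)[OF N that] by (simp add: w_def)
  have w1: "w 1 = N" using inv_theta_apply(1)[OF N] by (simp add: w_def)
  have fPol: "f \<in> Pol" and U: "\<And>k. k \<in> {1..N} \<Longrightarrow> Uop tau k f = (\<lambda>\<beta> S. lam k * f \<beta> S)"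
    using f by (auto simp: eigv_def)
  note fP = Pol_PV[OF fPol]
  have gU: "Dunkl tau (w k) (mulx (w k) g) \<beta> S - kappa * (\<Sum>j\<in>{1..<k}. act tau (tr (w k) (w j)) g \<beta> S) =
      lam k * g \<beta> S" if "k \<in> {1..N}" for k \<beta> S
    using act_Uop[OF w that fP, of \<beta> S] U[OF that] by (simp add: act_scale g_def)
  have "Uop tau N (mulx N g) = (\<lambda>\<beta> S. (lam 1 + 1) * mulx N g \<beta> S)"
  proof (intro ext)
    fix \<beta> S
    have "Dunkl tau N (mulx N g) = (\<lambda>\<beta> S. lam 1 * g \<beta> S)"
      using gU[of 1] N w1 by (simp add: fun_eq_iff)
    then show "Uop tau N (mulx N g) \<beta> S = (lam 1 + 1) * mulx N g \<beta> S"
      using Uop_eq[of N "mulx N g" \<beta> S] N by (simp add: mulx_scale distrib_right)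
  qed
  moreover have "Uop tau i (mulx N g) = (\<lambda>\<beta> S. lam (Suc i) * mulx N g \<beta> S)" if i: "1 \<le> i" "i < N" for i
  proof (intro ext)
    fix \<beta> S
    have iN: "i \<in> {1..N}" "N \<in> {1..N}" "i \<noteq> N" using i by auto
    have perm: "tr i N permutes {1..N}" "j \<in> {1..<i} \<Longrightarrow> tr i j permutes {1..N}" for j
      by (rule tr_permutes; use i in auto)+
    have low: "(\<Sum>j\<in>{1..<i}. act tau (tr i j) (mulx N g) \<beta> S) =
        (\<Sum>j\<in>{1..<i}. mulx N (act tau (tr i j) g) \<beta> S)"
      using i by (intro sum.cong refl) (auto simp: act_mulx[OF perm(2)])
    have sum: "(\<Sum>j\<in>{1..<Suc i}. act tau (tr i (w j)) g \<beta> S) =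
        act tau (tr i N) g \<beta> S + (\<Sum>j\<in>{1..<i}. act tau (tr i j) g \<beta> S)" for \<beta> S
    proof -
      have "(\<Sum>j\<in>{1..<Suc i}. act tau (tr i (w j)) g \<beta> S) =
          act tau (tr i (w 1)) g \<beta> S + (\<Sum>j\<in>{Suc 1..<Suc i}. act tau (tr i (w j)) g \<beta> S)"
        using i by (intro sum.atLeast_Suc_lessThan) auto
      also have "(\<Sum>j\<in>{Suc 1..<Suc i}. act tau (tr i (w j)) g \<beta> S) = (\<Sum>j\<in>{1..<i}. act tau (tr i j) g \<beta> S)"
        unfolding sum.shift_bounds_Suc_ivl by (intro sum.cong refl) (use wS i in auto)
      finally show ?thesis by (simp only: w1)
    qed
    define h where "h = (\<lambda>\<beta> S. Dunkl tau i (mulx i g) \<beta> S - kappa * act tau (tr i N) g \<beta> S -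
       kappa * (\<Sum>j\<in>{1..<i}. act tau (tr i j) g \<beta> S))"
    have h: "h = (\<lambda>\<beta> S. lam (Suc i) * g \<beta> S)"
      using gU[of "Suc i"] sum i wS[OF i] by (simp add: h_def fun_eq_iff algebra_simps del: sum.op_ivl_Suc)
    have "Uop tau i (mulx N g) \<beta> S = Dunkl tau i (mulx N (mulx i g)) \<beta> S -
        kappa * (\<Sum>j\<in>{1..<i}. mulx N (act tau (tr i j) g) \<beta> S)"
      unfolding Uop_def low mulx_commute[of i N] ..
    also have "Dunkl tau i (mulx N (mulx i g)) \<beta> S =
        mulx N (Dunkl tau i (mulx i g)) \<beta> S - kappa * mulx N (act tau (tr i N) g) \<beta> S"
      using Dunkl_mulx_other[OF iN, of "mulx i g" \<beta> S] act_mulx[OF perm(1), of i g] by simp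
    also have "\<dots> - kappa * (\<Sum>j\<in>{1..<i}. mulx N (act tau (tr i j) g) \<beta> S) = mulx N h \<beta> S"
      by (auto simp: mulx_def h_def vzero_def)
    finally show "Uop tau i (mulx N g) \<beta> S = lam (Suc i) * mulx N g \<beta> S"
      unfolding h mulx_scale .
  qed
  moreover have "mulx N g \<in> Pol"
    unfolding g_def using N by (intro mulx_in_Pol act_in_Pol[OF w fPol]) auto
  ultimately show ?thesis
    unfolding w_def[symmetric] g_def[symmetric] eigv_def by auto
qed

lemma eigv_cong:
  assumes "\<And>i. i \<in> {1..N} \<Longrightarrow> lam i = lam' i"
  shows "eigv lam f \<longleftrightarrow> eigv lam' f"
  using assms by (simp add: eigv_def)

lemma eigv_raise_tspec:
  assumes N: "1 \<le> N" and f: "eigv (tspec \<alpha> T) f" and \<alpha>': "\<alpha>' = (\<alpha> \<circ> theta N)(N := Suc (\<alpha> 1))"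
  shows "eigv (tspec \<alpha>' T) (mulx N (act tau (inv (theta N)) f))"
proof -
  have "eigv (\<lambda>i. if i = N then tspec \<alpha> T 1 + 1 else tspec \<alpha> T (Suc i)) (mulx N (act tau (inv (theta N)) f))"
    by (rule eigv_raise[OF N f])
  moreover have "\<alpha>' N = Suc (\<alpha> 1)" "i \<in> {1..N} \<Longrightarrow> i \<noteq> N \<Longrightarrow> \<alpha>' i = \<alpha> (Suc i)" for i
    by (auto simp: \<alpha>' theta_apply[OF N])
  ultimately show ?thesis
    by (elim eigv_cong[THEN iffD1, rotated])
       (auto simp: spec_def rank_raise[OF N \<alpha>'] theta_apply[OF N])
qed

lemma eigv_swap_tspec:
  assumes f: "eigv (tspec \<alpha> T) f" and i: "1 \<le> i" "i < N" and ne: "\<alpha> i \<noteq> \<alpha> (Suc i)"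
  shows "eigv (tspec (\<alpha> \<circ> tr i (Suc i)) T)
    (\<lambda>\<beta> S. act tau (tr i (Suc i)) f \<beta> S - kappa / (tspec \<alpha> T i - tspec \<alpha> T (Suc i)) * f \<beta> S)"
    and "(kappa / (tspec \<alpha> T i - tspec \<alpha> T (Suc i)))^2 \<noteq> 1"
proof -
  let ?d = "tspec \<alpha> T i - tspec \<alpha> T (Suc i)"
  \<comment> \<open>The integer part of this element is the difference of the exponents. The case
    \<open>k = 0\<close> separates the eigenvalues; \<open>k = 1\<close> and \<open>k = -1\<close>
    exclude that the scalar is -1 or 1.\<close>
  have d: "?d + kappa * of_int k \<noteq> 0" for k
  proof
    assume "?d + kappa * of_int k = 0"
    then have "of_int (int (\<alpha> i) - int (\<alpha> (Suc i))) +
        kappa * of_int (content (rank N \<alpha> i) T - content (rank N \<alpha> (Suc i)) T + k) = 0"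
      unfolding spec_diff by (simp add: algebra_simps)
    from kappa_transcendental(1)[OF this] show False using ne by simp
  qed
  have "eigv (tspec \<alpha> T \<circ> tr i (Suc i))
    (\<lambda>\<beta> S. act tau (tr i (Suc i)) f \<beta> S - kappa / ?d * f \<beta> S)"
    by (rule eigv_swap[OF f i]) (use d[of 0] in auto)
  moreover have "tspec (\<alpha> \<circ> tr i (Suc i)) T = tspec \<alpha> T \<circ> tr i (Suc i)"
    by (auto simp: spec_def rank_swap[OF i ne])
  ultimately show "eigv (tspec (\<alpha> \<circ> tr i (Suc i)) T)
    (\<lambda>\<beta> S. act tau (tr i (Suc i)) f \<beta> S - kappa / ?d * f \<beta> S)" by simp
  show "(kappa / ?d)^2 \<noteq> 1"
  proof
    assume "(kappa / ?d)^2 = 1"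
    then have "kappa / ?d = 1 \<or> kappa / ?d = -1"
      by (simp add: power2_eq_1_iff)
    then have "?d = kappa \<or> ?d = - kappa"
      using d[of 0] by (auto simp: field_simps)
    then show False using d[of 1] d[of "-1"] by auto
  qed
qed

text \<open>On degree 0 the Dunkl operators vanish, so \<open>Uop tau i\<close> is
  \<open>1 + kappa\<close> times a Jucys--Murphy element, which is diagonal on tableaux.\<close>

lemma eigv_constant:
  assumes T: "T \<in> Y"
  shows "eigv (tspec (\<lambda>_. 0) T) (\<lambda>\<beta>. if \<beta> = (\<lambda>_. 0) then bvec T else vzero)"
proof -
  define f :: pvec where "f = (\<lambda>\<beta>. if \<beta> = (\<lambda>_. 0) then bvec T else vzero)"
  have f0: "f \<beta> S = 0" if "\<beta> \<noteq> (\<lambda>_. 0)" for \<beta> S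
    using that by (simp add: f_def vzero_def)
  have r: "rank N (\<lambda>_. 0) i = i" if "i \<in> {1..N}" for i
    by (rule rank_fixed[OF that]) auto
  have "f \<in> PV" using bvec_in_V[OF T] by (auto simp: PV_def f_def)
  then have "f \<in> Pol"
    by (auto simp: Pol_def f_def monomial_exp_def intro: finite_subset[of _ "{\<lambda>_. 0}"])
  moreover have "Uop tau i f \<beta> S = tspec (\<lambda>_. 0) T i * f \<beta> S" if i: "i \<in> {1..N}" for i \<beta> S
  proof -
    have "f (\<gamma>(i := \<gamma> i + 1)) S = 0" for \<gamma> S
      by (rule f0) (metis Suc_eq_plus1 Zero_not_Suc fun_upd_same)
    then have dx: "dx i f \<gamma> S = 0" for \<gamma> S
      by (simp add: dx_def)
    have dd: "ddiff i j f \<gamma> = vzero" if "j \<in> {1..N} - {i}" for j \<gamma>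
      unfolding vzero_def
    proof (rule ext)
      fix S
      have "f (\<gamma>(i := a, j := \<gamma> i + \<gamma> j + 1 - a)) S = 0" for a
      proof (rule f0)
        show "\<gamma>(i := a, j := \<gamma> i + \<gamma> j + 1 - a) \<noteq> (\<lambda>_. 0)"
        proof
          assume eq: "\<gamma>(i := a, j := \<gamma> i + \<gamma> j + 1 - a) = (\<lambda>_. 0)"
          show False using fun_cong[OF eq, of i] fun_cong[OF eq, of j] that by auto
        qed
      qed
      then show "ddiff i j f \<gamma> S = 0" by (simp only: ddiff_def mult_zero_right sum.neutral_const)
    qed
    have "Dunkl tau i f \<gamma> S = 0" for \<gamma> S
      using dx dd by (simp add: Dunkl_def size fun_cong[OF vzero_def])
    then have D: "mulx i (Dunkl tau i f) \<beta> S = 0"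
      by (simp add: mulx_def vzero_def)
    have act: "act tau (tr i j) f \<beta> S = rho (tr i j) (f \<beta>) S" for j
    proof -
      have "\<beta> \<circ> tr i j = (\<lambda>_. 0) \<longleftrightarrow> \<beta> = (\<lambda>_. 0)"
        by (metis comp_apply ext tr_tr)
      then show ?thesis by (simp add: act_def f_def)
    qed
    have "(\<Sum>j\<in>{i<..N}. rho (tr i j) (f \<beta>) S) = of_int (content i T) * f \<beta> S"
    proof (cases "\<beta> = (\<lambda>_. 0) \<and> S \<in> Y")
      case True
      then show ?thesis
        using jucys_murphy[OF i bvec_in_V[OF T], of S] by (simp add: f_def bvec_def)
    next
      case False
      have "rho (tr i j) (f \<beta>) S = 0" if "j \<in> {i<..N}" for j
      proof (cases "\<beta> = (\<lambda>_. 0)")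
        case True
        have "tr i j permutes {1..N}" using that i by (intro tr_permutes) auto
        then show ?thesis
          using True False V_outside[OF rho_in_V[OF _ bvec_in_V[OF T]]] by (auto simp: f_def)
      next
        case nz: False
        then show ?thesis by (simp add: f_def fun_cong[OF vzero_def])
      qed
      moreover have "f \<beta> S = 0"
        using False T by (auto simp: f_def bvec_def vzero_def)
      ultimately show ?thesis by simp
    qed
    then show ?thesis
      unfolding Uop_eq[OF i] D act by (simp add: spec_def r[OF i] algebra_simps)
  qed
  ultimately show ?thesis
    unfolding eigv_def f_def[symmetric] by blast
qed

text \<open>Outer induction on the degree, inner induction on the distance of a positive exponent
  from position \<open>N\<close>. At \<open>N\<close> a raising step lowers the degree; elsewhere an
  exchange brings the positive exponent closer to \<open>N\<close>, and between equal exponents the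
  neighbour serves instead.\<close>

lemma eigv_exists:
  assumes "monomial_exp N \<alpha>" and T: "T \<in> Y"
  shows "\<exists>f. eigv (tspec \<alpha> T) f \<and> (\<exists>\<beta>. f \<beta> \<noteq> vzero)"
  using assms(1)
proof (induction "\<Sum>j\<in>{1..N}. \<alpha> j" arbitrary: \<alpha>)
  case 0
  then have "\<alpha> = (\<lambda>_. 0)"
    by (auto simp: monomial_exp_def fun_eq_iff)
  moreover have "(\<lambda>\<beta>. if \<beta> = (\<lambda>_. 0 :: nat) then bvec T else vzero) (\<lambda>_. 0) \<noteq> vzero"
    by (auto simp: bvec_def vzero_def fun_eq_iff)
  ultimately show ?case using eigv_constant[OF T] by blast
next
  case (Suc d)
  have *: "\<exists>f. eigv (tspec \<alpha> T) f \<and> (\<exists>\<beta>. f \<beta> \<noteq> vzero)"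
    if "k \<in> {1..N}" "0 < \<alpha> k" "monomial_exp N \<alpha>" "(\<Sum>j\<in>{1..N}. \<alpha> j) = Suc d" for k \<alpha>
    using that
  proof (induction "N - k" arbitrary: k \<alpha>)
    case 0
    then have N: "1 \<le> N" and pos: "0 < \<alpha> N" by auto
    let ?t = "theta N"
    have t: "?t permutes {1..N}" by (rule theta_permutes) simp
    \<comment> \<open>The exponent from which raising produces \<alpha>: the last entry lowered by
      one and rotated to the front.\<close>
    define \<gamma> where "\<gamma> = \<alpha>(N := \<alpha> N - 1) \<circ> inv ?t"
    have \<gamma>t: "\<gamma> \<circ> ?t = \<alpha>(N := \<alpha> N - 1)"
      unfolding \<gamma>_def comp_assoc permutes_inv_o(2)[OF t] by simp
    have \<gamma>1: "\<gamma> 1 = \<alpha> N - 1"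
      using inv_theta_apply(1)[OF N] by (simp add: \<gamma>_def)
    have \<alpha>\<gamma>: "\<alpha> = (\<gamma> \<circ> ?t)(N := Suc (\<gamma> 1))"
      unfolding \<gamma>t \<gamma>1 using pos by simp
    have mon: "monomial_exp N \<gamma>"
      unfolding \<gamma>_def using N 0 by (intro monomial_exp_permute permutes_inv t monomial_exp_upd) auto
    have "(\<Sum>j\<in>{1..N}. \<gamma> j) = (\<Sum>j\<in>{1..N}. (\<gamma> \<circ> ?t) j)"
      using sum.permute[OF t, of \<gamma>] .
    also have "\<dots> = (\<alpha> N - 1) + (\<Sum>j\<in>{1..N} - {N}. \<alpha> j)"
      unfolding \<gamma>t using N by (subst sum.remove[of _ N]) auto
    also have "\<dots> = d"
      using 0 N pos sum.remove[of "{1..N}" N \<alpha>] by auto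
    finally have "d = (\<Sum>j\<in>{1..N}. \<gamma> j)" by simp
    from Suc.hyps(1)[OF this mon] obtain f \<beta> where f: "eigv (tspec \<gamma> T) f" "f \<beta> \<noteq> vzero" by blast
    have it: "inv ?t permutes {1..N}" by (rule permutes_inv[OF t])
    have fP: "f \<in> PV" using f(1) Pol_PV by (auto simp: eigv_def)
    have "mulx N (act tau (inv ?t) f) ((\<beta> \<circ> ?t)(N := (\<beta> \<circ> ?t) N + 1)) = rho (inv ?t) (f \<beta>)"
      by (simp add: mulx_def act_def comp_assoc permutes_inv_o(1)[OF t] del: comp_apply)
    moreover have "rho (inv ?t) (f \<beta>) \<noteq> vzero"
      using rho_inj[OF it PV_D[OF fP] vzero_in_V] f(2) by auto
    ultimately show ?case
      using eigv_raise_tspec[OF N f(1) \<alpha>\<gamma>] by metis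
  next
    case (Suc l)
    then have k: "1 \<le> k" "k < N" by auto
    let ?s = "tr k (Suc k)"
    have s: "?s permutes {1..N}" using k by (intro tr_permutes) auto
    show ?case
    proof (cases "\<alpha> k = \<alpha> (Suc k)")
      case True
      show ?thesis
        by (rule Suc.hyps(1)[of "Suc k"]) (use Suc True in auto)
    next
      case False
      let ?\<alpha> = "\<alpha> \<circ> ?s"
      have mon: "monomial_exp N ?\<alpha>" by (rule monomial_exp_permute[OF s Suc.prems(3)])
      have sum: "(\<Sum>j\<in>{1..N}. ?\<alpha> j) = Suc d"
        using sum.permute[OF s, of \<alpha>] Suc.prems(4) by simp
      have l: "l = N - Suc k" using Suc.hyps(2) by simp
      have "\<exists>f. eigv (tspec ?\<alpha> T) f \<and> (\<exists>\<beta>. f \<beta> \<noteq> vzero)"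
        by (rule Suc.hyps(1)[OF l _ _ mon sum]) (use k Suc.prems(2) in auto)
      then obtain f \<beta> where f: "eigv (tspec ?\<alpha> T) f" "f \<beta> \<noteq> vzero" by blast
      have fP: "f \<in> PV" using f(1) Pol_PV by (auto simp: eigv_def)
      have ne: "?\<alpha> k \<noteq> ?\<alpha> (Suc k)" using False by simp
      define b where "b = kappa / (tspec ?\<alpha> T k - tspec ?\<alpha> T (Suc k))"
      define g where "g = (\<lambda>\<beta> S. act tau ?s f \<beta> S - b * f \<beta> S)"
      have "eigv (tspec (?\<alpha> \<circ> ?s) T) g"
        unfolding g_def b_def by (rule eigv_swap_tspec(1)[OF f(1) k ne])
      then have "eigv (tspec \<alpha> T) g" by (simp only: tr_comp_tr_assoc)
      moreover have "b^2 \<noteq> 1"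
        unfolding b_def by (rule eigv_swap_tspec(2)[OF f(1) k ne])
      then have "\<exists>\<gamma>. g \<gamma> \<noteq> vzero"
        using eigv_swap_nonzero[OF fP f(2) k, of b] unfolding g_def by blast
      ultimately show ?thesis by blast
    qed
  qed
  obtain k where "k \<in> {1..N}" "0 < \<alpha> k"
    using Suc.hyps(2) by (metis gr0I sum.neutral nat.distinct(1))
  then show ?case using *[of k \<alpha>] Suc by simp
qed

text \<open>The eigenvector supplied by \<open>eigv_exists\<close> has at \<alpha> a nonzero
  multiple of the vector of some tableau \<open>S\<close>. Equal contents force
  \<open>S = T\<close>, and dividing by the scalar normalises it.\<close>

lemma zeta_eigv:
  assumes \<alpha>: "monomial_exp N \<alpha>" and T: "T \<in> Y"
  shows "eigv (tspec \<alpha> T) (zeta tau \<alpha> T)"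
    and "zeta tau \<alpha> T \<alpha> = rho (inv (rank N \<alpha>)) (bvec T)"
proof -
  obtain f \<beta> where f: "eigv (tspec \<alpha> T) f" "f \<beta> \<noteq> vzero"
    using eigv_exists[OF \<alpha> T] by blast
  from eigv_leading(2)[OF f(1) \<alpha> f(2)] obtain S k where S: "S \<in> Y"
    "\<forall>i\<in>{1..N}. content (rank N \<alpha> i) T = content (rank N \<alpha> i) S"
    and k: "k \<noteq> 0" "f \<alpha> = (\<lambda>U. k * rho (inv (rank N \<alpha>)) (bvec S) U)"
    by blast
  have "T = S"
  proof (rule tableau_eqI[OF T S(1)])
    fix l assume "l \<in> {1..N}"
    then obtain i where "i \<in> {1..N}" "l = rank N \<alpha> i"
      using permutes_image[OF rank_permutes[of N \<alpha>]] by blast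
    then show "content l T = content l S" using S(2) by simp
  qed
  define g where "g = (\<lambda>\<beta> S. 1 / k * f \<beta> S + 0 * f \<beta> S)"
  have g: "eigv (tspec \<alpha> T) g" unfolding g_def by (rule eigv_lin[OF f(1) f(1)])
  have lead: "g \<alpha> = rho (inv (rank N \<alpha>)) (bvec T)"
    using k \<open>T = S\<close> by (simp add: g_def)
  have "zeta tau \<alpha> T = g" by (rule zeta_eqI[OF \<alpha> T g lead])
  then show "eigv (tspec \<alpha> T) (zeta tau \<alpha> T)"
    and "zeta tau \<alpha> T \<alpha> = rho (inv (rank N \<alpha>)) (bvec T)"
    using g lead by simp_all
qed

text \<open>Raising moves the leading coefficient without a scalar, since
  \<open>inv (theta N) \<circ> inv (rank N \<alpha>)\<close> is the inverse rank of the raised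
  exponent.\<close>

lemma zeta_raise:
  assumes N: "1 \<le> N" and \<alpha>: "monomial_exp N \<alpha>" and T: "T \<in> Y"
    and \<alpha>': "\<alpha>' = (\<alpha> \<circ> theta N)(N := Suc (\<alpha> 1))"
  shows "zeta tau \<alpha>' T = mulx N (act tau (inv (theta N)) (zeta tau \<alpha> T))"
proof (rule zeta_eqI[OF _ T])
  have t: "theta N permutes {1..N}" by (rule theta_permutes) simp
  show "monomial_exp N \<alpha>'" unfolding \<alpha>' by (rule monomial_exp_raise[OF N \<alpha>])
  show "eigv (tspec \<alpha>' T) (mulx N (act tau (inv (theta N)) (zeta tau \<alpha> T)))"
    by (rule eigv_raise_tspec[OF N zeta_eigv(1)[OF \<alpha> T] \<alpha>'])
  have "\<alpha>'(N := \<alpha>' N - 1) = \<alpha> \<circ> theta N"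
    by (auto simp: \<alpha>' theta_apply[OF N])
  then have "\<alpha>'(N := \<alpha>' N - 1) \<circ> inv (theta N) = \<alpha>"
    by (simp add: comp_assoc permutes_inv_o(1)[OF t])
  then have "mulx N (act tau (inv (theta N)) (zeta tau \<alpha> T)) \<alpha>' =
      rho (inv (theta N)) (rho (inv (rank N \<alpha>)) (bvec T))"
    by (simp add: mulx_def act_def zeta_eigv(2)[OF \<alpha> T] \<alpha>')
  also have "\<dots> = rho (inv (theta N) \<circ> inv (rank N \<alpha>)) (bvec T)"
    using rho_comp[OF permutes_inv[OF t] permutes_inv[OF rank_permutes] bvec_in_V[OF T]] by simp
  also have "inv (theta N) \<circ> inv (rank N \<alpha>) = inv (rank N \<alpha>')"
    unfolding rank_raise[OF N \<alpha>']
    by (rule o_inv_distrib[symmetric]) (use permutes_bij[OF t] permutes_bij[OF rank_permutes] in auto)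
  finally show "mulx N (act tau (inv (theta N)) (zeta tau \<alpha> T)) \<alpha>' = rho (inv (rank N \<alpha>')) (bvec T)" .
qed

end

section \<open>Dunkl operators on joint eigenvectors\<close>

context young_shape
begin

lemma act_zero: "act tau w (\<lambda>\<beta> S. 0) = (\<lambda>\<beta> S. 0)"
  using act_scale[of tau w 0 "\<lambda>\<beta> S. 0"] by simp

lemma Dunkl_zero: "Dunkl tau i (\<lambda>\<beta> S. 0) = (\<lambda>\<beta> S. 0)"
  using Dunkl_scale[of tau i 0 "\<lambda>\<beta> S. 0"] by simp

lemma Dunkl_adjacent:
  assumes i: "1 \<le> i" "i < N" and f: "f \<in> PV"
  defines "s \<equiv> tr i (Suc i)"
  shows "Dunkl tau i (act tau s f) = act tau s (Dunkl tau (Suc i) f)"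
    and "Dunkl tau i f = act tau s (Dunkl tau (Suc i) (act tau s f))"
proof -
  have s: "s permutes {1..N}" unfolding s_def using i by (intro tr_permutes) auto
  have iN: "Suc i \<in> {1..N}" using i by auto
  have *: "act tau s (Dunkl tau (Suc i) f) = Dunkl tau i (act tau s f)" if "f \<in> PV" for f
    using act_Dunkl[OF s iN that] by (simp add: s_def)
  show "Dunkl tau i (act tau s f) = act tau s (Dunkl tau (Suc i) f)"
    using *[OF f] by simp
  have "act tau s (act tau s f) = f"
    using act_comp[OF s s f] f by (simp add: s_def)
  then show "Dunkl tau i f = act tau s (Dunkl tau (Suc i) (act tau s f))"
    using *[OF act_in_PV[OF s f]] by simp
qed

lemma Uop_last:
  assumes "1 \<le> N"
  shows "Uop tau N f \<beta> S = mulx N (Dunkl tau N f) \<beta> S + f \<beta> S"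
  using Uop_eq[of N f \<beta> S] assms by simp

text \<open>At the last index \<open>x\<^sub>N D\<^sub>N = U\<^sub>N - 1\<close>, and multiplication
  by \<open>x\<^sub>N\<close> can be cancelled.\<close>

lemma Dunkl_last_eigv:
  assumes N: "1 \<le> N" and f: "eigv lam f" and g: "f = mulx N g"
  shows "Dunkl tau N f = (\<lambda>\<beta> S. (lam N - 1) * g \<beta> S)"
proof (rule mulx_inj, intro ext)
  fix \<beta> S
  have "Uop tau N f \<beta> S = lam N * f \<beta> S"
    using f N by (simp add: eigv_def)
  then have "mulx N (Dunkl tau N f) \<beta> S = (lam N - 1) * f \<beta> S"
    using Uop_last[OF N, of f \<beta> S] by (simp add: algebra_simps)
  then show "mulx N (Dunkl tau N f) \<beta> S = mulx N (\<lambda>\<beta> S. (lam N - 1) * g \<beta> S) \<beta> S"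
    by (simp add: mulx_scale g)
qed

text \<open>Where the exponent vanishes from \<open>i\<close> on, \<open>s\<^sub>i f\<close> is a combination of \<open>f\<close> and of an
  eigenvector with the same exponent (or \<open>0\<close>), and both are killed by \<open>Dunkl tau (Suc i)\<close>.\<close>

lemma Dunkl_eigv_zero:
  assumes "eigv (spec \<alpha> c) f" and \<alpha>: "monomial_exp N \<alpha>"
    and "i \<in> {1..N}" and "\<And>j. j \<in> {i..N} \<Longrightarrow> \<alpha> j = 0"
  shows "Dunkl tau i f = (\<lambda>\<beta> S. 0)"
  using assms(1,3,4)
proof (induction "N - i" arbitrary: i c f)
  case 0
  then have iN: "i = N" and N: "1 \<le> N" by auto
  show ?case
  proof (cases "\<exists>\<beta>. f \<beta> \<noteq> vzero")
    case False
    then have "f = (\<lambda>\<beta> S. 0)" by (auto simp: fun_eq_iff vzero_def)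
    then show ?thesis by (simp only: Dunkl_zero)
  next
    case True
    then obtain S where "S \<in> Y" and c: "\<forall>i\<in>{1..N}. c i = content (rank N \<alpha> i) S"
      using eigv_leading(2)[OF 0(2) \<alpha>] by blast
    have "rank N \<alpha> N = N"
      using 0 iN by (intro rank_fixed) auto
    \<comment> \<open>Exponent 0 at \<open>N\<close> makes \<open>N\<close> its own rank, and the
      entry \<open>N\<close> has content 0. With eigenvalue 1 nothing is left for
      \<open>x\<^sub>N D\<^sub>N f\<close>.\<close>
    then have "spec \<alpha> c N = 1"
      using c content_last[OF \<open>S \<in> Y\<close> N] 0 iN N by (simp add: spec_def)
    then have "mulx N (Dunkl tau N f) \<beta> S = 0" for \<beta> S
      using 0(2) N Uop_last[OF N, of f \<beta> S] by (simp add: eigv_def)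
    then have "mulx N (Dunkl tau N f) = mulx N (\<lambda>\<beta> S. 0)"
      by (auto simp: fun_eq_iff mulx_def vzero_def)
    then show ?thesis using mulx_inj iN by blast
  qed
next
  case (Suc d)
  then have i: "1 \<le> i" "i < N" by auto
  have fP: "f \<in> PV" using Suc.prems(1) Pol_PV by (simp add: eigv_def)
  let ?s = "tr i (Suc i)"
  have z: "\<alpha> i = 0" "\<alpha> (Suc i) = 0" using Suc.prems(3) i by auto
  have IH: "Dunkl tau (Suc i) g = (\<lambda>\<beta> S. 0)" if "eigv (spec \<alpha> c) g" for c g
    using Suc.hyps(1)[of "Suc i", OF _ that] Suc.hyps(2) Suc.prems(3) i by auto
  show ?case
  proof (cases "\<exists>\<beta>. f \<beta> \<noteq> vzero")
    case False
    then have "f = (\<lambda>\<beta> S. 0)" by (auto simp: fun_eq_iff vzero_def)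
    then show ?thesis by (simp only: Dunkl_zero)
  next
    case True
    then obtain S where S: "S \<in> Y" and c: "\<forall>i\<in>{1..N}. c i = content (rank N \<alpha> i) S"
      using eigv_leading(2)[OF Suc.prems(1) \<alpha>] by blast
    have r: "rank N \<alpha> i = i" "rank N \<alpha> (Suc i) = Suc i"
      using Suc.prems(3) i by (auto intro!: rank_fixed)
    have "spec \<alpha> c i \<noteq> spec \<alpha> c (Suc i)"
    proof
      assume "spec \<alpha> c i = spec \<alpha> c (Suc i)"
      then have "spec \<alpha> c i - spec \<alpha> c (Suc i) = 0" by simp
      from kappa_transcendental(2)[OF this[unfolded spec_diff]]
      have "gap i S = 0" using c r i by (simp add: gap_def)
      then show False using gap_nonzero[OF S i] by simp
    qed
    from eigv_swap[OF Suc.prems(1) i this] obtain b where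
      g: "eigv (spec \<alpha> c \<circ> ?s) (\<lambda>\<beta> S. act tau ?s f \<beta> S - b * f \<beta> S)" by blast
    \<comment> \<open>Both exponents are 0, so the exchange only permutes \<open>c\<close> and the
      induction hypothesis covers the new eigenvector for the same \<alpha>, whether or not it is
      0.\<close>
    have sp: "spec \<alpha> c \<circ> ?s = spec \<alpha> (c \<circ> ?s)"
    proof
      fix k
      show "(spec \<alpha> c \<circ> ?s) k = spec \<alpha> (c \<circ> ?s) k"
        by (cases "k = i"; cases "k = Suc i") (simp_all add: spec_def z)
    qed
    have g0: "Dunkl tau (Suc i) (\<lambda>\<beta> S. act tau ?s f \<beta> S - b * f \<beta> S) = (\<lambda>\<beta> S. 0)"
      by (rule IH[OF g[unfolded sp]])
    have "act tau ?s f = (\<lambda>\<beta> S. 1 * (act tau ?s f \<beta> S - b * f \<beta> S) + b * f \<beta> S)"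
      by simp
    then have "Dunkl tau (Suc i) (act tau ?s f) = (\<lambda>\<beta> S. 0)"
      using Dunkl_lin[of tau "Suc i" 1 "\<lambda>\<beta> S. act tau ?s f \<beta> S - b * f \<beta> S" b f] g0 IH[OF Suc.prems(1)]
      by simp
    then show ?thesis
      using Dunkl_adjacent(2)[OF i fP] by (simp add: act_zero)
  qed
qed

end

section \<open>Moving the last nonzero part to the end\<close>

locale dunkl_step = young_shape +
  fixes \<alpha> :: "nat \<Rightarrow> nat" and m :: nat and T :: tableau
  assumes \<alpha>: "monomial_exp N \<alpha>"
    and decreasing: "\<forall>i\<in>{1..N}. \<forall>j\<in>{1..N}. i \<le> j \<longrightarrow> \<alpha> j \<le> \<alpha> i"
    and m: "0 < m" "m < N" and pos: "0 < \<alpha> m" and zero: "\<And>i. m < i \<Longrightarrow> \<alpha> i = 0"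
    and T: "T \<in> RSYT tau"
begin

definition shifted :: "nat \<Rightarrow> nat \<Rightarrow> nat" where
  "shifted j = (\<lambda>i. if i = j then \<alpha> m else if i < m then \<alpha> i else 0)"

definition zdiff :: "nat \<Rightarrow> K" where
  "zdiff j = of_nat (\<alpha> m) + kappa * of_int (content m T - content j T)"

lemma shifted_m: "shifted m = \<alpha>"
  using zero by (auto simp: shifted_def fun_eq_iff not_less le_less)

lemma monomial_shifted: "m \<le> j \<Longrightarrow> j \<le> N \<Longrightarrow> monomial_exp N (shifted j)"
  using \<alpha> m by (auto simp: monomial_exp_def shifted_def)

lemma shifted_Suc: "m \<le> j \<Longrightarrow> shifted (Suc j) = shifted j \<circ> tr j (Suc j)"
  by (auto simp: shifted_def fun_eq_iff tr_def)

lemma rank_shifted_Suc: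
  assumes "m \<le> j" "j < N"
  shows "rank N (shifted (Suc j)) = rank N (shifted j) \<circ> tr j (Suc j)"
  unfolding shifted_Suc[OF assms(1)]
  by (rule rank_swap) (use assms m pos in \<open>auto simp: shifted_def\<close>)

lemma rank_shifted:
  assumes "m \<le> j" "j \<le> N"
  shows "rank N (shifted j) j = m"
  using assms
proof (induction j rule: dec_induct)
  case base
  show ?case
    unfolding shifted_m by (rule rank_fixed) (use m decreasing in auto)
next
  case (step j)
  then show ?case by (simp add: rank_shifted_Suc)
qed

lemma rank_shifted_next:
  assumes "m \<le> j" "j < N"
  shows "rank N (shifted j) (Suc j) = Suc j"
  by (rule rank_fixed) (use assms m in \<open>auto simp: shifted_def\<close>)

abbreviation Z :: "nat \<Rightarrow> pvec" where
  "Z j \<equiv> zeta tau (shifted j) T"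

lemma zdiff_nonzero: "zdiff j \<noteq> 0"
  using kappa_transcendental(1)[of "int (\<alpha> m)" "content m T - content j T"] pos
  by (auto simp: zdiff_def)

text \<open>The exchange is applied to \<open>Z (Suc j)\<close>, whose exponent lies below
  \<open>shifted j\<close>. So \<open>Z (Suc j)\<close> has no term at \<open>shifted j\<close>, the
  leading coefficient comes from the exchanged summand alone, and no rescaling arises. The plus sign
  reflects the spectral difference \<open>- zdiff (Suc j)\<close>.\<close>

lemma zeta_shifted_step:
  assumes j: "m \<le> j" "j < N"
  shows "Z j = (\<lambda>\<beta> S. act tau (tr j (Suc j)) (Z (Suc j)) \<beta> S + kappa / zdiff (Suc j) * Z (Suc j) \<beta> S)"
proof (rule zeta_eqI[OF monomial_shifted[OF j(1) less_imp_le[OF j(2)]] T])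
  let ?s = "tr j (Suc j)" and ?\<alpha> = "shifted (Suc j)"
  have j1: "1 \<le> j" using j m by simp
  have s: "?s permutes {1..N}" using j1 j by (intro tr_permutes) auto
  have mon: "monomial_exp N ?\<alpha>" by (rule monomial_shifted) (use j in auto)
  note Z = zeta_eigv[OF mon T]
  have vals: "?\<alpha> j = 0" "?\<alpha> (Suc j) = \<alpha> m" using j by (auto simp: shifted_def)
  have ne: "?\<alpha> j \<noteq> ?\<alpha> (Suc j)" using vals pos by simp
  have ranks: "rank N ?\<alpha> j = Suc j" "rank N ?\<alpha> (Suc j) = m"
    using rank_shifted_next[OF j] rank_shifted[of "Suc j"] rank_shifted_Suc[OF j] j by auto
  have d: "tspec ?\<alpha> T j - tspec ?\<alpha> T (Suc j) = - zdiff (Suc j)"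
    unfolding spec_diff vals ranks by (simp add: zdiff_def algebra_simps)
  have unswap: "?\<alpha> \<circ> ?s = shifted j"
    unfolding shifted_Suc[OF j(1)] by simp
  have "(\<lambda>\<beta> S. act tau ?s (Z (Suc j)) \<beta> S - kappa / - zdiff (Suc j) * Z (Suc j) \<beta> S) =
      (\<lambda>\<beta> S. act tau ?s (Z (Suc j)) \<beta> S + kappa / zdiff (Suc j) * Z (Suc j) \<beta> S)"
    by simp
  then show "eigv (tspec (shifted j) T)
      (\<lambda>\<beta> S. act tau ?s (Z (Suc j)) \<beta> S + kappa / zdiff (Suc j) * Z (Suc j) \<beta> S)"
    using eigv_swap_tspec(1)[OF Z(1) j1 j(2) ne] unfolding d unswap by metis
  have "dlt N ?\<alpha> (shifted j)"
    unfolding unswap[symmetric] by (rule dlt_swap) (use j j1 vals pos in auto)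
  then have "Z (Suc j) (shifted j) = vzero"
    using eigv_leading(1)[OF Z(1) mon, of "shifted j"] not_dlt_refl
      dlt_asym[OF mon monomial_shifted[OF j(1) less_imp_le[OF j(2)]]] by metis
  moreover have "act tau ?s (Z (Suc j)) (shifted j) = rho (inv (rank N (shifted j))) (bvec T)"
  proof -
    have "inv (rank N ?\<alpha>) = inv ?s \<circ> inv (rank N (shifted j))"
      unfolding rank_shifted_Suc[OF j]
      by (rule o_inv_distrib) (use permutes_bij[OF s] permutes_bij[OF rank_permutes] in auto)
    also have "inv ?s = ?s" by (rule inv_equality) auto
    finally have inv: "inv (rank N (shifted j)) = ?s \<circ> inv (rank N ?\<alpha>)"
      by (simp add: fun_eq_iff)
    have "act tau ?s (Z (Suc j)) (shifted j) = rho ?s (Z (Suc j) ?\<alpha>)"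
      by (simp add: act_def shifted_Suc[OF j(1)])
    also have "\<dots> = rho (inv (rank N (shifted j))) (bvec T)"
      unfolding Z(2) inv
      using rho_comp[OF s permutes_inv[OF rank_permutes] bvec_in_V[OF T]] by simp
    finally show ?thesis .
  qed
  ultimately show "(\<lambda>S. act tau ?s (Z (Suc j)) (shifted j) S + kappa / zdiff (Suc j) * Z (Suc j) (shifted j) S)
      = rho (inv (rank N (shifted j))) (bvec T)"
    by (simp add: vzero_def)
qed

text \<open>Applying \<open>D\<^sub>j\<^sub>+\<^sub>1\<close>, which kills \<open>Z j\<close>, to
  the two-term relation and conjugating by the exchange gives \<open>D\<^sub>j
  Z\<^sub>j\<^sub>+\<^sub>1 = - b s\<^sub>j D\<^sub>j\<^sub>+\<^sub>1
  Z\<^sub>j\<^sub>+\<^sub>1\<close>. In \<open>D\<^sub>j Z\<^sub>j\<close> the second summand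
  therefore contributes \<open>- b\<^sup>2\<close>.\<close>

lemma Dunkl_shifted_step:
  assumes j: "m \<le> j" "j < N"
  shows "Dunkl tau j (Z j) =
    (\<lambda>\<beta> S. (1 - (kappa / zdiff (Suc j))^2) * act tau (tr j (Suc j)) (Dunkl tau (Suc j) (Z (Suc j))) \<beta> S)"
proof -
  let ?s = "tr j (Suc j)" and ?b = "kappa / zdiff (Suc j)"
  have j1: "1 \<le> j" using j m by simp
  have mon: "monomial_exp N (shifted j)" "monomial_exp N (shifted (Suc j))"
    by (rule monomial_shifted; use j in auto)+
  have PV: "Z (Suc j) \<in> PV"
    using zeta_eigv(1)[OF mon(2) T] Pol_PV by (simp add: eigv_def)
  have Zj: "Z j = (\<lambda>\<beta> S. 1 * act tau ?s (Z (Suc j)) \<beta> S + ?b * Z (Suc j) \<beta> S)"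
    using zeta_shifted_step[OF j] by simp
  have "Dunkl tau (Suc j) (Z j) = (\<lambda>\<beta> S. 0)"
    by (rule Dunkl_eigv_zero[OF zeta_eigv(1)[OF mon(1) T] mon(1)]) (use j in \<open>auto simp: shifted_def\<close>)
  then have "Dunkl tau (Suc j) (act tau ?s (Z (Suc j))) \<beta> S = - ?b * Dunkl tau (Suc j) (Z (Suc j)) \<beta> S" for \<beta> S
    unfolding Zj Dunkl_lin by (auto simp: fun_eq_iff eq_neg_iff_add_eq_0)
  then have "Dunkl tau (Suc j) (act tau ?s (Z (Suc j))) = (\<lambda>\<beta> S. - ?b * Dunkl tau (Suc j) (Z (Suc j)) \<beta> S)"
    by blast
  then have D: "Dunkl tau j (Z (Suc j)) = (\<lambda>\<beta> S. - ?b * act tau ?s (Dunkl tau (Suc j) (Z (Suc j))) \<beta> S)"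
    using Dunkl_adjacent(2)[OF j1 j(2) PV] by (simp only: act_scale)
  have "Dunkl tau j (Z j) = (\<lambda>\<beta> S. 1 * act tau ?s (Dunkl tau (Suc j) (Z (Suc j))) \<beta> S + ?b * Dunkl tau j (Z (Suc j)) \<beta> S)"
    using arg_cong[OF Zj, of "Dunkl tau j"] unfolding Dunkl_lin Dunkl_adjacent(1)[OF j1 j(2) PV] .
  then show ?thesis
    unfolding D by (simp add: algebra_simps power2_eq_square)
qed

text \<open>This is where the exponent of the theorem arises: undoing a raising step on
  \<open>shifted N\<close> lowers the moved part and puts it in front. Since it is positive,
  \<open>Suc\<close> undoes the truncated subtraction.\<close>

lemma alpha_hat_raise: "shifted N = (alpha_hat m \<alpha> \<circ> theta N)(N := Suc (alpha_hat m \<alpha> 1))"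
  using m pos \<alpha> by (auto simp: fun_eq_iff shifted_def alpha_hat_def theta_apply monomial_exp_def)

lemma monomial_alpha_hat: "monomial_exp N (alpha_hat m \<alpha>)"
  using m by (auto simp: monomial_exp_def alpha_hat_def)

text \<open>At \<open>j = N\<close> the scalar is the last eigenvalue minus 1, where the moved part
  still has rank \<open>m\<close> and so keeps the content of \<open>m\<close>. Going down, each
  exchange is absorbed by
  \<open>inv (theta j) = tr j (Suc j) \<circ> inv (theta (Suc j))\<close>.\<close>

lemma Dunkl_shifted:
  assumes "m \<le> j" "j \<le> N"
  shows "Dunkl tau j (Z j) =
    (\<lambda>\<beta> S. ((of_nat (\<alpha> m) + kappa * of_int (content m T)) * (\<Prod>l\<in>{Suc j..N}. 1 - (kappa / zdiff l)^2)) *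
      act tau (inv (theta j)) (zeta tau (alpha_hat m \<alpha>) T) \<beta> S)"
  using assms
proof (induction "N - j" arbitrary: j)
  case 0
  then have j: "j = N" and N: "1 \<le> N" using m by auto
  have mon: "monomial_exp N (shifted N)" by (rule monomial_shifted) (use m in auto)
  have "tspec (shifted N) T N - 1 = of_nat (\<alpha> m) + kappa * of_int (content m T)"
    using rank_shifted[of N] m by (simp add: spec_def shifted_def)
  then show ?case
    using Dunkl_last_eigv[OF N zeta_eigv(1)[OF mon T] zeta_raise[OF N monomial_alpha_hat T alpha_hat_raise]] j
    by simp
next
  case (Suc d)
  then have j: "m \<le> j" "j < N" by auto
  let ?s = "tr j (Suc j)"
  have s: "?s permutes {1..N}" using m j by (intro tr_permutes) auto
  have t: "theta j permutes {1..N}" "theta (Suc j) permutes {1..N}"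
    by (rule theta_permutes; use j in auto)+
  have "theta (Suc j) = theta j \<circ> ?s"
    using j m by (simp add: theta_def)
  then have "inv (theta (Suc j)) = inv ?s \<circ> inv (theta j)"
    using o_inv_distrib[OF permutes_bij[OF t(1)] permutes_bij[OF s]] by simp
  also have "inv ?s = ?s" by (rule inv_equality) auto
  finally have inv: "inv (theta j) = ?s \<circ> inv (theta (Suc j))"
    by (simp add: fun_eq_iff)
  have PV: "zeta tau (alpha_hat m \<alpha>) T \<in> PV"
    using zeta_eigv(1)[OF monomial_alpha_hat T] Pol_PV by (simp add: eigv_def)
  have IH: "Dunkl tau (Suc j) (Z (Suc j)) = (\<lambda>\<beta> S. ((of_nat (\<alpha> m) + kappa * of_int (content m T)) *
      (\<Prod>l\<in>{Suc (Suc j)..N}. 1 - (kappa / zdiff l)^2)) *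
      act tau (inv (theta (Suc j))) (zeta tau (alpha_hat m \<alpha>) T) \<beta> S)"
    by (rule Suc.hyps(1)) (use Suc.hyps(2) j in auto)
  have "{Suc j..N} = insert (Suc j) {Suc (Suc j)..N}" using j by auto
  then have "(\<Prod>l\<in>{Suc j..N}. 1 - (kappa / zdiff l)^2) =
      (1 - (kappa / zdiff (Suc j))^2) * (\<Prod>l\<in>{Suc (Suc j)..N}. 1 - (kappa / zdiff l)^2)"
    by simp
  then show ?case
    unfolding Dunkl_shifted_step[OF j] IH act_scale act_comp[OF s permutes_inv[OF t(2)] PV, symmetric] inv[symmetric]
    by (simp only: mult_ac)
qed

text \<open>The difference of squares \<open>(z - kappa) (z + kappa)\<close> over
  \<open>z\<^sup>2\<close>; here \<open>z\<close> is nonzero because its integer part \<alpha> m is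
  positive.\<close>

lemma factor_eq:
  "1 - (kappa / zdiff j)^2 =
    (of_nat (\<alpha> m) + kappa * of_int (content m T - content j T - 1)) *
    (of_nat (\<alpha> m) + kappa * of_int (content m T - content j T + 1)) /
    (of_nat (\<alpha> m) + kappa * of_int (content m T - content j T))^2"
proof -
  define z where "z = zdiff j"
  have "of_nat (\<alpha> m) + kappa * of_int (content m T - content j T - 1) = z - kappa"
    "of_nat (\<alpha> m) + kappa * of_int (content m T - content j T + 1) = z + kappa"
    "of_nat (\<alpha> m) + kappa * of_int (content m T - content j T) = z"
    by (simp_all add: z_def zdiff_def algebra_simps)
  moreover have "z \<noteq> 0" using zdiff_nonzero by (simp add: z_def)
  ultimately show ?thesis
    by (simp add: z_def[symmetric] field_simps power2_eq_square)
qed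

end

theorem theorem6p6:
  fixes tau :: "nat list" and N m :: nat and \<alpha> :: "nat \<Rightarrow> nat" and T :: tableau
  assumes "is_partition tau" and "sum_list tau = N"
    and "monomial_exp N \<alpha>"
    and "\<forall>i\<in>{1..N}. \<forall>j\<in>{1..N}. i \<le> j \<longrightarrow> \<alpha> j \<le> \<alpha> i"
    and "ell \<alpha> = m" and "0 < m" and "m < N"
    and "T \<in> RSYT tau"
  shows "Dunkl tau m (zeta tau \<alpha> T) =
    (\<lambda>\<beta> S. ((of_nat (\<alpha> m) + kappa * of_int (content m T)) *
      (\<Prod>j\<in>{m+1..N}.
         (of_nat (\<alpha> m) + kappa * of_int (content m T - content j T - 1)) *
         (of_nat (\<alpha> m) + kappa * of_int (content m T - content j T + 1)) /
         (of_nat (\<alpha> m) + kappa * of_int (content m T - content j T))^2)) *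
      act tau (inv (theta m)) (zeta tau (alpha_hat m \<alpha>) T) \<beta> S)"
proof -
  have \<alpha>0: "\<alpha> i = 0" if "i \<notin> {1..N}" for i
    using assms(3) that by (simp add: monomial_exp_def)
  have sub: "{i. 0 < \<alpha> i} \<subseteq> {1..N}"
    using \<alpha>0 by fastforce
  then have fin: "finite {i. 0 < \<alpha> i}"
    by (rule finite_subset) simp
  \<comment> \<open>\<open>ell\<close> takes the default value 0 on the zero exponent, which
    \<open>0 < m\<close> rules out.\<close>
  have ne: "\<exists>i. 0 < \<alpha> i"
    using assms(5,6) by (auto simp: ell_def split: if_splits)
  then have m: "m = Max {i. 0 < \<alpha> i}"
    using assms(5) by (simp add: ell_def)
  have pos: "0 < \<alpha> m"
    using Max_in[OF fin] ne unfolding m by blast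
  have zero: "\<alpha> i = 0" if "m < i" for i
    using Max_ge[OF fin, of i] that unfolding m[symmetric] by fastforce
  interpret dunkl_step tau N \<alpha> m T
    using assms pos zero by unfold_locales auto
  show ?thesis
    using Dunkl_shifted[of m] m assms(7) unfolding shifted_m factor_eq by simp
qed

end
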